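(* Let $\varphi$ and $\psi$ be nonconstant linear fractional self-maps of $\mathbb D$. Then $$\|C_\psi^*C_\varphi\|_{e,\mathcal D}=\begin{cases}0,&\varphi^{-1}(\mathbb T)\cap\psi^{-1}(\mathbb T)\cap\mathbb T=\varnothing,\\ 1,&\varphi^{-1}(\mathbb T)\cap\psi^{-1}(\mathbb T)\cap\mathbb T\neq\varnothing.\end{cases}$$
   Context: $\mathbb D$ is the open unit disk in $\mathbb C$, $\mathbb T$ is the unit circle, and $dA$ is the normalized area measure on $\mathbb D$. The classical Dirichlet space $\mathcal D=\mathcal D_0$ is the Hilbert space of analytic functions $f$ on $\mathbb D$ with $\|f\|_{\mathcal D}^2=|f(0)|^2+\int_{\mathbb D}|f'(z)|^2\,dA(z)<\infty$, with the associated inner product. A nonconstant linear fractional self-map of $\mathbb D$ is a map $\varphi(z)=\frac{az+b}{cz+d}$ with $ad-bc\neq0$ and $\varphi(\mathbb D)\subset\mathbb D$; it extends analytically to a neighborhood of $\overline{\mathbb D}$. Thus $\varphi^{-1}(\mathbb T)\cap\psi^{-1}(\mathbb T)\cap\mathbb T=\{\lambda\in\mathbb T:|\varphi(\lambda)|=|\psi(\lambda)|=1\}$. The composition operator is $C_\varphi f=f\circ\varphi$; for such $\varphi$ it is bounded on $\mathcal D$. $C_\psi^*$ is the Hilbert space adjoint of $C_\psi$ on $\mathcal D$. For a bounded operator $T$ on a Hilbert space $\mathcal H$, the essential norm is $\|T\|_{e,\mathcal H}=\inf\{\|T-K\|:K\text{ compact on }\mathcal H\}$. *)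

theory Defs
  imports "HOL-Complex_Analysis.Complex_Analysis"
begin

section \<open>The Dirichlet space\<close>

abbreviation disk :: "complex set" where
  "disk \<equiv> ball 0 1"

text \<open>
  Functions on the disk are represented by total functions that vanish off the disk, so that
  equality of elements is equality on the disk.  The normalized area measure is
  \<^term>\<open>lborel\<close> on the disk divided by \<^term>\<open>pi\<close>.
\<close>

definition dirichlet_space :: "(complex \<Rightarrow> complex) set" where
  "dirichlet_space = {f. f holomorphic_on disk
      \<and> set_integrable lborel disk (\<lambda>z. (cmod (deriv f z))\<^sup>2)
      \<and> (\<forall>z. z \<notin> disk \<longrightarrow> f z = 0)}"

definition dinner_fun :: "(complex \<Rightarrow> complex) \<Rightarrow> (complex \<Rightarrow> complex) \<Rightarrow> complex" where
  "dinner_fun f g = f 0 * cnj (g 0)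
      + (LINT z:disk|lborel. deriv f z * cnj (deriv g z)) / of_real pi"

lemma dirichlet_holo: "f \<in> dirichlet_space \<Longrightarrow> f holomorphic_on disk"
  by (simp add: dirichlet_space_def)

lemma dirichlet_deriv_cont:
  assumes "f \<in> dirichlet_space"
  shows "continuous_on disk (deriv f)"
  using holomorphic_deriv[OF dirichlet_holo[OF assms]] holomorphic_on_imp_continuous_on by blast

lemma dirichlet_field_diff:
  assumes "f \<in> dirichlet_space" "z \<in> disk"
  shows "f field_differentiable at z"
  using dirichlet_holo[OF assms(1)] assms(2) holomorphic_on_imp_differentiable_at open_ball by blast

lemma dirichlet_prod_integrable:
  assumes f: "f \<in> dirichlet_space" and g: "g \<in> dirichlet_space"
  shows "set_integrable lborel disk (\<lambda>z. deriv f z * cnj (deriv g z))"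
proof -
  have i: "set_integrable lborel disk (\<lambda>z. (cmod (deriv f z))\<^sup>2 + (cmod (deriv g z))\<^sup>2)"
    using f g by (intro set_integral_add) (auto simp: dirichlet_space_def)
  have m: "(\<lambda>z. indicator disk z *\<^sub>R (deriv f z * cnj (deriv g z))) \<in> borel_measurable lborel"
    using dirichlet_deriv_cont[OF f] dirichlet_deriv_cont[OF g]
    by (simp, intro borel_measurable_continuous_on_indicator) (auto intro!: continuous_intros)
  have b: "a * b \<le> a\<^sup>2 + b\<^sup>2" if "a \<ge> 0" "b \<ge> 0" for a b :: real
    using sum_squares_bound[of a b] mult_nonneg_nonneg[OF that] by linarith
  show ?thesis
    unfolding set_integrable_def
    by (rule Bochner_Integration.integrable_bound[OF i[unfolded set_integrable_def] m])
       (auto simp: norm_mult indicator_def b)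
qed

lemma set_integrable_disk_cong:
  assumes "\<And>z. z \<in> disk \<Longrightarrow> f z = g z" "set_integrable lborel disk g"
  shows "set_integrable lborel disk f"
  by (subst set_integrable_cong[OF refl refl assms(1)]) (auto intro: assms(2))

lemma dirichlet_zero: "(\<lambda>_. 0) \<in> dirichlet_space"
  by (simp add: dirichlet_space_def set_integrable_def)

lemma dirichlet_scale:
  assumes f: "f \<in> dirichlet_space"
  shows "(\<lambda>z. c * f z) \<in> dirichlet_space"
proof -
  have "set_integrable lborel disk (\<lambda>z. (cmod c)\<^sup>2 * (cmod (deriv f z))\<^sup>2)"
    using f by (intro set_integrable_mult_right) (auto simp: dirichlet_space_def)
  then have "set_integrable lborel disk (\<lambda>z. (cmod (deriv (\<lambda>z. c * f z) z))\<^sup>2)"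
    by (rule set_integrable_disk_cong[rotated])
       (simp add: deriv_cmult dirichlet_field_diff[OF f] norm_mult power_mult_distrib)
  then show ?thesis
    using f by (auto simp: dirichlet_space_def intro!: holomorphic_intros)
qed

lemma dirichlet_add:
  assumes f: "f \<in> dirichlet_space" and g: "g \<in> dirichlet_space"
  shows "(\<lambda>z. f z + g z) \<in> dirichlet_space"
proof -
  note df = dirichlet_field_diff[OF f] dirichlet_field_diff[OF g]
  have i: "set_integrable lborel disk (\<lambda>z. 2 * (cmod (deriv f z))\<^sup>2 + 2 * (cmod (deriv g z))\<^sup>2)"
    using f g by (intro set_integral_add set_integrable_mult_right) (auto simp: dirichlet_space_def)
  have m: "(\<lambda>z. indicator disk z *\<^sub>R (cmod (deriv f z + deriv g z))\<^sup>2) \<in> borel_measurable lborel"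
    using dirichlet_deriv_cont[OF f] dirichlet_deriv_cont[OF g]
    by (simp only: measurable_lborel1 measurable_lborel2, intro borel_measurable_continuous_on_indicator)
       (auto intro!: continuous_intros)
  have b: "(cmod (x + y))\<^sup>2 \<le> 2 * (cmod x)\<^sup>2 + 2 * (cmod y)\<^sup>2" for x y
  proof -
    have "(cmod (x + y))\<^sup>2 \<le> (cmod x + cmod y)\<^sup>2"
      by (intro power_mono norm_triangle_ineq) auto
    also have "\<dots> \<le> 2 * (cmod x)\<^sup>2 + 2 * (cmod y)\<^sup>2"
      using sum_squares_bound[of "cmod x" "cmod y"] by (simp add: power2_sum)
    finally show ?thesis .
  qed
  have "set_integrable lborel disk (\<lambda>z. (cmod (deriv f z + deriv g z))\<^sup>2)"
    unfolding set_integrable_def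
    by (rule Bochner_Integration.integrable_bound[OF i[unfolded set_integrable_def] m])
       (auto simp: indicator_def b)
  then have "set_integrable lborel disk (\<lambda>z. (cmod (deriv (\<lambda>z. f z + g z) z))\<^sup>2)"
    by (rule set_integrable_disk_cong[rotated]) (simp add: deriv_add df)
  then show ?thesis
    using f g by (auto simp: dirichlet_space_def intro!: holomorphic_intros)
qed

lemma dirichlet_uminus: "f \<in> dirichlet_space \<Longrightarrow> (\<lambda>z. - f z) \<in> dirichlet_space"
  using dirichlet_scale[of f "-1"] by simp

lemma dirichlet_diff:
  "f \<in> dirichlet_space \<Longrightarrow> g \<in> dirichlet_space \<Longrightarrow> (\<lambda>z. f z - g z) \<in> dirichlet_space"
  using dirichlet_add[of f "\<lambda>z. - g z"] dirichlet_uminus[of g] by simp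

lemma dinner_fun_add:
  assumes "f \<in> dirichlet_space" "g \<in> dirichlet_space" "h \<in> dirichlet_space"
  shows "dinner_fun (\<lambda>z. f z + g z) h = dinner_fun f h + dinner_fun g h"
proof -
  have "(LINT z:disk|lborel. deriv (\<lambda>z. f z + g z) z * cnj (deriv h z))
      = (LINT z:disk|lborel. deriv f z * cnj (deriv h z) + deriv g z * cnj (deriv h z))"
    using assms by (intro set_lebesgue_integral_cong)
      (auto simp: deriv_add dirichlet_field_diff algebra_simps)
  also have "\<dots> = (LINT z:disk|lborel. deriv f z * cnj (deriv h z))
      + (LINT z:disk|lborel. deriv g z * cnj (deriv h z))"
    using assms by (intro set_integral_add dirichlet_prod_integrable)
  finally show ?thesis
    by (simp add: dinner_fun_def algebra_simps add_divide_distrib)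
qed

lemma dinner_fun_scale:
  assumes "f \<in> dirichlet_space"
  shows "dinner_fun (\<lambda>z. c * f z) h = c * dinner_fun f h"
proof -
  have "(LINT z:disk|lborel. deriv (\<lambda>z. c * f z) z * cnj (deriv h z))
      = (LINT z:disk|lborel. c * (deriv f z * cnj (deriv h z)))"
    using assms by (intro set_lebesgue_integral_cong)
      (auto simp: deriv_cmult dirichlet_field_diff algebra_simps)
  then show ?thesis
    by (simp add: dinner_fun_def algebra_simps)
qed

lemma dinner_fun_commute: "dinner_fun g f = cnj (dinner_fun f g)"
proof -
  have "cnj (LINT z:disk|lborel. deriv f z * cnj (deriv g z))
      = (LINT z:disk|lborel. deriv g z * cnj (deriv f z))"
    unfolding set_lebesgue_integral_def
    by (subst Bochner_Integration.integral_cnj[symmetric])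
       (simp add: scaleR_conv_of_real mult_ac)
  then show ?thesis
    by (simp add: dinner_fun_def mult_ac)
qed

lemma dinner_fun_self:
  "dinner_fun f f
    = of_real ((cmod (f 0))\<^sup>2 + (LINT z:disk|lborel. (cmod (deriv f z))\<^sup>2) / pi)"
proof -
  have "(LINT z:disk|lborel. deriv f z * cnj (deriv f z))
      = (LINT z:disk|lborel. of_real ((cmod (deriv f z))\<^sup>2))"
    by (simp add: complex_norm_square[symmetric] del: of_real_power)
  then show ?thesis
    by (simp add: dinner_fun_def complex_norm_square[symmetric] set_integral_complex_of_real
        del: of_real_power)
qed

lemma dirichlet_integral_nonneg: "0 \<le> (LINT z:disk|lborel. (cmod (deriv f z))\<^sup>2)"
  unfolding set_lebesgue_integral_def by (intro Bochner_Integration.integral_nonneg) auto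

lemma dinner_fun_self_eq_0:
  assumes f: "f \<in> dirichlet_space" and 0: "dinner_fun f f = 0"
  shows "f = (\<lambda>_. 0)"
proof -
  have s: "(cmod (f 0))\<^sup>2 + (LINT z:disk|lborel. (cmod (deriv f z))\<^sup>2) / pi = 0"
    using 0 unfolding dinner_fun_self of_real_eq_0_iff .
  have q: "(LINT z:disk|lborel. (cmod (deriv f z))\<^sup>2) / pi \<ge> 0"
    using dirichlet_integral_nonneg[of f] by simp
  have f0: "f 0 = 0" and i0: "(LINT z:disk|lborel. (cmod (deriv f z))\<^sup>2) = 0"
    using s q zero_le_power2[of "cmod (f 0)"] by (auto simp: add_nonneg_eq_0_iff)
  have int: "integrable lborel (\<lambda>z. indicator disk z *\<^sub>R (cmod (deriv f z))\<^sup>2)"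
    using f by (simp add: dirichlet_space_def set_integrable_def)
  have "AE z in lborel. indicator disk z *\<^sub>R (cmod (deriv f z))\<^sup>2 = 0"
    using i0 int unfolding set_lebesgue_integral_def
    by (subst (asm) integral_nonneg_eq_0_iff_AE) auto
  then have ae: "AE z in lborel. z \<notin> {z \<in> disk. deriv f z \<noteq> 0}"
    by eventually_elim (auto simp: indicator_def split: if_splits)
  have op: "open {z \<in> disk. deriv f z \<noteq> 0}"
  proof -
    have "open (disk \<inter> deriv f -` (- {0}))"
      by (rule continuous_open_preimage[OF dirichlet_deriv_cont[OF f]]) auto
    moreover have "disk \<inter> deriv f -` (- {0}) = {z \<in> disk. deriv f z \<noteq> 0}" by auto
    ultimately show ?thesis by simp
  qed
  have "{z \<in> disk. deriv f z \<noteq> 0} \<in> null_sets lborel"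
    using ae op by (subst AE_iff_null_sets) auto
  then have "negligible {z \<in> disk. deriv f z \<noteq> 0}"
    by (simp add: negligible_iff_null_sets null_sets_completionI)
  then have d0: "deriv f z = 0" if "z \<in> disk" for z
    using open_not_negligible[OF op] that by auto
  have "\<exists>c. \<forall>z\<in>disk. f z = c"
  proof (rule has_field_derivative_zero_constant)
    fix z :: complex assume z: "z \<in> disk"
    have "(f has_field_derivative deriv f z) (at z)"
      using dirichlet_field_diff[OF f z] field_differentiable_derivI by blast
    then show "(f has_field_derivative 0) (at z within disk)"
      using d0[OF z] has_field_derivative_at_within by force
  qed auto
  then obtain c where c: "\<And>z. z \<in> disk \<Longrightarrow> f z = c" by blast
  from c[of 0] f0 have "c = 0" by simp
  with c f show ?thesis by (force simp: dirichlet_space_def)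
qed

typedef dirichlet = dirichlet_space
  morphisms dfun Abs_dirichlet
  using dirichlet_zero by blast

setup_lifting type_definition_dirichlet

lift_definition dscale :: "complex \<Rightarrow> dirichlet \<Rightarrow> dirichlet" is "\<lambda>c f z. c * f z"
  by (rule dirichlet_scale)

lift_definition dinner :: "dirichlet \<Rightarrow> dirichlet \<Rightarrow> complex" is dinner_fun .

text \<open>
  The distribution has no class of complex inner product spaces.  The type is made an instance of
  \<^class>\<open>real_inner\<close> with the real part of \<^term>\<open>dinner\<close>, which induces
  the same norm; complex scalars and the complex inner product stay available as
  \<^term>\<open>dscale\<close> and \<^term>\<open>dinner\<close>.
\<close>

instantiation dirichlet :: real_inner
begin

lift_definition zero_dirichlet :: dirichlet is "\<lambda>_. 0"
  by (rule dirichlet_zero)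

lift_definition plus_dirichlet :: "dirichlet \<Rightarrow> dirichlet \<Rightarrow> dirichlet" is "\<lambda>f g z. f z + g z"
  by (rule dirichlet_add)

lift_definition uminus_dirichlet :: "dirichlet \<Rightarrow> dirichlet" is "\<lambda>f z. - f z"
  by (rule dirichlet_uminus)

lift_definition minus_dirichlet :: "dirichlet \<Rightarrow> dirichlet \<Rightarrow> dirichlet" is "\<lambda>f g z. f z - g z"
  by (rule dirichlet_diff)

definition scaleR_dirichlet :: "real \<Rightarrow> dirichlet \<Rightarrow> dirichlet" where
  "scaleR_dirichlet r = dscale (of_real r)"

lift_definition norm_dirichlet :: "dirichlet \<Rightarrow> real" is
  "\<lambda>f. sqrt ((cmod (f 0))\<^sup>2 + (LINT z:disk|lborel. (cmod (deriv f z))\<^sup>2) / pi)" .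

definition inner_dirichlet :: "dirichlet \<Rightarrow> dirichlet \<Rightarrow> real" where
  "inner_dirichlet f g = Re (dinner f g)"

definition dist_dirichlet :: "dirichlet \<Rightarrow> dirichlet \<Rightarrow> real" where
  "dist_dirichlet f g = norm (f - g)"

definition sgn_dirichlet :: "dirichlet \<Rightarrow> dirichlet" where
  "sgn_dirichlet f = inverse (norm f) *\<^sub>R f"

definition uniformity_dirichlet :: "(dirichlet \<times> dirichlet) filter" where
  "uniformity_dirichlet = (INF e\<in>{0<..}. principal {(x, y). dist x y < e})"

definition open_dirichlet :: "dirichlet set \<Rightarrow> bool" where
  "open_dirichlet U \<longleftrightarrow> (\<forall>x\<in>U. eventually (\<lambda>(x', y). x' = x \<longrightarrow> y \<in> U) uniformity)"

instance
proof
  fix f g h :: dirichlet and r s :: real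
  show "f + g + h = f + (g + h)" by transfer (simp add: add.assoc)
  show "f + g = g + f" by transfer (simp add: add.commute)
  show "0 + f = f" by transfer simp
  show "- f + f = 0" by transfer simp
  show "f - g = f + - g" by transfer simp
  show "r *\<^sub>R (f + g) = r *\<^sub>R f + r *\<^sub>R g"
    unfolding scaleR_dirichlet_def by transfer (simp add: algebra_simps)
  show "(r + s) *\<^sub>R f = r *\<^sub>R f + s *\<^sub>R f"
    unfolding scaleR_dirichlet_def by transfer (simp add: algebra_simps)
  show "r *\<^sub>R s *\<^sub>R f = (r * s) *\<^sub>R f"
    unfolding scaleR_dirichlet_def by transfer (simp add: algebra_simps)
  show "1 *\<^sub>R f = f"
    unfolding scaleR_dirichlet_def by transfer simp
  show "dist f g = norm (f - g)" by (rule dist_dirichlet_def)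
  show "sgn f = inverse (norm f) *\<^sub>R f" by (rule sgn_dirichlet_def)
  show "inner f g = inner g f"
    unfolding inner_dirichlet_def by transfer (metis dinner_fun_commute complex_cnj cnj.sel(1))
  show "inner (f + g) h = inner f h + inner g h"
    unfolding inner_dirichlet_def by transfer (simp add: dinner_fun_add)
  show "inner (r *\<^sub>R f) g = r * inner f g"
    unfolding inner_dirichlet_def scaleR_dirichlet_def by transfer (simp add: dinner_fun_scale)
  show "0 \<le> inner f f"
    unfolding inner_dirichlet_def
    by transfer (simp add: dinner_fun_self dirichlet_integral_nonneg)
  show "norm f = sqrt (inner f f)"
    unfolding inner_dirichlet_def
    by transfer (simp add: dinner_fun_self)
  show "inner f f = 0 \<longleftrightarrow> f = 0"
  proof
    assume "inner f f = 0"
    then show "f = 0"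
      unfolding inner_dirichlet_def
    proof transfer
      fix f assume f: "f \<in> dirichlet_space" and "Re (dinner_fun f f) = 0"
      then have "dinner_fun f f = 0" by (simp add: dinner_fun_self)
      with f show "f = (\<lambda>_. 0)" by (rule dinner_fun_self_eq_0)
    qed
  next
    assume "f = 0"
    then show "inner f f = 0"
      unfolding inner_dirichlet_def by transfer (simp add: dinner_fun_self)
  qed
qed (simp_all add: uniformity_dirichlet_def open_dirichlet_def)

end

section \<open>Operators on the Dirichlet space\<close>

definition clinear_op :: "(dirichlet \<Rightarrow> dirichlet) \<Rightarrow> bool" where
  "clinear_op T \<longleftrightarrow> (\<forall>f g. T (f + g) = T f + T g) \<and> (\<forall>c f. T (dscale c f) = dscale c (T f))"

definition compact_op :: "(dirichlet \<Rightarrow> dirichlet) \<Rightarrow> bool" where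
  "compact_op K \<longleftrightarrow> clinear_op K \<and> compact (closure (K ` cball 0 1))"

definition ess_norm :: "(dirichlet \<Rightarrow> dirichlet) \<Rightarrow> real" where
  "ess_norm T = Inf {onorm (\<lambda>f. T f - K f) |K. compact_op K}"

definition hadjoint :: "(dirichlet \<Rightarrow> dirichlet) \<Rightarrow> dirichlet \<Rightarrow> dirichlet" where
  "hadjoint T = (THE S. \<forall>f g. dinner (T f) g = dinner f (S g))"

text \<open>
  For a linear fractional self-map the composite lies in \<^term>\<open>dirichlet_space\<close>, so
  \<^term>\<open>Abs_dirichlet\<close> is applied within its domain there.
\<close>

definition comp_op :: "(complex \<Rightarrow> complex) \<Rightarrow> dirichlet \<Rightarrow> dirichlet" where
  "comp_op \<phi> f = Abs_dirichlet (\<lambda>z. if z \<in> disk then dfun f (\<phi> z) else 0)"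

text \<open>
  A linear fractional map without pole in the disk that maps the disk into itself is bounded
  there, so it has no pole on the unit circle either; the formula therefore describes the
  analytic extension at every point of the closed disk.
\<close>

definition linear_fractional_self_map :: "(complex \<Rightarrow> complex) \<Rightarrow> bool" where
  "linear_fractional_self_map \<phi> \<longleftrightarrow>
     (\<exists>a b c d. a * d - b * c \<noteq> 0
        \<and> (\<forall>z\<in>disk. c * z + d \<noteq> 0)
        \<and> (\<forall>z\<in>cball 0 1. \<phi> z = (a * z + b) / (c * z + d)))
     \<and> \<phi> ` disk \<subseteq> disk"

end

theory Submission
  imports Defs
begin

text \<open>
  Since \<open>\<phi>\<close> and \<open>\<psi>\<close> are univalent, the operator \<open>T = C\<^sub>\<psi>\<^sup>* C\<^sub>\<phi>\<close> is described by
  \<open>\<langle>T f, g\<rangle> = f (\<phi> 0) cnj (g (\<psi> 0)) + (1/\<pi>) \<integral> (f \<circ> \<phi>)' cnj ((g \<circ> \<psi>)') dA\<close>,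
  where the first summand has rank one. The change of variables \<open>w = \<phi> z\<close> gives
  \<open>\<integral> |(f \<circ> \<phi>)'|\<^sup>2 dA = \<integral> |f'|\<^sup>2 dA\<close> over \<open>\<phi> ` disk\<close>, which is at most the integral over the disk, so
  the second summand is bounded by \<open>\<parallel>f\<parallel> \<parallel>g\<parallel>\<close>. Hence the essential norm is always at most 1
  (\<open>ess_norm_le_1\<close>).

  If no point of the circle is mapped into the circle by both maps, compactness of the closed disk
  yields \<open>r < 1\<close> such that at every point of the disk \<open>|\<phi>| \<le> r\<close> or \<open>|\<psi>| \<le> r\<close>. On
  \<open>|w| \<le> r\<close> the derivative \<open>h'\<close> of any \<open>h\<close> is approximated by its Taylor polynomials with an
  error of at most \<open>\<parallel>h\<parallel>\<close> times the tail of \<open>\<Sum> (n + 1) r\<^sup>n\<close>, because its coefficients are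
  inner products of \<open>h\<close> with the functions \<open>z\<^sup>n\<^sup>+\<^sup>1\<close>. Replacing \<open>f'\<close> by its Taylor polynomial where
  \<open>|\<phi>| \<le> r\<close> and \<open>g'\<close> by its Taylor polynomial elsewhere changes the form by little and leaves
  the form of an operator of finite rank (\<open>ess_norm_le_bergman_tail\<close>, \<open>ess_norm_eq_0\<close>).

  If \<open>|\<phi> l| = |\<psi> l| = 1\<close> for some \<open>l\<close> on the circle, let \<open>w\<close> tend to \<open>l\<close> radially and let
  \<open>k\<^sub>w\<close> be the normalised reproducing kernel at \<open>w\<close>. The kernel has norm
  \<open>sqrt (1 - ln (1 - |w|\<^sup>2))\<close>, and \<open>1 - |\<phi> w| = O(1 - |w|)\<close>, so in the limit the kernel at
  \<open>\<phi> w\<close> is at least as long as the one at \<open>w\<close>. By the reproducing property the inner product of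
  \<open>C\<^sub>\<phi> k\<^bsub>\<phi> w\<^esub>\<close> with \<open>k\<^sub>w\<close> is the quotient of these two norms; since \<open>C\<^sub>\<phi>\<close> asymptotically does not
  increase the norm of \<open>k\<^bsub>\<phi> w\<^esub>\<close>, it follows that \<open>C\<^sub>\<phi> k\<^bsub>\<phi> w\<^esub> - k\<^sub>w\<close> tends to 0
  (\<open>comp_op_nkernel_asymptotics\<close>). The same holds for \<open>\<psi>\<close>, so
  \<open>\<langle>T k\<^bsub>\<phi> w\<^esub>, k\<^bsub>\<psi> w\<^esub>\<rangle> = \<langle>C\<^sub>\<phi> k\<^bsub>\<phi> w\<^esub>, C\<^sub>\<psi> k\<^bsub>\<psi> w\<^esub>\<rangle>\<close> tends to 1. Normalised kernels tend weakly to 0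
  at the circle, so subtracting a compact operator does not change this limit
  (\<open>ess_norm_ge_1\<close>).

  The Hilbert space background consists of the reproducing kernel, obtained from the Taylor
  coefficients of \<open>f'\<close> as area integrals, and the completeness of the space, which gives the
  Riesz representation theorem and thereby the adjoint.
\<close>

section \<open>Area change of variables for injective holomorphic maps\<close>

text \<open>
  The change of variables theorem concerns maps of \<^typ>\<open>real^2\<close>; this identification with
  the complex plane carries it over to holomorphic maps.
\<close>

definition vec_to_complex :: "real^2 \<Rightarrow> complex" where "vec_to_complex x = Complex (x $ 1) (x $ 2)"
definition complex_to_vec :: "complex \<Rightarrow> real^2" where "complex_to_vec z = vector [Re z, Im z]"

lemma vec_to_complex_to_vec [simp]: "vec_to_complex (complex_to_vec z) = z" and complex_to_vec_to_complex [simp]: "complex_to_vec (vec_to_complex x) = x"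
  by (simp_all add: vec_to_complex_def complex_to_vec_def vec_eq_iff forall_2)

lemma linear_vec_to_complex: "linear vec_to_complex"
  by (rule linearI) (simp_all add: vec_to_complex_def complex_eq_iff)

lemma linear_complex_to_vec: "linear complex_to_vec"
  by (rule linearI) (simp_all add: complex_to_vec_def vec_eq_iff forall_2)

lemma bounded_linear_vec_to_complex: "bounded_linear vec_to_complex" and bounded_linear_complex_to_vec: "bounded_linear complex_to_vec"
  using linear_vec_to_complex linear_complex_to_vec linear_conv_bounded_linear by blast+

lemma vec_to_complex_borel [measurable]: "vec_to_complex \<in> borel_measurable borel"
  by (simp add: bounded_linear_vec_to_complex borel_measurable_continuous_onI linear_continuous_on)

lemma lborel_distr_vec_to_complex: "distr lborel borel vec_to_complex = lborel"
proof (rule lborel_eqI[symmetric])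
  fix l u :: complex assume le: "\<And>b. b \<in> Basis \<Longrightarrow> l \<bullet> b \<le> u \<bullet> b"
  have "vec_to_complex -` box l u = box (complex_to_vec l) (complex_to_vec u)"
    by (auto simp: vec_to_complex_def complex_to_vec_def mem_box Basis_vec_def Basis_complex_def inner_axis forall_2)
  moreover have "emeasure lborel (box (complex_to_vec l) (complex_to_vec u)) = (\<Prod>b\<in>Basis. (u - l) \<bullet> b)"
    using le[of 1] le[of \<i>] by (subst emeasure_lborel_box)
      (auto simp: complex_to_vec_def Basis_vec_def Basis_complex_def inner_axis forall_2 UNIV_2 axis_eq_axis mult.commute)
  ultimately show "emeasure (distr lborel borel vec_to_complex) (box l u) = (\<Prod>b\<in>Basis. (u - l) \<bullet> b)"
    by (simp add: emeasure_distr)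
qed simp

text \<open>
  Multiplication by \<open>d = a + b\<i>\<close> has the real matrix with rows \<open>(a, -b)\<close> and \<open>(b, a)\<close>, so the
  Jacobian determinant of a holomorphic map is the squared modulus of its derivative.
\<close>

lemma det_complex_mult: "det (matrix (\<lambda>h. complex_to_vec (d * vec_to_complex h))) = (cmod d)\<^sup>2"
  unfolding cmod_power2 by (simp add: det_2 matrix_def complex_to_vec_def vec_to_complex_def power2_eq_square axis_def)

text \<open>
  The set is described as \<open>B\<close> rather than as an image, so that its measurability is an assumption
  and the preimage is measurable by continuity. Both sides may be infinite.
\<close>

lemma emeasure_holomorphic_image:
  assumes S: "open S" and hol: "f holomorphic_on S" and inj: "inj_on f S"
    and B: "B \<in> sets borel" "B \<subseteq> f ` S"
  shows "emeasure lborel B = (\<integral>\<^sup>+z. ennreal ((cmod (deriv f z))\<^sup>2) * indicator (S \<inter> f -` B) z \<partial>lborel)"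
proof -
  define A where "A = S \<inter> f -` B"
  define F where "F x = complex_to_vec (f (vec_to_complex x))" for x
  define J where "J x = (cmod (deriv f (vec_to_complex x)))\<^sup>2" for x
  have contf: "continuous_on S f" using hol by (rule holomorphic_on_imp_continuous_on)
  have Ab: "A \<in> sets borel"
  proof -
    have "f \<in> borel_measurable (restrict_space borel S)"
      using contf by (rule borel_measurable_continuous_on_restrict)
    then have "f -` B \<inter> space (restrict_space borel S) \<in> sets (restrict_space borel S)"
      using B(1) by (rule measurable_sets)
    then show ?thesis
      using S by (auto simp: sets_restrict_space space_restrict_space A_def Int_commute)
  qed
  have fA: "f ` A = B" using B(2) by (auto simp: A_def)
  define A' where "A' = vec_to_complex -` A"
  have A'b: "A' \<in> sets borel" unfolding A'_def using Ab by (metis vec_to_complex_borel inf_top.right_neutral measurable_sets space_borel)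
  have A'l: "A' \<in> sets lebesgue" using A'b by (simp add: sets_completionI_sets)
  have FA: "F ` A' = vec_to_complex -` B"
  proof -
    have "F ` A' = complex_to_vec ` (f ` A)"
      unfolding A'_def F_def by (force simp: image_iff intro: bexI[of _ "complex_to_vec _"])
    also have "\<dots> = vec_to_complex -` B" unfolding fA by (auto simp: image_iff) (metis complex_to_vec_to_complex)
    finally show ?thesis .
  qed
  have der: "(F has_derivative (\<lambda>h. complex_to_vec (deriv f (vec_to_complex x) * vec_to_complex h))) (at x within A')" if "x \<in> A'" for x
  proof -
    have "vec_to_complex x \<in> S" using that by (auto simp: A'_def A_def)
    then have "(f has_field_derivative deriv f (vec_to_complex x)) (at (vec_to_complex x))"
      using hol S holomorphic_derivI by blast
    then have d: "(f has_derivative (\<lambda>h. deriv f (vec_to_complex x) * h)) (at (vec_to_complex x))"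
      by (simp add: has_field_derivative_def)
    have c: "(vec_to_complex has_derivative vec_to_complex) (at x within A')"
      by (rule bounded_linear_imp_has_derivative[OF bounded_linear_vec_to_complex])
    have "((\<lambda>x. complex_to_vec (f (vec_to_complex x))) has_derivative (\<lambda>h. complex_to_vec (deriv f (vec_to_complex x) * vec_to_complex h))) (at x within A')"
      by (rule bounded_linear.has_derivative[OF bounded_linear_complex_to_vec has_derivative_compose[OF c d]])
    then show ?thesis unfolding F_def .
  qed
  have injF: "inj_on F A'"
    unfolding F_def A'_def A_def using inj by (auto simp: inj_on_def) (metis vec_to_complex_to_vec complex_to_vec_to_complex)
  have Jm: "(\<lambda>x. J x * indicator A' x) \<in> borel_measurable borel"
  proof -
    have "continuous_on S (\<lambda>z. (cmod (deriv f z))\<^sup>2)"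
      using hol S by (intro continuous_intros holomorphic_on_imp_continuous_on holomorphic_deriv) auto
    then have "(\<lambda>z. indicator S z *\<^sub>R (cmod (deriv f z))\<^sup>2) \<in> borel_measurable borel"
      using S by (intro borel_measurable_continuous_on_indicator) auto
    then have "(\<lambda>x. (indicator S (vec_to_complex x) *\<^sub>R (cmod (deriv f (vec_to_complex x)))\<^sup>2) * indicator A' x) \<in> borel_measurable borel"
      using A'b by measurable
    also have "(\<lambda>x. (indicator S (vec_to_complex x) *\<^sub>R (cmod (deriv f (vec_to_complex x)))\<^sup>2) * indicator A' x) = (\<lambda>x. J x * indicator A' x)"
      by (auto simp: indicator_def J_def A'_def A_def)
    finally show ?thesis .
  qed
  \<comment> \<open>The equivalence settles finite and infinite measure alike: one side is finite iff the other is.\<close>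
  have ch: "F ` A' \<in> lmeasurable \<and> measure lebesgue (F ` A') = m \<longleftrightarrow> (J has_integral m) A'" for m
    using has_measure_differentiable_image[OF A'l der injF, of m]
    by (simp add: det_complex_mult J_def[abs_def])
  have eq: "emeasure lborel (vec_to_complex -` B) = (\<integral>\<^sup>+x. ennreal (J x) * indicator A' x \<partial>lborel)"
  proof -
    have preB: "vec_to_complex -` B \<in> sets borel" using B(1) by (metis vec_to_complex_borel inf_top.right_neutral measurable_sets space_borel)
    have Ji: "(\<lambda>x. J x * indicator A' x) = (\<lambda>x. if x \<in> A' then J x else 0)"
      by (auto simp: indicator_def)
    have nn: "(\<integral>\<^sup>+x. ennreal (J x) * indicator A' x \<partial>lborel) = (\<integral>\<^sup>+x. ennreal (J x * indicator A' x) \<partial>lborel)"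
      by (auto intro!: nn_integral_cong simp: indicator_def)
    show ?thesis
    proof (cases "emeasure lborel (vec_to_complex -` B) < \<infinity>")
      case True
      then have "F ` A' \<in> lmeasurable"
        using preB unfolding FA by (simp add: fmeasurable_def sets_completionI_sets)
      then have "(J has_integral measure lebesgue (vec_to_complex -` B)) A'"
        using ch FA by metis
      then have "((\<lambda>x. J x * indicator A' x) has_integral measure lebesgue (vec_to_complex -` B)) UNIV"
        unfolding Ji by (simp add: has_integral_restrict_UNIV)
      moreover have "0 \<le> J x * indicator A' x" for x by (auto simp: J_def)
      ultimately have "(\<integral>\<^sup>+x. ennreal (J x * indicator A' x) \<partial>lborel) = ennreal (measure lebesgue (vec_to_complex -` B))"
        using Jm by (intro nn_integral_has_integral_lborel) auto
      also have "\<dots> = emeasure lborel (vec_to_complex -` B)"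
        using True preB by (simp add: emeasure_eq_ennreal_measure)
      finally show ?thesis using nn by simp
    next
      case False
      then have inf: "emeasure lborel (vec_to_complex -` B) = \<infinity>" by (simp add: less_top[symmetric])
      have "(\<integral>\<^sup>+x. ennreal (J x * indicator A' x) \<partial>lborel) = \<infinity>"
      proof (rule ccontr)
        assume *: "\<not> ?thesis"
        then have "integrable lborel (\<lambda>x. J x * indicator A' x)"
          using Jm by (intro integrableI_nonneg) (auto simp: J_def less_top[symmetric])
        then have "(\<lambda>x. J x * indicator A' x) integrable_on UNIV"
          using has_integral_integral_lborel by blast
        then have "J integrable_on A'"
          unfolding Ji by (simp add: integrable_restrict_UNIV)
        then have "F ` A' \<in> lmeasurable" using ch by (metis integrable_integral)
        then show False using inf preB by (simp add: FA fmeasurable_def)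
      qed
      then show ?thesis using inf nn by simp
    qed
  qed
  have "emeasure lborel B = emeasure lborel (vec_to_complex -` B)"
    using B(1) by (subst lborel_distr_vec_to_complex[symmetric]) (simp add: emeasure_distr)
  also have "\<dots> = (\<integral>\<^sup>+x. ennreal (J x * indicator A' x) \<partial>lborel)"
    unfolding eq by (auto intro!: nn_integral_cong simp: indicator_def)
  also have "\<dots> = (\<integral>\<^sup>+x. ennreal ((cmod (indicator S (vec_to_complex x) *\<^sub>R deriv f (vec_to_complex x)))\<^sup>2 * indicator A (vec_to_complex x)) \<partial>lborel)"
    by (auto intro!: nn_integral_cong simp: indicator_def J_def A'_def A_def)
  also have "\<dots> = (\<integral>\<^sup>+z. ennreal ((cmod (indicator S z *\<^sub>R deriv f z))\<^sup>2 * indicator A z) \<partial>distr lborel borel vec_to_complex)"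
  proof -
    define D where "D z = indicator S z *\<^sub>R deriv f z" for z
    have D: "D \<in> borel_measurable borel"
      unfolding D_def using hol S
      by (intro borel_measurable_continuous_on_indicator holomorphic_on_imp_continuous_on holomorphic_deriv) auto
    have "(\<lambda>z. ennreal ((cmod (D z))\<^sup>2 * indicator A z)) \<in> borel_measurable borel"
      using D Ab by measurable
    then show ?thesis unfolding D_def[symmetric] by (simp add: nn_integral_distr)
  qed
  also have "\<dots> = (\<integral>\<^sup>+z. ennreal ((cmod (deriv f z))\<^sup>2) * indicator (S \<inter> f -` B) z \<partial>lborel)"
    unfolding lborel_distr_vec_to_complex by (auto intro!: nn_integral_cong simp: indicator_def A_def)
  finally show ?thesis .
qed

text \<open>
  By the formula for sets, the image under \<open>f\<close> of the measure with density \<open>|f'|\<^sup>2\<close> on \<open>S\<close> is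
  Lebesgue measure on \<open>f ` S\<close>. Off \<open>S\<close> the map is replaced by 0 to make it measurable
  on the whole plane; the density vanishes there.
\<close>

lemma nn_integral_holomorphic_image:
  assumes S: "open S" and hol: "f holomorphic_on S" and inj: "inj_on f S"
    and g: "g \<in> borel_measurable borel" and fS: "f ` S \<in> sets borel"
  shows "(\<integral>\<^sup>+z. g z * indicator (f ` S) z \<partial>lborel)
       = (\<integral>\<^sup>+z. g (f z) * ennreal ((cmod (deriv f z))\<^sup>2) * indicator S z \<partial>lborel)"
proof -
  define f1 where "f1 z = indicator S z *\<^sub>R f z" for z
  define J where "J z = indicator S z * ennreal ((cmod (indicator S z *\<^sub>R deriv f z))\<^sup>2)" for z
  have [measurable]: "f1 \<in> borel_measurable borel"
    using hol S unfolding f1_def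
    by (intro borel_measurable_continuous_on_indicator holomorphic_on_imp_continuous_on) auto
  have [measurable]: "(\<lambda>z. indicator S z *\<^sub>R deriv f z) \<in> borel_measurable borel"
    using hol S by (intro borel_measurable_continuous_on_indicator holomorphic_on_imp_continuous_on holomorphic_deriv) auto
  have [measurable]: "S \<in> sets borel" using S by auto
  have [measurable]: "J \<in> borel_measurable borel" unfolding J_def by measurable
  note [measurable] = fS g
  have m: "distr (density lborel J) borel f1 = density lborel (indicator (f ` S))"
  proof (rule measure_eqI)
    fix B assume "B \<in> sets (distr (density lborel J) borel f1)"
    then have [measurable]: "B \<in> sets borel" by simp
    have "emeasure (distr (density lborel J) borel f1) B = (\<integral>\<^sup>+z. J z * indicator (f1 -` B) z \<partial>lborel)"
      using measurable_sets[of f1 borel borel B] by (simp add: emeasure_distr emeasure_density)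
    also have "\<dots> = (\<integral>\<^sup>+z. ennreal ((cmod (deriv f z))\<^sup>2) * indicator (S \<inter> f -` (B \<inter> f ` S)) z \<partial>lborel)"
      by (auto intro!: nn_integral_cong simp: indicator_def J_def f1_def)
    also have "\<dots> = emeasure lborel (B \<inter> f ` S)"
      by (rule emeasure_holomorphic_image[OF S hol inj, symmetric]) auto
    also have "\<dots> = emeasure (density lborel (indicator (f ` S))) B"
      by (simp add: emeasure_density nn_integral_indicator flip: indicator_inter_arith)
        (simp add: Int_commute)
    finally show "emeasure (distr (density lborel J) borel f1) B = emeasure (density lborel (indicator (f ` S))) B" .
  qed simp
  have "(\<integral>\<^sup>+z. g z * indicator (f ` S) z \<partial>lborel) = (\<integral>\<^sup>+z. g z \<partial>density lborel (indicator (f ` S)))"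
    by (simp add: nn_integral_density mult.commute)
  also have "\<dots> = (\<integral>\<^sup>+z. J z * g (f1 z) \<partial>lborel)"
    unfolding m[symmetric] by (simp add: nn_integral_distr nn_integral_density)
  also have "\<dots> = (\<integral>\<^sup>+z. g (f z) * ennreal ((cmod (deriv f z))\<^sup>2) * indicator S z \<partial>lborel)"
    by (auto intro!: nn_integral_cong simp: indicator_def J_def f1_def mult_ac)
  finally show ?thesis .
qed

section \<open>Taylor coefficients as area integrals\<close>

lemma borel_measurable_cnj [measurable]: "cnj \<in> borel_measurable borel"
  by (intro borel_measurable_continuous_onI continuous_intros)

lemma ball_in_borel [measurable]: "ball c r \<in> sets borel"
  by simp

lemma emeasure_ball_complex_not_top [simp]: "emeasure lborel (ball (c::complex) r) \<noteq> top"
  using emeasure_lborel_ball_finite[of c r] by auto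

lemma lborel_distr_rotation:
  fixes \<omega> :: complex
  assumes "cmod \<omega> = 1"
  shows "distr lborel borel (\<lambda>z. \<omega> * z) = lborel"
proof (rule measure_eqI)
  fix B assume "B \<in> sets (distr lborel borel (\<lambda>z. \<omega> * z))"
  then have B: "B \<in> sets borel" by simp
  have w: "\<omega> \<noteq> 0" using assms by auto
  have "range ((*) \<omega>) = UNIV"
    using w by (metis surj_def nonzero_mult_div_cancel_left times_divide_eq_right)
  then have "emeasure lborel B = (\<integral>\<^sup>+z. indicator ((\<lambda>z. \<omega> * z) -` B) z \<partial>lborel)"
    using emeasure_holomorphic_image[of UNIV "\<lambda>z. \<omega> * z" B] B w assms
    by (simp add: inj_on_def holomorphic_intros)
  also have "\<dots> = emeasure (distr lborel borel (\<lambda>z. \<omega> * z)) B"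
    using B measurable_sets[of "\<lambda>z. \<omega> * z" borel borel B] by (simp add: emeasure_distr)
  finally show "emeasure (distr lborel borel (\<lambda>z. \<omega> * z)) B = emeasure lborel B" by simp
qed simp

lemma set_integral_ball_rotation:
  fixes f :: "complex \<Rightarrow> complex"
  assumes "cmod \<omega> = 1" and [measurable]: "f \<in> borel_measurable borel"
  shows "(LINT z:ball 0 r|lborel. f (\<omega> * z)) = (LINT z:ball 0 r|lborel. f z)"
proof -
  have "(LINT z:ball 0 r|lborel. f z) = (LINT z:ball 0 r|distr lborel borel (\<lambda>z. \<omega> * z). f z)"
    using assms by (simp add: lborel_distr_rotation)
  also have "\<dots> = (LINT z:ball 0 r|lborel. f (\<omega> * z))"
    unfolding set_lebesgue_integral_def using assms
    by (subst integral_distr) (auto simp: indicator_def norm_mult intro!: Bochner_Integration.integral_cong)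
  finally show ?thesis by simp
qed

text \<open>
  A rotation by \<open>t\<close> multiplies the integrand by \<open>cis ((m - n) t)\<close> and preserves the integral;
  choosing \<open>t = \<pi> / (m - n)\<close> makes this factor \<open>-1\<close>.
\<close>

lemma integral_ball_monomials_orthogonal:
  assumes "m \<noteq> n"
  shows "(LINT z:ball 0 r|lborel. z ^ m * cnj z ^ n) = 0"
proof -
  define t where "t = pi / (real m - real n)"
  have d: "real m - real n \<noteq> 0" using assms by simp
  have "cis t ^ m * cnj (cis t) ^ n = cis ((real m - real n) * t)"
    by (simp only: cis_cnj Complex.DeMoivre cis_mult) (simp add: algebra_simps)
  also have "\<dots> = -1" using d by (simp add: t_def)
  finally have e: "cis t ^ m * cnj (cis t) ^ n = -1" .
  have "(LINT z:ball 0 r|lborel. z ^ m * cnj z ^ n) = (LINT z:ball 0 r|lborel. (cis t * z) ^ m * cnj (cis t * z) ^ n)"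
    by (rule set_integral_ball_rotation[symmetric]) auto
  also have "\<dots> = (LINT z:ball 0 r|lborel. (cis t ^ m * cnj (cis t) ^ n) * (z ^ m * cnj z ^ n))"
    by (simp add: power_mult_distrib mult_ac)
  also have "\<dots> = - (LINT z:ball 0 r|lborel. z ^ m * cnj z ^ n)"
    unfolding e by (simp add: set_lebesgue_integral_def)
  finally show ?thesis by simp
qed

lemma set_integrable_ball_bounded:
  fixes f :: "complex \<Rightarrow> 'a::{banach, second_countable_topology}"
  assumes "f \<in> borel_measurable borel" "\<And>z. cmod z < r \<Longrightarrow> norm (f z) \<le> B"
  shows "set_integrable lborel (ball 0 r) f"
  unfolding set_integrable_def
proof (rule Bochner_Integration.integrable_bound)
  show "integrable lborel (\<lambda>z::complex. indicator (ball 0 r) z *\<^sub>R B)"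
    by (intro integrable_scaleR_left integrable_real_indicator) (auto simp: less_top[symmetric])
  show "(\<lambda>z. indicator (ball 0 r) z *\<^sub>R f z) \<in> borel_measurable lborel" using assms(1) unfolding measurable_lborel1 measurable_lborel2 by measurable
  show "AE z in lborel. norm (indicator (ball 0 r) z *\<^sub>R f z) \<le> norm (indicator (ball 0 r) z *\<^sub>R B)"
    using assms(2) by (intro AE_I2) (auto simp: indicator_def intro: order_trans[OF _ abs_ge_self])
qed

lemma measure_disk_radius:
  assumes "r \<ge> 0"
  shows "measure lborel (ball (0::complex) r) = pi * r\<^sup>2"
  using assms by (simp add: content_ball unit_ball_vol_2)

lemma integral_ball_scaling:
  assumes "0 < r"
  shows "(LINT z:ball (0::complex) r|lborel. cmod z ^ (2*n)) = r ^ (2*n+2) * (LINT z:ball (0::complex) 1|lborel. cmod z ^ (2*n))"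
proof -
  have "lborel = density (distr lborel borel (\<lambda>z::complex. 0 + r *\<^sub>R z)) (\<lambda>_. \<bar>r\<bar>^DIM(complex))"
    using assms by (intro lborel_affine) auto
  then have l: "lborel = density (distr lborel borel (\<lambda>z::complex. r *\<^sub>R z)) (\<lambda>_. ennreal (r\<^sup>2))"
    by simp
  have m: "(\<lambda>z::complex. indicator (ball 0 r) z * cmod z ^ (2*n)) \<in> borel_measurable borel"
    by measurable
  have "(LINT z:ball (0::complex) r|lborel. cmod z ^ (2*n))
     = (LINT z|density (distr lborel borel (\<lambda>z::complex. r *\<^sub>R z)) (\<lambda>_. ennreal (r\<^sup>2)). indicator (ball 0 r) z *\<^sub>R cmod z ^ (2*n))"
    unfolding set_lebesgue_integral_def using l by simp
  also have "\<dots> = (LINT z|lborel. r\<^sup>2 * (indicator (ball (0::complex) r) (r *\<^sub>R z) *\<^sub>R cmod (r *\<^sub>R z) ^ (2*n)))"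
    using m by (simp add: integral_density integral_distr)
  also have "\<dots> = (LINT z|lborel. r ^ (2*n+2) * (indicator (ball (0::complex) 1) z *\<^sub>R cmod z ^ (2*n)))"
  proof (rule Bochner_Integration.integral_cong)
    fix z :: complex
    have "r *\<^sub>R z \<in> ball 0 r \<longleftrightarrow> z \<in> ball 0 1" using assms by simp
    then show "r\<^sup>2 * (indicator (ball 0 r) (r *\<^sub>R z) *\<^sub>R cmod (r *\<^sub>R z) ^ (2*n)) = r ^ (2*n+2) * (indicator (ball 0 1) z *\<^sub>R cmod z ^ (2*n))"
      using assms by (simp add: indicator_def power_mult_distrib power_add power2_eq_square)
  qed simp
  finally show ?thesis by (simp add: set_lebesgue_integral_def)
qed

text \<open>
  Let \<open>J\<close> be the integral and \<open>0 < r < 1\<close>. Scaling shows that the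
  shell between the radii \<open>r\<close> and \<open>1\<close> contributes \<open>J (1 - r\<^bsup>2n+2\<^esup>)\<close>; on the other hand, its area
  is \<open>\<pi> (1 - r\<^sup>2)\<close> and the integrand on it lies between \<open>r\<^bsup>2n\<^esup>\<close> and \<open>1\<close>. Dividing by \<open>1 - r\<^sup>2\<close>
  and letting \<open>x = r\<^sup>2\<close> tend to 1 turns this into \<open>J (n + 1) = \<pi>\<close>.
\<close>

lemma integral_disk_norm_power:
  "(LINT z:ball (0::complex) 1|lborel. cmod z ^ (2*n)) = pi / (real n + 1)"
proof -
  define J where "J r = (LINT z:ball (0::complex) r|lborel. cmod z ^ (2*n))" for r
  have int: "set_integrable lborel (ball (0::complex) r) (\<lambda>z. cmod z ^ (2*n))" for r
    by (rule set_integrable_ball_bounded[of _ _ "r ^ (2*n)"]) (auto intro!: power_mono)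
  have bounds: "J 1 * (\<Sum>k<Suc n. x ^ k) \<in> {x ^ n * pi .. pi}" if x: "0 < x" "x < 1" for x
  proof -
    define r where "r = sqrt x"
    have r: "0 < r" "r < 1" "r\<^sup>2 = x" using x by (auto simp: r_def)
    define S where "S = ball (0::complex) 1 - ball 0 r"
    have sub: "ball (0::complex) r \<subseteq> ball 0 1" using r by auto
    have Sm: "S \<in> sets lborel" by (auto simp: S_def)
    have iS: "set_integrable lborel S (\<lambda>z. cmod z ^ (2*n))"
      by (rule set_integrable_subset[OF int[of 1] Sm]) (auto simp: S_def)
    have "ball (0::complex) 1 = S \<union> ball 0 r" using sub by (auto simp: S_def)
    then have "J 1 = (LINT z:S|lborel. cmod z ^ (2*n)) + J r"
      unfolding J_def using iS int[of r]
      by (subst set_integral_Un[symmetric]) (auto simp: S_def)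
    then have JS: "J 1 * (1 - r ^ (2*n+2)) = (LINT z:S|lborel. cmod z ^ (2*n))"
      using integral_ball_scaling[OF r(1), of n] by (simp add: J_def algebra_simps)
    have eS: "emeasure lborel S < \<infinity>"
      unfolding S_def by (rule le_less_trans[OF emeasure_mono[of _ "ball 0 1"]]) (auto simp: less_top[symmetric])
    have mS: "measure lborel S = pi * (1 - x)"
      unfolding S_def using r sub
      by (subst measure_Diff) (auto simp: measure_disk_radius algebra_simps)
    have iC: "set_integrable lborel S (\<lambda>z. c)" for c :: real
      using eS Sm by (simp add: set_integrable_def)
    have IC: "(LINT z:S|lborel. c) = c * measure lborel S" for c :: real
      by (simp add: set_lebesgue_integral_def)
    have ub: "(LINT z:S|lborel. cmod z ^ (2*n)) \<le> (LINT z:S|lborel. 1)"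
      by (rule set_integral_mono[OF iS iC]) (auto simp: S_def power_le_one)
    have lb: "(LINT z:S|lborel. r ^ (2*n)) \<le> (LINT z:S|lborel. cmod z ^ (2*n))"
      using r by (intro set_integral_mono[OF iC iS] power_mono) (auto simp: S_def)
    have g: "1 - r ^ (2*n+2) = (1 - x) * (\<Sum>k<Suc n. x ^ k)"
    proof -
      have "r ^ (2*n+2) = x ^ Suc n" using r(3) by (metis power_mult mult_Suc_right Suc_eq_plus1 distrib_left mult_2 nat_mult_1_right power_Suc add.commute)
      then show ?thesis by (simp only: one_diff_power_eq)
    qed
    have "(1 - x) * (J 1 * (\<Sum>k<Suc n. x ^ k)) \<le> (1 - x) * pi"
      using ub unfolding IC mS JS[symmetric] g by (simp only: mult_ac mult_1)
    moreover have "(1 - x) * (x ^ n * pi) \<le> (1 - x) * (J 1 * (\<Sum>k<Suc n. x ^ k))"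
      using lb unfolding IC mS JS[symmetric] g power_mult[of r 2 n] r(3) by (simp only: mult_ac mult_1)
    ultimately show ?thesis using x by (auto dest!: mult_left_le_imp_le)
  qed
  have ev: "\<forall>\<^sub>F x in at_left 1. 0 < x \<and> x < (1::real)"
    using eventually_at_left_real[of 0 1] by (auto elim: eventually_mono)
  have l1: "((\<lambda>x. J 1 * (\<Sum>k<Suc n. x ^ k)) \<longlongrightarrow> J 1 * (\<Sum>k<Suc n. 1 ^ k)) (at_left (1::real))"
    by (intro tendsto_intros)
  have l2: "((\<lambda>x. x ^ n * pi) \<longlongrightarrow> 1 ^ n * pi) (at_left (1::real))"
    by (intro tendsto_intros)
  have "J 1 * (\<Sum>k<Suc n. 1 ^ k) \<le> pi"
    by (rule tendsto_upperbound[OF l1]) (use ev bounds in \<open>auto elim!: eventually_mono\<close>)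
  moreover have "1 ^ n * pi \<le> J 1 * (\<Sum>k<Suc n. 1 ^ k)"
    by (rule tendsto_le[OF _ l1 l2]) (use ev bounds in \<open>auto elim!: eventually_mono\<close>)
  ultimately have "J 1 * (real n + 1) = pi" by (simp add: add.commute)
  then show ?thesis by (simp add: J_def field_simps)
qed

text \<open>
  Dominated convergence, for integrands that may be unbounded near the circle.
\<close>

lemma integral_ball_tendsto_disk:
  fixes g :: "complex \<Rightarrow> 'a::{banach, second_countable_topology}"
  assumes g: "set_integrable lborel disk g"
    and R: "\<And>k. R k < 1" and RL: "R \<longlonglongrightarrow> 1"
  shows "(\<lambda>k. LINT z:ball 0 (R k)|lborel. g z) \<longlonglongrightarrow> (LINT z:disk|lborel. g z)"
  unfolding set_lebesgue_integral_def
proof (rule integral_dominated_convergence[where w = "\<lambda>z. norm (indicator disk z *\<^sub>R g z)"])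
  have m: "(\<lambda>z. indicator disk z *\<^sub>R g z) \<in> borel_measurable borel"
    using borel_measurable_integrable[OF g[unfolded set_integrable_def]] by simp
  then show "(\<lambda>z. indicator disk z *\<^sub>R g z) \<in> borel_measurable lborel" by simp
  show "(\<lambda>z. indicator (ball 0 (R k)) z *\<^sub>R g z) \<in> borel_measurable lborel" for k
  proof -
    have "(\<lambda>z. indicator (ball 0 (R k)) z *\<^sub>R (indicator disk z *\<^sub>R g z)) \<in> borel_measurable borel"
      using m by measurable
    also have "(\<lambda>z. indicator (ball 0 (R k)) z *\<^sub>R (indicator disk z *\<^sub>R g z)) = (\<lambda>z. indicator (ball 0 (R k)) z *\<^sub>R g z)"
      using R[of k] by (auto simp: indicator_def)
    finally show ?thesis by simp
  qed
  show "integrable lborel (\<lambda>z. norm (indicator disk z *\<^sub>R g z))"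
    using g unfolding set_integrable_def by (rule integrable_norm)
  show "AE z in lborel. norm (indicator (ball 0 (R k)) z *\<^sub>R g z) \<le> norm (indicator disk z *\<^sub>R g z)" for k
    using R[of k] by (auto simp: indicator_def)
  show "AE z in lborel. (\<lambda>k. indicator (ball 0 (R k)) z *\<^sub>R g z) \<longlonglongrightarrow> indicator disk z *\<^sub>R g z"
  proof (rule AE_I2)
    fix z :: complex
    show "(\<lambda>k. indicator (ball 0 (R k)) z *\<^sub>R g z) \<longlonglongrightarrow> indicator disk z *\<^sub>R g z"
    proof (cases "z \<in> disk")
      case True
      then have "\<forall>\<^sub>F k in sequentially. cmod z < R k" using order_tendstoD(1)[OF RL] by auto
      then show ?thesis using True by (intro tendsto_eventually) (auto elim!: eventually_mono)
    next
      case False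
      then have "z \<notin> ball 0 (R k)" for k using R[of k] by auto
      then show ?thesis using False by simp
    qed
  qed
qed

text \<open>
  On a smaller disk the power series of \<open>h\<close> converges uniformly, so it may be integrated term by
  term, and orthogonality leaves the \<open>n\<close>-th term only. The radius then tends to 1.
\<close>

lemma integral_disk_holomorphic_coeff:
  assumes hol: "h holomorphic_on disk" and int: "set_integrable lborel disk h"
  shows "(LINT z:disk|lborel. h z * cnj z ^ n) = of_real pi / of_nat (Suc n) * ((deriv ^^ n) h 0 / fact n)"
proof -
  define c where "c m = (deriv ^^ m) h 0 / fact m" for m
  have ser: "(\<lambda>m. c m * z ^ m) sums h z" if "z \<in> disk" for z
    using holomorphic_power_series[OF hol that] by (simp add: c_def)
  have hm: "(\<lambda>z. indicator disk z *\<^sub>R h z) \<in> borel_measurable borel"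
    using hol by (intro borel_measurable_continuous_on_indicator holomorphic_on_imp_continuous_on) auto
  have part: "(LINT z:ball 0 r|lborel. h z * cnj z ^ n) = c n * (LINT z:ball 0 r|lborel. complex_of_real (cmod z ^ (2*n)))"
    if r: "0 < r" "r < 1" for r
  proof -
    define t where "t m z = indicator (ball 0 r) z *\<^sub>R (c m * (z ^ m * cnj z ^ n))" for m and z :: complex
    have sm: "summable (\<lambda>m. cmod (c m) * r ^ m)"
    proof -
      have "summable (\<lambda>m. c m * of_real ((r + 1) / 2) ^ m)"
        using r by (intro sums_summable[OF ser]) auto
      then have "summable (\<lambda>m. cmod (c m * of_real r ^ m))"
        using r by (intro powser_insidea) auto
      then show ?thesis using r by (simp add: norm_mult norm_power)
    qed
    have tb: "cmod (t m z) \<le> indicator (ball 0 r) z * (cmod (c m) * r ^ m)" for m z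
    proof (cases "cmod z < r")
      case True
      have "cmod z ^ m * cmod z ^ n \<le> r ^ m * 1"
        using True r by (intro mult_mono power_mono power_le_one) auto
      then show ?thesis using True
        by (simp add: t_def norm_mult norm_power mult_left_mono)
    qed (simp add: t_def)
    have ti: "integrable lborel (t m)" for m
      unfolding t_def set_integrable_def[symmetric]
    proof (rule set_integrable_ball_bounded)
      fix z :: complex assume "cmod z < r"
      then show "cmod (c m * (z ^ m * cnj z ^ n)) \<le> cmod (c m) * r ^ m" using tb[of m z] by (simp add: t_def)
    qed measurable
    have nb: "(LINT z|lborel. cmod (t m z)) \<le> measure lborel (ball (0::complex) r) * (cmod (c m) * r ^ m)" for m
    proof -
      have "(LINT z|lborel. cmod (t m z)) \<le> (LINT z|lborel. indicator (ball (0::complex) r) z * (cmod (c m) * r ^ m))"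
        using ti tb by (intro integral_mono integrable_norm integrable_mult_left integrable_real_indicator)
          (auto simp: less_top[symmetric])
      then show ?thesis by simp
    qed
    have s1: "summable (\<lambda>m. LINT z|lborel. cmod (t m z))"
      by (rule summable_comparison_test'[of "\<lambda>m. measure lborel (ball (0::complex) r) * (cmod (c m) * r ^ m)" 0])
        (use nb sm in \<open>auto intro: summable_mult\<close>)
    have s2: "AE z in lborel. summable (\<lambda>m. cmod (t m z))"
    proof (rule AE_I2)
      fix z
      show "summable (\<lambda>m. cmod (t m z))"
        by (rule summable_comparison_test'[of "\<lambda>m. indicator (ball (0::complex) r) z * (cmod (c m) * r ^ m)" 0])
          (use tb sm in \<open>auto intro: summable_mult\<close>)
    qed
    have lim: "(\<lambda>m. t m z) sums (indicator (ball 0 r) z *\<^sub>R (h z * cnj z ^ n))" for z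
    proof (cases "z \<in> ball 0 r")
      case True
      then have "z \<in> disk" using r by auto
      from sums_mult2[OF ser[OF this], of "cnj z ^ n"] True show ?thesis
        by (simp add: t_def mult_ac)
    qed (simp add: t_def)
    have "(\<lambda>m. LINT z|lborel. t m z) sums (LINT z|lborel. (\<Sum>m. t m z))"
      by (rule sums_integral[OF ti s2 s1])
    then have 1: "(\<lambda>m. LINT z|lborel. t m z) sums (LINT z:ball 0 r|lborel. h z * cnj z ^ n)"
      using lim by (simp add: sums_iff set_lebesgue_integral_def)
    have tm: "(LINT z|lborel. t m z) = c m * (LINT z:ball 0 r|lborel. z ^ m * cnj z ^ n)" for m
      by (simp add: t_def set_lebesgue_integral_def mult_ac flip: integral_mult_right_zero)
    have "(\<lambda>m. LINT z|lborel. t m z) sums (LINT z|lborel. t n z)"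
      using sums_finite[of "{n}" "\<lambda>m. LINT z|lborel. t m z"]
      by (simp add: tm integral_ball_monomials_orthogonal)
    with 1 have "(LINT z:ball 0 r|lborel. h z * cnj z ^ n) = (LINT z|lborel. t n z)"
      by (rule sums_unique2)
    also have "\<dots> = c n * (LINT z:ball 0 r|lborel. z ^ n * cnj z ^ n)" by (rule tm)
    also have "(\<lambda>z. z ^ n * cnj z ^ n) = (\<lambda>z. complex_of_real (cmod z ^ (2*n)))"
      by (simp add: power_mult flip: power_mult_distrib complex_norm_square)
    finally show ?thesis .
  qed
  define R where "R k = 1 - 1 / real (k + 2)" for k
  have R: "0 < R k" "R k < 1" for k by (auto simp: R_def field_simps)
  have RL: "R \<longlonglongrightarrow> 1" unfolding R_def by real_asymp
  have m1: "(\<lambda>z. indicator disk z *\<^sub>R (h z * cnj z ^ n)) \<in> borel_measurable borel"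
  proof -
    have "(\<lambda>z. (indicator disk z *\<^sub>R h z) * cnj z ^ n) \<in> borel_measurable borel" using hm by measurable
    then show ?thesis by simp
  qed
  have "set_integrable lborel disk (\<lambda>z. h z * cnj z ^ n)"
    unfolding set_integrable_def
    by (rule Bochner_Integration.integrable_bound[OF int[unfolded set_integrable_def]])
      (use m1 in \<open>auto simp: indicator_def norm_mult norm_power mult_left_le power_le_one\<close>)
  then have "(\<lambda>k. LINT z:ball 0 (R k)|lborel. h z * cnj z ^ n) \<longlonglongrightarrow> (LINT z:disk|lborel. h z * cnj z ^ n)"
    by (rule integral_ball_tendsto_disk[OF _ R(2) RL])
  moreover have "(\<lambda>k. c n * (LINT z:ball 0 (R k)|lborel. complex_of_real (cmod z ^ (2*n))))
      \<longlonglongrightarrow> c n * (LINT z:disk|lborel. complex_of_real (cmod z ^ (2*n)))"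
    by (intro tendsto_mult tendsto_const integral_ball_tendsto_disk[OF _ R(2) RL] set_integrable_ball_bounded[where B = 1])
      (auto simp: power_le_one norm_power)
  ultimately have "(LINT z:disk|lborel. h z * cnj z ^ n) = c n * (LINT z:disk|lborel. complex_of_real (cmod z ^ (2*n)))"
    using part[OF R] LIMSEQ_unique by simp
  also have "(LINT z:disk|lborel. complex_of_real (cmod z ^ (2*n))) = of_real (pi / (real n + 1))"
    unfolding set_integral_complex_of_real integral_disk_norm_power ..
  finally show ?thesis by (simp add: c_def mult.commute add.commute)
qed

section \<open>The inner product of the Dirichlet space\<close>

lemma dinner_formula:
  "dinner f g = dfun f 0 * cnj (dfun g 0)
     + (LINT z:disk|lborel. deriv (dfun f) z * cnj (deriv (dfun g) z)) / of_real pi"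
  by (simp add: dinner.rep_eq dinner_fun_def)

lemma norm_dirichlet_sq:
  "(norm f)\<^sup>2 = (cmod (dfun f 0))\<^sup>2 + (LINT z:disk|lborel. (cmod (deriv (dfun f) z))\<^sup>2) / pi"
  by (simp add: norm_dirichlet.rep_eq dirichlet_integral_nonneg)

lemma dfun_add [simp]: "dfun (f + g) z = dfun f z + dfun g z"
  and dfun_diff [simp]: "dfun (f - g) z = dfun f z - dfun g z"
  and dfun_dscale [simp]: "dfun (dscale c f) z = c * dfun f z"
  and dfun_zero [simp]: "dfun 0 z = 0"
  by (simp_all add: plus_dirichlet.rep_eq minus_dirichlet.rep_eq dscale.rep_eq zero_dirichlet.rep_eq)

lemma dfun_eqI: "(\<And>z. z \<in> disk \<Longrightarrow> dfun f z = dfun g z) \<Longrightarrow> f = g"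
proof -
  assume "\<And>z. z \<in> disk \<Longrightarrow> dfun f z = dfun g z"
  moreover have "z \<notin> disk \<Longrightarrow> dfun f z = dfun g z" for z
    using dfun[of f] dfun[of g] by (simp add: dirichlet_space_def)
  ultimately have "dfun f = dfun g" by blast
  then show ?thesis by (simp add: dfun_inject)
qed

lemma dinner_commute: "dinner g f = cnj (dinner f g)"
  by transfer (rule dinner_fun_commute)

lemma dinner_add_left: "dinner (f + g) h = dinner f h + dinner g h"
  by transfer (rule dinner_fun_add)

lemma dinner_dscale_left: "dinner (dscale c f) h = c * dinner f h"
  by transfer (rule dinner_fun_scale)

lemma dinner_dscale_right: "dinner h (dscale c f) = cnj c * dinner h f"
  by (metis dinner_dscale_left dinner_commute complex_cnj_mult)

lemma dscale_minus_one: "dscale (- 1) f = - f"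
  by (rule dfun_eqI) (simp add: uminus_dirichlet.rep_eq)

lemma dinner_diff_left: "dinner (f - g) h = dinner f h - dinner g h"
  using dinner_add_left[of f "- g" h] dinner_dscale_left[of "-1" g h] by (simp add: dscale_minus_one)

lemma dinner_diff_right: "dinner h (f - g) = dinner h f - dinner h g"
  by (metis dinner_diff_left dinner_commute complex_cnj_diff)

lemma dinner_zero_left [simp]: "dinner 0 h = 0"
  using dinner_diff_left[of 0 0 h] by simp

lemma dinner_sum_left: "dinner (\<Sum>i\<in>I. f i) h = (\<Sum>i\<in>I. dinner (f i) h)"
  by (induction I rule: infinite_finite_induct) (simp_all add: dinner_add_left)

lemma Re_dinner: "Re (dinner f g) = inner f g"
  by (simp add: inner_dirichlet_def)

lemma dinner_self: "dinner f f = of_real ((norm f)\<^sup>2)"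
  unfolding norm_dirichlet_sq by (simp only: dinner.rep_eq dinner_fun_self)

lemma norm_dscale: "norm (dscale c f) = cmod c * norm f"
proof -
  have "complex_of_real ((norm (dscale c f))\<^sup>2) = of_real ((cmod c * norm f)\<^sup>2)"
    unfolding dinner_self[symmetric] dinner_dscale_left dinner_dscale_right power_mult_distrib of_real_mult
    by (simp add: complex_norm_square[of c] dinner_self del: of_real_power)
  then have "(norm (dscale c f))\<^sup>2 = (cmod c * norm f)\<^sup>2" by (simp only: of_real_eq_iff)
  then show ?thesis by (simp add: power2_eq_iff_nonneg)
qed

lemma scaleR_eq_dscale: "r *\<^sub>R f = dscale (of_real r) f"
  by (simp add: scaleR_dirichlet_def)

text \<open>
  The real inner product bounds the real part of \<^term>\<open>dinner f g\<close> only; rotating \<open>f\<close> by the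
  unimodular constant that makes this number real and nonnegative gives its modulus.
\<close>

lemma dinner_Cauchy_Schwarz: "cmod (dinner f g) \<le> norm f * norm g"
proof (cases "dinner f g = 0")
  case False
  define c where "c = cnj (dinner f g) / of_real (cmod (dinner f g))"
  have c1: "cmod c = 1" using False by (simp add: c_def norm_divide)
  have "dinner (dscale c f) g = of_real (cmod (dinner f g))"
    using False unfolding dinner_dscale_left c_def
    by (simp add: complex_norm_square[symmetric] power2_eq_square mult.commute[of "cnj _"])
  then have "cmod (dinner f g) = inner (dscale c f) g" by (simp flip: Re_dinner)
  also have "\<dots> \<le> norm (dscale c f) * norm g" by (rule norm_cauchy_schwarz)
  finally show ?thesis by (simp add: norm_dscale c1)
qed simp

lemma dirichlet_norm_leI:
  assumes "\<And>g. cmod (dinner f g) \<le> C * norm g" and C: "0 \<le> C"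
  shows "norm f \<le> C"
proof (cases "f = 0")
  case False
  have "norm f * norm f \<le> C * norm f"
    using assms(1)[of f] by (simp add: dinner_self power2_eq_square norm_mult)
  then show ?thesis using False by simp
qed (simp add: C)

section \<open>Square-integrable functions on the disk\<close>

text \<open>
  Measurability is required on the disk only, because derivatives of holomorphic functions have
  arbitrary values elsewhere.
\<close>

definition L2_disk :: "(complex \<Rightarrow> complex) set" where
  "L2_disk = {u. (\<lambda>z. indicator disk z *\<^sub>R u z) \<in> borel_measurable borel
     \<and> set_integrable lborel disk (\<lambda>z. (cmod (u z))\<^sup>2)}"

definition norm_L2 :: "(complex \<Rightarrow> complex) \<Rightarrow> real" where
  "norm_L2 u = sqrt ((LINT z:disk|lborel. (cmod (u z))\<^sup>2) / pi)"

lemma norm_L2_nonneg [simp]: "0 \<le> norm_L2 u"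
  and norm_L2_sq: "(norm_L2 u)\<^sup>2 = (LINT z:disk|lborel. (cmod (u z))\<^sup>2) / pi"
proof -
  have "0 \<le> (LINT z:disk|lborel. (cmod (u z))\<^sup>2)"
    unfolding set_lebesgue_integral_def by (intro Bochner_Integration.integral_nonneg) auto
  then show "0 \<le> norm_L2 u" "(norm_L2 u)\<^sup>2 = (LINT z:disk|lborel. (cmod (u z))\<^sup>2) / pi"
    by (simp_all add: norm_L2_def)
qed

lemma L2_disk_boundedI:
  assumes m: "(\<lambda>z. indicator disk z *\<^sub>R u z) \<in> borel_measurable borel" and b: "\<And>z. z \<in> disk \<Longrightarrow> cmod (u z) \<le> B"
  shows "u \<in> L2_disk"
proof -
  have "(\<lambda>z. (cmod (indicator disk z *\<^sub>R u z))\<^sup>2) \<in> borel_measurable borel" using m by measurable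
  then have "set_integrable lborel disk (\<lambda>z. (cmod (indicator disk z *\<^sub>R u z))\<^sup>2)"
    using b by (intro set_integrable_ball_bounded[where B = "B\<^sup>2"]) (auto intro!: power_mono)
  then have "set_integrable lborel disk (\<lambda>z. (cmod (u z))\<^sup>2)"
    by (rule set_integrable_disk_cong[rotated]) auto
  then show ?thesis using m by (simp add: L2_disk_def)
qed

lemma L2_disk_dominated:
  assumes "v \<in> L2_disk" and m: "(\<lambda>z. indicator disk z *\<^sub>R u z) \<in> borel_measurable borel"
    and b: "\<And>z. z \<in> disk \<Longrightarrow> cmod (u z) \<le> cmod (v z)"
  shows "u \<in> L2_disk"
proof -
  have i: "set_integrable lborel disk (\<lambda>z. (cmod (v z))\<^sup>2)" using assms by (simp add: L2_disk_def)
  have "(\<lambda>z. (cmod (indicator disk z *\<^sub>R u z))\<^sup>2) \<in> borel_measurable borel" using m by measurable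
  also have "(\<lambda>z. (cmod (indicator disk z *\<^sub>R u z))\<^sup>2) = (\<lambda>z. indicator disk z *\<^sub>R (cmod (u z))\<^sup>2)"
    by (auto simp: indicator_def)
  finally have "set_integrable lborel disk (\<lambda>z. (cmod (u z))\<^sup>2)"
    unfolding set_integrable_def
    by (intro Bochner_Integration.integrable_bound[OF i[unfolded set_integrable_def]])
      (use b in \<open>auto simp: indicator_def intro!: power_mono\<close>)
  then show ?thesis using m by (simp add: L2_disk_def)
qed

text \<open>
  The Cauchy--Schwarz inequality for the normalised area measure.
\<close>

lemma L2_disk_product:
  assumes u: "u \<in> L2_disk" and v: "v \<in> L2_disk"
  shows "set_integrable lborel disk (\<lambda>z. u z * cnj (v z))"
    and "cmod ((LINT z:disk|lborel. u z * cnj (v z)) / of_real pi) \<le> norm_L2 u * norm_L2 v"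
proof -
  define U where "U z = indicator disk z *\<^sub>R u z" for z
  define V where "V z = indicator disk z *\<^sub>R v z" for z
  have [measurable]: "U \<in> borel_measurable borel" "V \<in> borel_measurable borel"
    using u v by (simp_all add: L2_disk_def U_def[abs_def] V_def[abs_def])
  have UV: "indicator disk z *\<^sub>R (u z * cnj (v z)) = U z * cnj (V z)" for z
    by (simp add: U_def V_def indicator_def)
  have sq: "indicator disk z *\<^sub>R (cmod (u z))\<^sup>2 = (cmod (U z))\<^sup>2" "indicator disk z *\<^sub>R (cmod (v z))\<^sup>2 = (cmod (V z))\<^sup>2" for z
    by (simp_all add: U_def V_def indicator_def)
  have iU: "integrable lborel (\<lambda>z. (cmod (U z))\<^sup>2)" and iV: "integrable lborel (\<lambda>z. (cmod (V z))\<^sup>2)"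
    using u v by (auto simp only: L2_disk_def set_integrable_def sq mem_Collect_eq)
  have b: "a * b \<le> a\<^sup>2 + b\<^sup>2" if "a \<ge> 0" "b \<ge> 0" for a b :: real
    using sum_squares_bound[of a b] mult_nonneg_nonneg[OF that] by linarith
  have int: "integrable lborel (\<lambda>z. U z * cnj (V z))"
    by (rule Bochner_Integration.integrable_bound[OF Bochner_Integration.integrable_add[OF iU iV]])
      (auto simp: norm_mult b)
  then show "set_integrable lborel disk (\<lambda>z. u z * cnj (v z))"
    by (simp add: set_integrable_def UV)
  define A where "A = (LINT z|lborel. (cmod (U z))\<^sup>2)"
  define B where "B = (LINT z|lborel. (cmod (V z))\<^sup>2)"
  have AB: "0 \<le> A" "0 \<le> B" by (simp_all add: A_def B_def)
  have intn: "integrable lborel (\<lambda>z. cmod (U z) * cmod (V z))"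
    using integrable_norm[OF int] by (simp add: norm_mult)
  define I where "I = (LINT z|lborel. cmod (U z) * cmod (V z))"
  have I0: "0 \<le> I" by (simp add: I_def)
  have "(\<integral>\<^sup>+z. ennreal (cmod (U z)) * ennreal (cmod (V z)) \<partial>lborel)\<^sup>2
      \<le> (\<integral>\<^sup>+z. (ennreal (cmod (U z)))\<^sup>2 \<partial>lborel) * (\<integral>\<^sup>+z. (ennreal (cmod (V z)))\<^sup>2 \<partial>lborel)"
    by (intro Cauchy_Schwarz_nn_integral) auto
  also have "(\<integral>\<^sup>+z. (ennreal (cmod (U z)))\<^sup>2 \<partial>lborel) = ennreal A"
    unfolding A_def using iU by (simp add: nn_integral_eq_integral ennreal_power)
  also have "(\<integral>\<^sup>+z. (ennreal (cmod (V z)))\<^sup>2 \<partial>lborel) = ennreal B"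
    unfolding B_def using iV by (simp add: nn_integral_eq_integral ennreal_power)
  also have "(\<integral>\<^sup>+z. ennreal (cmod (U z)) * ennreal (cmod (V z)) \<partial>lborel) = ennreal I"
    unfolding I_def using intn by (simp add: nn_integral_eq_integral flip: ennreal_mult)
  finally have "I\<^sup>2 \<le> A * B"
    using AB I0 by (simp add: ennreal_power flip: ennreal_mult)
  then have "I \<le> sqrt A * sqrt B"
    by (metis real_le_rsqrt real_sqrt_mult)
  moreover have "cmod (LINT z|lborel. U z * cnj (V z)) \<le> I"
    unfolding I_def using integral_norm_bound[of lborel "\<lambda>z. U z * cnj (V z)"] by (simp add: norm_mult)
  ultimately have "cmod (LINT z|lborel. U z * cnj (V z)) / pi \<le> (sqrt A * sqrt B) / pi"
    by (intro divide_right_mono) auto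
  also have "\<dots> = norm_L2 u * norm_L2 v"
    unfolding norm_L2_def set_lebesgue_integral_def sq A_def B_def by (simp add: real_sqrt_divide)
  finally show "cmod ((LINT z:disk|lborel. u z * cnj (v z)) / of_real pi) \<le> norm_L2 u * norm_L2 v"
    by (simp add: set_lebesgue_integral_def UV norm_divide)
qed

lemma norm_L2_mono:
  assumes "u \<in> L2_disk" "v \<in> L2_disk" "\<And>z. z \<in> disk \<Longrightarrow> cmod (u z) \<le> cmod (v z)"
  shows "norm_L2 u \<le> norm_L2 v"
  unfolding norm_L2_def using assms
  by (auto simp: L2_disk_def intro!: divide_right_mono set_integral_mono power_mono)

lemma norm_L2_cmult: "norm_L2 (\<lambda>z. c * u z) = cmod c * norm_L2 u"
  by (simp add: norm_L2_def norm_mult power_mult_distrib real_sqrt_mult real_sqrt_divide)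

lemma L2_disk_cmult: "u \<in> L2_disk \<Longrightarrow> (\<lambda>z. c * u z) \<in> L2_disk"
proof -
  assume u: "u \<in> L2_disk"
  then have "(\<lambda>z. c * (indicator disk z *\<^sub>R u z)) \<in> borel_measurable borel"
    unfolding L2_disk_def by (intro borel_measurable_times) auto
  then show ?thesis using u by (simp add: L2_disk_def norm_mult power_mult_distrib)
qed

lemma deriv_dfun_L2 [simp]: "deriv (dfun f) \<in> L2_disk"
  using dfun[of f] dirichlet_deriv_cont[of "dfun f"]
  by (auto simp: L2_disk_def dirichlet_space_def intro!: borel_measurable_continuous_on_indicator)

lemma norm_L2_deriv_le: "norm_L2 (deriv (dfun f)) \<le> norm f"
  by (rule power2_le_imp_le) (simp_all add: norm_L2_sq norm_dirichlet_sq)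

lemma norm_sq_eq_L2: "(norm f)\<^sup>2 = (cmod (dfun f 0))\<^sup>2 + (norm_L2 (deriv (dfun f)))\<^sup>2"
  by (simp add: norm_L2_sq norm_dirichlet_sq)

section \<open>Monomials and reproducing kernels\<close>

text \<open>
  Every element constructed below, including those of the form \<^term>\<open>comp_op \<phi> f\<close>, arises in this
  way from a function that is holomorphic on the disk.
\<close>

definition restrict_disk :: "(complex \<Rightarrow> complex) \<Rightarrow> dirichlet" where
  "restrict_disk h = Abs_dirichlet (\<lambda>z. if z \<in> disk then h z else 0)"

lemma deriv_if_in_disk:
  "z \<in> disk \<Longrightarrow> deriv (\<lambda>z. if z \<in> disk then h z else 0) z = deriv h z"
  by (intro deriv_cong_ev refl) (auto intro: eventually_mono[OF eventually_nhds_in_open[of disk z]])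

lemma restrict_disk_in_dirichlet_space:
  assumes h: "h holomorphic_on disk" and L2: "deriv h \<in> L2_disk"
  shows "(\<lambda>z. if z \<in> disk then h z else 0) \<in> dirichlet_space"
proof -
  have "(\<lambda>z. if z \<in> disk then h z else 0) holomorphic_on disk"
    using h by (rule holomorphic_transform) auto
  moreover have "set_integrable lborel disk (\<lambda>z. (cmod (deriv (\<lambda>z. if z \<in> disk then h z else 0) z))\<^sup>2)"
  proof (rule set_integrable_disk_cong)
    show "set_integrable lborel disk (\<lambda>z. (cmod (deriv h z))\<^sup>2)" using L2 by (simp only: L2_disk_def mem_Collect_eq)
  qed (simp only: deriv_if_in_disk)
  ultimately show ?thesis by (simp add: dirichlet_space_def)
qed

lemma dfun_restrict_disk:
  assumes "h holomorphic_on disk" "deriv h \<in> L2_disk"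
  shows "dfun (restrict_disk h) = (\<lambda>z. if z \<in> disk then h z else 0)"
  unfolding restrict_disk_def by (rule Abs_dirichlet_inverse[OF restrict_disk_in_dirichlet_space[OF assms]])

lemma dfun_holomorphic: "dfun f holomorphic_on disk"
  using dfun dirichlet_holo by blast

lemma deriv_dfun_holomorphic: "deriv (dfun f) holomorphic_on disk"
  by (intro holomorphic_deriv dfun_holomorphic open_ball)

lemma set_integrable_deriv_dfun: "set_integrable lborel disk (deriv (dfun f))"
proof -
  have "(\<lambda>z. 1) \<in> L2_disk"
    by (rule L2_disk_boundedI[where B = 1]) auto
  from L2_disk_product(1)[OF deriv_dfun_L2[of f] this] show ?thesis by simp
qed

text \<open>
  The exponent is shifted so that the index matches the Taylor coefficients of derivatives: the
  inner product with the \<open>n\<close>-th of these elements is the \<open>n\<close>-th coefficient of \<open>f'\<close>.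
\<close>

definition zpow :: "nat \<Rightarrow> dirichlet" where
  "zpow n = restrict_disk (\<lambda>z. z ^ Suc n)"

lemma deriv_power_Suc: "deriv (\<lambda>z. z ^ Suc n) z = of_nat (Suc n) * (z::complex) ^ n"
proof (rule DERIV_imp_deriv)
  have "((\<lambda>z. z ^ Suc n) has_field_derivative (1 + of_nat n) * (1 * z ^ n)) (at z)"
    by (rule DERIV_power_Suc) (rule DERIV_ident)
  then show "((\<lambda>z. z ^ Suc n) has_field_derivative of_nat (Suc n) * z ^ n) (at z)"
    by (simp only: of_nat_Suc mult_1)
qed

lemma zpow_L2: "deriv (\<lambda>z. z ^ Suc n) \<in> L2_disk"
proof (rule L2_disk_boundedI)
  show "(\<lambda>z. indicator disk z *\<^sub>R deriv (\<lambda>z. z ^ Suc n) z) \<in> borel_measurable borel"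
    by (intro borel_measurable_continuous_on_indicator holomorphic_on_imp_continuous_on holomorphic_deriv holomorphic_intros) auto
  show "cmod (deriv (\<lambda>z. z ^ Suc n) z) \<le> real (Suc n)" if "z \<in> disk" for z
    using that by (simp add: deriv_power_Suc norm_mult norm_power power_le_one mult_left_le del: power_Suc of_nat_Suc)
qed

lemma dfun_zpow: "dfun (zpow n) = (\<lambda>z. if z \<in> disk then z ^ Suc n else 0)"
  unfolding zpow_def by (rule dfun_restrict_disk[OF _ zpow_L2]) (intro holomorphic_intros)

lemma deriv_dfun_zpow: "z \<in> disk \<Longrightarrow> deriv (dfun (zpow n)) z = of_nat (Suc n) * z ^ n"
  unfolding dfun_zpow by (simp only: deriv_if_in_disk deriv_power_Suc)

lemma dinner_zpow:
  "dinner f (zpow n) = (deriv ^^ n) (deriv (dfun f)) 0 / fact n"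
proof -
  have "dinner f (zpow n) = (LINT z:disk|lborel. deriv (dfun f) z * cnj (deriv (dfun (zpow n)) z)) / of_real pi"
    by (simp add: dinner_formula dfun_zpow)
  also have "(LINT z:disk|lborel. deriv (dfun f) z * cnj (deriv (dfun (zpow n)) z))
     = (LINT z:disk|lborel. of_nat (Suc n) * (deriv (dfun f) z * cnj z ^ n))"
    by (intro set_lebesgue_integral_cong) (auto simp: deriv_dfun_zpow simp del: of_nat_Suc)
  also have "\<dots> = of_nat (Suc n) * (LINT z:disk|lborel. deriv (dfun f) z * cnj z ^ n)"
    by (rule set_integral_mult_right)
  also have "\<dots> = of_nat (Suc n) * (of_real pi / of_nat (Suc n) * ((deriv ^^ n) (deriv (dfun f)) 0 / fact n))"
    by (subst integral_disk_holomorphic_coeff[OF deriv_dfun_holomorphic set_integrable_deriv_dfun]) (rule refl)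
  also have "\<dots> / of_real pi = (deriv ^^ n) (deriv (dfun f)) 0 / fact n"
  proof -
    have "x * (p / x * a) / p = a" if "x \<noteq> 0" "p \<noteq> 0" for x p a :: complex
      using that by simp
    from this[OF of_nat_neq_0] show ?thesis by this simp
  qed
  finally show ?thesis .
qed

lemma deriv_dfun_sums:
  assumes "w \<in> disk"
  shows "(\<lambda>n. dinner f (zpow n) * w ^ n) sums deriv (dfun f) w"
  using holomorphic_power_series[OF deriv_dfun_holomorphic assms] by (simp add: dinner_zpow)

text \<open>
  The norm is \<open>sqrt (n + 1)\<close>; the weaker bound keeps the error series below elementary.
\<close>

lemma norm_zpow_le: "norm (zpow n) \<le> real (Suc n)"
proof (rule power2_le_imp_le)
  have z0: "dfun (zpow n) 0 = 0" by (simp add: dfun_zpow)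
  have "(LINT z:disk|lborel. (cmod (deriv (dfun (zpow n)) z))\<^sup>2)
     = (LINT z:disk|lborel. (real (Suc n))\<^sup>2 * cmod z ^ (2 * n))"
    by (intro set_lebesgue_integral_cong)
      (auto simp: deriv_dfun_zpow norm_mult norm_power power_mult_distrib mult.commute[of 2 n] simp flip: power_mult simp del: of_nat_Suc)
  also have "\<dots> = (real (Suc n))\<^sup>2 * (pi / (real n + 1))"
    by (simp add: integral_disk_norm_power)
  finally have "(norm (zpow n))\<^sup>2 = real (Suc n)"
    unfolding norm_dirichlet_sq z0 by (simp add: power2_eq_square add.commute)
  then show "(norm (zpow n))\<^sup>2 \<le> (real (Suc n))\<^sup>2" by (simp add: power2_eq_square)
qed simp

text \<open>
  The tail from \<open>N\<close> on of the expansion \<open>1 / (1 - r)\<^sup>2 = \<Sum> (n + 1) r\<^sup>n\<close> of the Bergman kernel.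
\<close>

definition bergman_tail :: "real \<Rightarrow> nat \<Rightarrow> real" where
  "bergman_tail r N = (\<Sum>n. real (Suc (n + N)) * r ^ (n + N))"

lemma summable_Suc_power: "0 \<le> r \<Longrightarrow> r < 1 \<Longrightarrow> summable (\<lambda>n. real (Suc n) * r ^ n)"
  using geometric_deriv_sums[of r] by (auto simp: sums_iff)

lemma bergman_tail_tendsto_0:
  assumes "0 \<le> r" "r < 1" shows "(\<lambda>N. bergman_tail r N) \<longlonglongrightarrow> 0"
  unfolding bergman_tail_def using suminf_exist_split2[OF summable_Suc_power[OF assms]] by simp

text \<open>
  The coefficients are inner products with \<^term>\<open>zpow n\<close>, hence at most \<open>(n + 1) \<parallel>f\<parallel>\<close>. The
  bound is uniform over the unit ball, which is what makes the finite-rank approximation of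
  operators possible.
\<close>

lemma deriv_dfun_taylor_error:
  assumes r: "r < 1" and w: "cmod w \<le> r"
  shows "cmod (deriv (dfun f) w - (\<Sum>n<N. dinner f (zpow n) * w ^ n)) \<le> norm f * bergman_tail r N"
proof -
  have r0: "0 \<le> r" using w norm_ge_zero[of w] by linarith
  have wd: "w \<in> disk" using r w by simp
  note s = sums_split_initial_segment[OF deriv_dfun_sums[OF wd, of f], of N]
  have b: "cmod (dinner f (zpow (n + N)) * w ^ (n + N)) \<le> norm f * (real (Suc (n + N)) * r ^ (n + N))" for n
  proof -
    have "cmod (dinner f (zpow (n + N))) \<le> norm f * real (Suc (n + N))"
      by (rule order_trans[OF dinner_Cauchy_Schwarz mult_left_mono[OF norm_zpow_le]]) simp
    then have "cmod (dinner f (zpow (n + N))) * cmod w ^ (n + N) \<le> (norm f * real (Suc (n + N))) * r ^ (n + N)"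
      using w by (intro mult_mono power_mono) auto
    then show ?thesis by (simp add: norm_mult norm_power mult_ac)
  qed
  have sm: "summable (\<lambda>n. norm f * (real (Suc (n + N)) * r ^ (n + N)))"
    using summable_Suc_power[OF r0 r] by (intro summable_mult) (subst summable_iff_shift)
  have "cmod (\<Sum>n. dinner f (zpow (n + N)) * w ^ (n + N)) \<le> (\<Sum>n. norm f * (real (Suc (n + N)) * r ^ (n + N)))"
    by (rule norm_suminf_le[OF b sm])
  also have "\<dots> = norm f * bergman_tail r N"
    unfolding bergman_tail_def using summable_Suc_power[OF r0 r] by (intro suminf_mult) (subst summable_iff_shift)
  finally show ?thesis using s by (simp add: sums_iff)
qed

text \<open>
  The formula is \<open>1 + \<Sum> (cnj w z)\<^sup>n / n\<close>, summed over \<open>n \<ge> 1\<close>.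
\<close>

definition rkernel :: "complex \<Rightarrow> dirichlet" where
  "rkernel w = restrict_disk (\<lambda>z. 1 - Ln (1 - cnj w * z))"

lemma one_minus_in_right_half_plane:
  assumes "w \<in> disk" "z \<in> disk" shows "0 < Re (1 - cnj w * z)"
proof -
  have "cmod (cnj w * z) < 1 * 1"
    unfolding norm_mult using assms by (intro mult_strict_mono) auto
  then show ?thesis using complex_Re_le_cmod[of "cnj w * z"] by simp
qed

lemma rkernel_holomorphic:
  assumes "w \<in> disk" shows "(\<lambda>z. 1 - Ln (1 - cnj w * z)) holomorphic_on disk"
  using one_minus_in_right_half_plane[OF assms]
  by (intro holomorphic_intros) (auto simp: complex_nonpos_Reals_iff not_le)

lemma deriv_rkernel:
  assumes "w \<in> disk" "z \<in> disk"
  shows "deriv (\<lambda>z. 1 - Ln (1 - cnj w * z)) z = cnj w / (1 - cnj w * z)"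
proof -
  have "1 - cnj w * z \<notin> \<real>\<^sub>\<le>\<^sub>0"
    using one_minus_in_right_half_plane[OF assms] by (auto simp: complex_nonpos_Reals_iff not_le)
  then show ?thesis
    by (intro DERIV_imp_deriv) (auto intro!: derivative_eq_intros simp: field_simps)
qed

lemma one_minus_norm_lower:
  assumes "w \<in> disk" "z \<in> disk"
  shows "1 - cmod w \<le> cmod (1 - cnj w * z)"
proof -
  have "1 - cmod w \<le> 1 - cmod (cnj w * z)"
    using assms by (simp add: norm_mult mult_left_le)
  also have "\<dots> \<le> cmod (1 - cnj w * z)" using norm_triangle_ineq2[of 1 "cnj w * z"] by simp
  finally show ?thesis .
qed

lemma rkernel_L2:
  assumes "w \<in> disk" shows "deriv (\<lambda>z. 1 - Ln (1 - cnj w * z)) \<in> L2_disk"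
proof (rule L2_disk_boundedI)
  show "(\<lambda>z. indicator disk z *\<^sub>R deriv (\<lambda>z. 1 - Ln (1 - cnj w * z)) z) \<in> borel_measurable borel"
    by (intro borel_measurable_continuous_on_indicator holomorphic_on_imp_continuous_on holomorphic_deriv rkernel_holomorphic assms) auto
  show "cmod (deriv (\<lambda>z. 1 - Ln (1 - cnj w * z)) z) \<le> 1 / (1 - cmod w)" if "z \<in> disk" for z
  proof -
    have "cmod w / cmod (1 - cnj w * z) \<le> 1 / (1 - cmod w)"
      using assms one_minus_norm_lower[OF assms that] by (intro frac_le) auto
    then show ?thesis unfolding deriv_rkernel[OF assms that] norm_divide complex_mod_cnj .
  qed
qed

lemma dfun_rkernel:
  assumes "w \<in> disk"
  shows "dfun (rkernel w) = (\<lambda>z. if z \<in> disk then 1 - Ln (1 - cnj w * z) else 0)"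
  unfolding rkernel_def by (rule dfun_restrict_disk[OF rkernel_holomorphic rkernel_L2]) fact+

lemma deriv_dfun_rkernel:
  assumes "w \<in> disk" "z \<in> disk"
  shows "deriv (dfun (rkernel w)) z = cnj w / (1 - cnj w * z)"
  unfolding dfun_rkernel[OF assms(1)] using assms by (simp only: deriv_if_in_disk deriv_rkernel)

text \<open>
  The derivative of the kernel is the geometric series \<open>cnj w / (1 - cnj w z)\<close>. Integrating it
  against \<open>f'\<close> term by term yields \<open>w\<^bsup>n+1\<^esup>\<close> times the \<open>n\<close>-th coefficient of \<open>f'\<close> divided by
  \<open>n + 1\<close>, that is, the terms of the power series of \<open>f\<close> except the constant one. The constant
  term comes from the value of the kernel at 0, which is 1.
\<close>

lemma dinner_rkernel:
  assumes w: "w \<in> disk"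
  shows "dinner f (rkernel w) = dfun f w"
proof -
  define t where "t n z = indicator disk z *\<^sub>R (w ^ Suc n * (deriv (dfun f) z * cnj z ^ n))" for n z
  have pr: "set_integrable lborel disk (\<lambda>z. deriv (dfun f) z * cnj z ^ n)" for n
  proof -
    have "(\<lambda>z. z ^ n) \<in> L2_disk"
      by (rule L2_disk_boundedI[where B = 1]) (auto simp: norm_power power_le_one)
    from L2_disk_product(1)[OF deriv_dfun_L2 this] show ?thesis by simp
  qed
  have tint: "integrable lborel (t n)" for n
    unfolding t_def set_integrable_def[symmetric] by (intro set_integrable_mult_right pr)
  define D where "D z = cmod (indicator disk z *\<^sub>R deriv (dfun f) z)" for z
  have Di: "integrable lborel D"
    unfolding D_def using set_integrable_deriv_dfun unfolding set_integrable_def by (rule integrable_norm)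
  have tb: "cmod (t n z) \<le> D z * cmod w ^ n" for n z
  proof (cases "z \<in> disk")
    case True
    have "cmod w ^ Suc n * cmod z ^ n \<le> cmod w ^ n * 1"
      using w True by (intro mult_mono power_decreasing power_le_one) auto
    from mult_left_mono[OF this, of "cmod (deriv (dfun f) z)"] show ?thesis
      using True by (simp add: t_def D_def norm_mult norm_power mult_ac)
  qed (simp add: t_def D_def)
  have g: "summable (\<lambda>n. C * cmod w ^ n)" for C
    using w by (intro summable_mult summable_geometric) auto
  have s1: "AE z in lborel. summable (\<lambda>n. cmod (t n z))"
    by (intro AE_I2 summable_comparison_test'[OF g, of 0]) (use tb in auto)
  have nb: "(LINT z|lborel. cmod (t n z)) \<le> (LINT z|lborel. D z) * cmod w ^ n" for n
  proof -
    have "(LINT z|lborel. cmod (t n z)) \<le> (LINT z|lborel. D z * cmod w ^ n)"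
      using tb by (intro integral_mono integrable_norm integrable_mult_left tint Di) auto
    then show ?thesis by simp
  qed
  have s2: "summable (\<lambda>n. LINT z|lborel. cmod (t n z))"
    by (intro summable_comparison_test'[OF g, of 0]) (use nb in auto)
  have lim: "(\<lambda>n. t n z) sums (indicator disk z *\<^sub>R (deriv (dfun f) z * cnj (deriv (dfun (rkernel w)) z)))" for z
  proof (cases "z \<in> disk")
    case True
    have "cmod (w * cnj z) < 1 * 1" unfolding norm_mult using w True by (intro mult_strict_mono) auto
    then have "(\<lambda>n. (w * cnj z) ^ n) sums (1 / (1 - w * cnj z))" by (intro geometric_sums) simp
    from sums_mult[OF this, of "deriv (dfun f) z * w"] show ?thesis
      using True w by (simp add: t_def deriv_dfun_rkernel power_mult_distrib mult_ac)
  qed (simp add: t_def)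
  have "(\<lambda>n. LINT z|lborel. t n z) sums (LINT z|lborel. (\<Sum>n. t n z))"
    by (rule sums_integral[OF tint s1 s2])
  then have 1: "(\<lambda>n. LINT z|lborel. t n z) sums (LINT z:disk|lborel. deriv (dfun f) z * cnj (deriv (dfun (rkernel w)) z))"
    using lim by (simp add: sums_iff set_lebesgue_integral_def)
  define a where "a n = (deriv ^^ n) (dfun f) 0 / fact n" for n
  have ti: "(LINT z|lborel. t n z) = of_real pi * (a (Suc n) * w ^ Suc n)" for n
  proof -
    have "(LINT z|lborel. t n z) = w ^ Suc n * (LINT z:disk|lborel. deriv (dfun f) z * cnj z ^ n)"
      unfolding t_def set_lebesgue_integral_def[symmetric] by (rule set_integral_mult_right)
    also have "\<dots> = w ^ Suc n * (of_real pi / of_nat (Suc n) * ((deriv ^^ n) (deriv (dfun f)) 0 / fact n))"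
      by (subst integral_disk_holomorphic_coeff[OF deriv_dfun_holomorphic set_integrable_deriv_dfun]) (rule refl)
    finally show ?thesis
      by (simp add: a_def funpow_Suc_right del: funpow.simps of_nat_Suc power_Suc)
  qed
  have "(\<lambda>n. a n * w ^ n) sums dfun f w"
    using holomorphic_power_series[OF dfun_holomorphic w] by (simp add: a_def)
  then have "(\<lambda>n. a (Suc n) * w ^ Suc n) sums (dfun f w - dfun f 0)"
    by (subst sums_Suc_iff) (simp add: a_def)
  from sums_mult[OF this, of "of_real pi"] 1
  have "(LINT z:disk|lborel. deriv (dfun f) z * cnj (deriv (dfun (rkernel w)) z)) = of_real pi * (dfun f w - dfun f 0)"
    unfolding ti by (metis sums_unique2)
  then show ?thesis using w by (simp add: dinner_formula dfun_rkernel)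
qed

lemma norm_rkernel_sq:
  assumes w: "w \<in> disk"
  shows "(norm (rkernel w))\<^sup>2 = 1 - ln (1 - (cmod w)\<^sup>2)"
proof -
  have l: "(cmod w)\<^sup>2 < 1" using w by (simp add: power_less_one_iff)
  have "complex_of_real ((norm (rkernel w))\<^sup>2) = 1 - Ln (1 - cnj w * w)"
    using w by (simp add: dinner_self[symmetric] dinner_rkernel dfun_rkernel del: of_real_power)
  also have "1 - cnj w * w = of_real (1 - (cmod w)\<^sup>2)"
    by (simp only: complex_norm_square of_real_diff of_real_1 mult.commute)
  also have "Ln \<dots> = of_real (ln (1 - (cmod w)\<^sup>2))" using l by (intro Ln_of_real) simp
  finally have "complex_of_real ((norm (rkernel w))\<^sup>2) = of_real (1 - ln (1 - (cmod w)\<^sup>2))" by simp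
  then show ?thesis by (simp only: of_real_eq_iff)
qed

section \<open>Completeness, the Riesz representation theorem and adjoints\<close>

text \<open>
  Fatou's lemma, in the form in which it shows that a pointwise limit of derivatives is the
  derivative of an element and stays close to the approximating sequence.
\<close>

lemma L2_disk_Fatou:
  assumes u: "\<And>n. u n \<in> L2_disk" and C: "\<And>n. norm_L2 (u n) \<le> C"
    and lim: "\<And>z. z \<in> disk \<Longrightarrow> (\<lambda>n. u n z) \<longlonglongrightarrow> v z"
  shows "v \<in> L2_disk" "norm_L2 v \<le> C"
proof -
  have mu [measurable]: "(\<lambda>z. indicator disk z *\<^sub>R u n z) \<in> borel_measurable borel" for n
    using u by (simp add: L2_disk_def)
  have [measurable]: "(\<lambda>z. indicator disk z *\<^sub>R v z) \<in> borel_measurable borel"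
  proof (rule borel_measurable_LIMSEQ_metric)
    show "(\<lambda>z. indicator disk z *\<^sub>R u n z) \<in> borel_measurable borel" for n by (rule mu)
    show "(\<lambda>n. indicator disk z *\<^sub>R u n z) \<longlonglongrightarrow> indicator disk z *\<^sub>R v z" for z
      using lim[of z] by (cases "z \<in> disk") auto
  qed
  have C0: "0 \<le> C" using C[of 0] norm_L2_nonneg order_trans by blast
  define U where "U n z = (cmod (indicator disk z *\<^sub>R u n z))\<^sup>2" for n z
  define V where "V z = (cmod (indicator disk z *\<^sub>R v z))\<^sup>2" for z
  have [measurable]: "U n \<in> borel_measurable borel" for n unfolding U_def by (intro borel_measurable_power borel_measurable_norm) measurable
  have [measurable]: "V \<in> borel_measurable borel" unfolding V_def by (intro borel_measurable_power borel_measurable_norm) measurable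
  have Ueq: "U n = (\<lambda>z. indicator disk z *\<^sub>R (cmod (u n z))\<^sup>2)" for n by (auto simp: U_def indicator_def)
  have Veq: "V = (\<lambda>z. indicator disk z *\<^sub>R (cmod (v z))\<^sup>2)" by (auto simp: V_def indicator_def)
  have Ui: "integrable lborel (U n)" for n
    using u[of n] unfolding Ueq by (simp only: L2_disk_def set_integrable_def mem_Collect_eq)
  have Ub: "(\<integral>\<^sup>+z. ennreal (U n z) \<partial>lborel) \<le> ennreal (C\<^sup>2 * pi)" for n
  proof -
    have "(LINT z|lborel. U n z) / pi = (norm_L2 (u n))\<^sup>2"
      unfolding norm_L2_sq Ueq set_lebesgue_integral_def ..
    also have "\<dots> \<le> C\<^sup>2" using C by (intro power_mono) auto
    finally have "(LINT z|lborel. U n z) \<le> C\<^sup>2 * pi" by (simp add: field_simps)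
    moreover have "(\<integral>\<^sup>+z. ennreal (U n z) \<partial>lborel) = ennreal (LINT z|lborel. U n z)"
      by (rule nn_integral_eq_integral[OF Ui]) (simp add: U_def)
    ultimately show ?thesis by (simp add: ennreal_leI)
  qed
  have UV: "(\<lambda>n. U n z) \<longlonglongrightarrow> V z" for z
    unfolding U_def V_def using lim[of z] by (cases "z \<in> disk") (auto intro!: tendsto_intros)
  have "(\<integral>\<^sup>+z. ennreal (V z) \<partial>lborel) = (\<integral>\<^sup>+z. liminf (\<lambda>n. ennreal (U n z)) \<partial>lborel)"
    by (intro nn_integral_cong sym[OF lim_imp_Liminf] tendsto_ennrealI UV) simp
  also have "\<dots> \<le> liminf (\<lambda>n. \<integral>\<^sup>+z. ennreal (U n z) \<partial>lborel)"
    by (rule nn_integral_liminf) measurable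
  also have "\<dots> \<le> liminf (\<lambda>n. ennreal (C\<^sup>2 * pi))"
    by (intro Liminf_mono) (simp add: Ub)
  finally have Vn: "(\<integral>\<^sup>+z. ennreal (V z) \<partial>lborel) \<le> ennreal (C\<^sup>2 * pi)" by (simp add: Liminf_const)
  have Vi: "integrable lborel V"
    using Vn by (intro integrableI_nonneg) (auto simp: V_def le_less_trans)
  then show "v \<in> L2_disk"
    unfolding Veq L2_disk_def set_integrable_def by simp
  have "ennreal (LINT z|lborel. V z) \<le> ennreal (C\<^sup>2 * pi)"
    using Vn by (subst nn_integral_eq_integral[OF Vi, symmetric]) (simp add: V_def)
  then have "(LINT z|lborel. V z) \<le> C\<^sup>2 * pi" by (subst (asm) ennreal_le_iff) simp_all
  then have "(norm_L2 v)\<^sup>2 \<le> C\<^sup>2"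
    unfolding norm_L2_sq Veq set_lebesgue_integral_def by (simp add: field_simps)
  then show "norm_L2 v \<le> C" using C0 by (rule power2_le_imp_le)
qed

lemma dfun_field_differentiable: "z \<in> disk \<Longrightarrow> dfun f field_differentiable at z"
  by (rule dirichlet_field_diff[OF dfun])

lemma dfun_diff_le: "w \<in> disk \<Longrightarrow> cmod (dfun f w - dfun g w) \<le> norm (f - g) * norm (rkernel w)"
  using dinner_Cauchy_Schwarz[of "f - g" "rkernel w"] by (simp add: dinner_rkernel)

lemma norm_rkernel_mono:
  assumes "cmod w \<le> r" "r < 1" shows "norm (rkernel w) \<le> sqrt (1 - ln (1 - r\<^sup>2))"
proof -
  have "0 \<le> r" using assms(1) norm_ge_zero order_trans by blast
  then have r2: "r\<^sup>2 < 1" using assms(2) by (simp add: power_less_one_iff)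
  have "(cmod w)\<^sup>2 \<le> r\<^sup>2" using assms(1) by (intro power_mono) auto
  then have "(norm (rkernel w))\<^sup>2 \<le> 1 - ln (1 - r\<^sup>2)"
    using assms r2 by (subst norm_rkernel_sq) auto
  then show ?thesis by (rule real_le_rsqrt)
qed

text \<open>
  Kernels are bounded in norm on smaller disks, so a Cauchy sequence converges locally uniformly
  together with its derivatives. Fatou's lemma, applied to the differences with a fixed member,
  bounds the distance of the limit from that member.
\<close>

instance dirichlet :: complete_space
proof
  fix X :: "nat \<Rightarrow> dirichlet" assume X: "Cauchy X"
  define F where "F w = lim (\<lambda>n. dfun (X n) w)" for w
  have unif: "uniform_limit (cball 0 r) (\<lambda>n. dfun (X n)) F sequentially" if r: "r < 1" for r
  proof -
    define M where "M = sqrt (1 - ln (1 - r\<^sup>2)) + 1"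
    have Mb: "norm (rkernel w) < M" if "w \<in> cball 0 r" for w
      using norm_rkernel_mono[of w r] that r by (simp add: M_def)
    have "uniformly_Cauchy_on (cball 0 r) (\<lambda>n. dfun (X n))"
    proof (rule uniformly_Cauchy_onI)
      fix e :: real assume e: "e > 0"
      show "\<exists>N. \<forall>w\<in>cball 0 r. \<forall>m\<ge>N. \<forall>n\<ge>N. dist (dfun (X m) w) (dfun (X n) w) < e"
      proof (cases "cball (0::complex) r = {}")
        case False
        then obtain w0 :: complex where "w0 \<in> cball 0 r" by blast
        then have M0: "0 < M" using Mb norm_ge_zero le_less_trans by blast
        then have "e / M > 0" using e by simp
        then obtain N where N: "\<And>m n. m \<ge> N \<Longrightarrow> n \<ge> N \<Longrightarrow> norm (X m - X n) < e / M"
          using X CauchyD by blast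
        have "dist (dfun (X m) w) (dfun (X n) w) < e" if "w \<in> cball 0 r" "m \<ge> N" "n \<ge> N" for w m n
        proof -
          have "w \<in> disk" using that r by auto
          then have "cmod (dfun (X m) w - dfun (X n) w) \<le> norm (X m - X n) * norm (rkernel w)" by (rule dfun_diff_le)
          also have "\<dots> \<le> norm (X m - X n) * M" using Mb[OF that(1)] by (intro mult_left_mono) auto
          also have "\<dots> < e / M * M" using N[OF that(2,3)] M0 by (intro mult_strict_right_mono)
          finally show ?thesis using M0 by (simp add: dist_norm)
        qed
        then show ?thesis by blast
      qed auto
    qed
    then show ?thesis
      unfolding F_def using uniformly_convergent_eq_Cauchy uniformly_convergent_uniform_limit_iff by blast
  qed
  have "\<exists>g'. \<forall>x\<in>disk. (F has_field_derivative g' x) (at x) \<and> (\<lambda>n. deriv (dfun (X n)) x) \<longlonglongrightarrow> g' x"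
  proof (rule has_complex_derivative_uniform_sequence)
    show "open disk" by simp
    show "(dfun (X n) has_field_derivative deriv (dfun (X n)) x) (at x)" if "x \<in> disk" for n x
      by (rule holomorphic_derivI[OF dfun_holomorphic _ that]) simp
    show "\<exists>d>0. cball x d \<subseteq> disk \<and> uniform_limit (cball x d) (\<lambda>n. dfun (X n)) F sequentially" if "x \<in> disk" for x
    proof (intro exI conjI)
      define d where "d = (1 - cmod x) / 2"
      show "0 < d" using that by (simp add: d_def)
      have sub: "cball x d \<subseteq> cball 0 ((1 + cmod x) / 2)"
      proof
        fix y assume "y \<in> cball x d"
        then have "cmod y \<le> cmod x + d" using norm_triangle_ineq[of x "y - x"] by (simp add: dist_norm norm_minus_commute)
        then show "y \<in> cball 0 ((1 + cmod x) / 2)" by (simp add: d_def field_simps)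
      qed
      show "cball x d \<subseteq> disk" using sub that by (auto simp: subset_iff)
      show "uniform_limit (cball x d) (\<lambda>n. dfun (X n)) F sequentially"
        using that by (intro uniform_limit_on_subset[OF unif sub]) auto
    qed
  qed
  then have dF: "(F has_field_derivative deriv F x) (at x)" "(\<lambda>n. deriv (dfun (X n)) x) \<longlonglongrightarrow> deriv F x"
    if "x \<in> disk" for x using that by (metis DERIV_imp_deriv)+
  have Fh: "F holomorphic_on disk"
    using dF(1) unfolding holomorphic_on_open[OF open_ball] by blast
  have F0: "(\<lambda>n. dfun (X n) 0) \<longlonglongrightarrow> F 0"
    using tendsto_uniform_limitI[OF unif[of 0], of 0] by simp
  define E where "E m z = F z - dfun (X m) z" for m z
  have Eh: "E m holomorphic_on disk" for m unfolding E_def by (intro holomorphic_intros Fh dfun_holomorphic)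
  have dE: "deriv (E m) z = deriv F z - deriv (dfun (X m)) z" if "z \<in> disk" for m z
    unfolding E_def using that Fh by (intro deriv_diff dfun_field_differentiable) (auto simp: holomorphic_on_imp_differentiable_at)
  have bound: "deriv (E m) \<in> L2_disk \<and> cmod (E m 0) \<le> e \<and> norm_L2 (deriv (E m)) \<le> e"
    if N: "\<And>n. n \<ge> N \<Longrightarrow> norm (X n - X m) \<le> e" for N m e
  proof (intro conjI)
    define u where "u n = deriv (dfun (X (n + N) - X m))" for n
    have ue: "u n z = deriv (dfun (X (n + N))) z - deriv (dfun (X m)) z" if "z \<in> disk" for n z
      unfolding u_def minus_dirichlet.rep_eq
      using that by (intro deriv_diff dfun_field_differentiable)
    have uL: "u n \<in> L2_disk" for n by (simp add: u_def)
    have ub: "norm_L2 (u n) \<le> e" for n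
      unfolding u_def using norm_L2_deriv_le N[of "n + N"] order_trans by auto
    have ul: "(\<lambda>n. u n z) \<longlonglongrightarrow> deriv (E m) z" if "z \<in> disk" for z
      unfolding dE[OF that] ue[OF that]
      by (intro tendsto_diff tendsto_const LIMSEQ_ignore_initial_segment dF that)
    show "deriv (E m) \<in> L2_disk" "norm_L2 (deriv (E m)) \<le> e"
      by (rule L2_disk_Fatou[OF uL ub ul]; assumption)+
    have "(\<lambda>n. cmod (dfun (X (n + N)) 0 - dfun (X m) 0)) \<longlonglongrightarrow> cmod (E m 0)"
      unfolding E_def by (intro tendsto_norm tendsto_diff tendsto_const LIMSEQ_ignore_initial_segment F0)
    moreover have "cmod (dfun (X (n + N)) 0 - dfun (X m) 0) \<le> e" for n
    proof -
      have "(cmod (dfun (X (n + N) - X m) 0))\<^sup>2 \<le> (norm (X (n + N) - X m))\<^sup>2" by (simp add: norm_sq_eq_L2)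
      then have "cmod (dfun (X (n + N) - X m) 0) \<le> norm (X (n + N) - X m)" by (rule power2_le_imp_le) simp
      then show ?thesis using N[of "n + N"] by simp
    qed
    ultimately show "cmod (E m 0) \<le> e" by (intro LIMSEQ_le_const2) auto
  qed
  obtain M where M: "\<And>n. n \<ge> M \<Longrightarrow> norm (X n - X M) \<le> 1"
    using CauchyD[OF X, of 1] by (meson less_imp_le order_refl zero_less_one)
  \<comment> \<open>The limit is known to differ from one member of the sequence by an element, which makes it an
    element itself.\<close>
  define G where "G = restrict_disk (E M) + X M"
  have dG: "dfun G z = F z" if "z \<in> disk" for z
    using that bound[OF M] by (simp add: G_def dfun_restrict_disk[OF Eh] E_def)
  have "X \<longlonglongrightarrow> G"
  proof (rule LIMSEQ_I)
    fix e :: real assume e: "e > 0"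
    obtain N where N: "\<And>m n. m \<ge> N \<Longrightarrow> n \<ge> N \<Longrightarrow> norm (X m - X n) < e / 2"
      using CauchyD[OF X, of "e / 2"] e by auto
    have "norm (X m - G) < e" if m: "m \<ge> N" for m
    proof -
      have b: "deriv (E m) \<in> L2_disk" "cmod (E m 0) \<le> e / 2" "norm_L2 (deriv (E m)) \<le> e / 2"
        using bound[of N m "e / 2"] N[OF _ m] less_imp_le by blast+
      have GX: "G - X m = restrict_disk (E m)"
        by (rule dfun_eqI) (simp add: dG dfun_restrict_disk[OF Eh b(1)] E_def)
      have nd: "norm_L2 (deriv (dfun (restrict_disk (E m)))) = norm_L2 (deriv (E m))"
        unfolding norm_L2_def dfun_restrict_disk[OF Eh b(1)]
        by (intro arg_cong[where f = sqrt] arg_cong2[where f = "(/)"] set_lebesgue_integral_cong)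
          (auto simp only: deriv_if_in_disk sets_lborel borel_open open_ball)
      have "(norm (G - X m))\<^sup>2 = (cmod (E m 0))\<^sup>2 + (norm_L2 (deriv (E m)))\<^sup>2"
        unfolding GX norm_sq_eq_L2 nd by (simp add: dfun_restrict_disk[OF Eh b(1)])
      also have "\<dots> \<le> (e / 2)\<^sup>2 + (e / 2)\<^sup>2" using b by (intro add_mono power_mono) auto
      also have "\<dots> < e\<^sup>2" using e by (simp add: power2_eq_square)
      finally have "norm (G - X m) < e" using e by (intro power2_less_imp_less[of _ e]) auto
      then show ?thesis by (simp add: norm_minus_commute)
    qed
    then show "\<exists>N. \<forall>m\<ge>N. norm (X m - G) < e" by blast
  qed
  then show "convergent X" by (auto simp: convergent_def)
qed

text \<open>
  The representing vector minimises \<open>q x = \<parallel>x\<parallel>\<^sup>2 - 2 F x\<close>. By the parallelogram law, two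
  near-minimisers are close to each other since \<open>q\<close> of their midpoint is not below the infimum;
  hence minimising sequences converge.
\<close>

lemma riesz_representation_real:
  fixes F :: "'a::{real_inner, complete_space} \<Rightarrow> real"
  assumes F: "bounded_linear F"
  shows "\<exists>k. \<forall>x. F x = inner x k"
proof -
  interpret F: bounded_linear F by fact
  define q where "q x = (norm x)\<^sup>2 - 2 * F x" for x
  obtain C where C: "\<And>x. norm (F x) \<le> norm x * C" using F.bounded by blast
  have low: "- C\<^sup>2 \<le> q x" for x
  proof -
    have "2 * F x \<le> 2 * (norm x * C)" using C[of x] by simp
    also have "\<dots> \<le> (norm x)\<^sup>2 + C\<^sup>2" using sum_squares_bound[of "norm x" C] by simp
    finally show ?thesis by (simp add: q_def)
  qed
  have bdd: "bdd_below (range q)" using low by (auto intro!: bdd_belowI)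
  define m where "m = Inf (range q)"
  have mle: "m \<le> q x" for x unfolding m_def using bdd by (intro cInf_lower) auto
  have "\<exists>x. q x < m + 1 / real (Suc n)" for n
  proof -
    have "Inf (range q) < m + 1 / real (Suc n)" by (simp add: m_def)
    then show ?thesis using cInf_lessD[of "range q"] by auto
  qed
  then obtain X where X: "\<And>n. q (X n) < m + 1 / real (Suc n)" by metis
  have par: "(norm (x - y))\<^sup>2 = 2 * q x + 2 * q y - 4 * q ((1/2) *\<^sub>R (x + y))" for x y
  proof -
    have "(norm ((1/2) *\<^sub>R (x + y)))\<^sup>2 = (norm (x + y))\<^sup>2 / 4"
      by (simp add: power_divide)
    moreover have "F ((1/2) *\<^sub>R (x + y)) = F x / 2 + F y / 2"
      by (simp add: F.scaleR F.add add_divide_distrib)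
    ultimately have "4 * q ((1/2) *\<^sub>R (x + y)) = (norm (x + y))\<^sup>2 - 4 * F x - 4 * F y"
      unfolding q_def by (simp only:) (simp add: field_simps)
    then show ?thesis
      unfolding q_def power2_norm_eq_inner
      by (simp add: inner_diff_left inner_diff_right inner_add_left inner_add_right inner_commute[of y x])
  qed
  have close: "(norm (X a - X b))\<^sup>2 \<le> 4 / real (Suc N)" if "a \<ge> N" "b \<ge> N" for a b N
  proof -
    have "1 / real (Suc a) \<le> 1 / real (Suc N)" "1 / real (Suc b) \<le> 1 / real (Suc N)"
      using that by (auto intro!: divide_left_mono)
    then have "q (X a) \<le> m + 1 / real (Suc N)" "q (X b) \<le> m + 1 / real (Suc N)"
      using X[of a] X[of b] by linarith+
    then show ?thesis using mle[of "(1/2) *\<^sub>R (X a + X b)"] unfolding par by simp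
  qed
  have "Cauchy X"
  proof (rule CauchyI)
    fix e :: real assume e: "e > 0"
    obtain N where N: "4 / e\<^sup>2 < real N" using reals_Archimedean2 by blast
    have "4 / real (Suc N) < e\<^sup>2" using N e by (simp add: field_simps) (smt (verit) zero_le_power2)
    then have "norm (X a - X b) < e" if "a \<ge> N" "b \<ge> N" for a b
      using close[OF that] e by (intro power2_less_imp_less[of _ e]) auto
    then show "\<exists>N. \<forall>a\<ge>N. \<forall>b\<ge>N. norm (X a - X b) < e" by blast
  qed
  then obtain x where x: "X \<longlonglongrightarrow> x" using Cauchy_convergent_iff convergent_def by blast
  have "(\<lambda>n. q (X n)) \<longlonglongrightarrow> q x"
    unfolding q_def by (intro tendsto_intros x F.tendsto)
  moreover have "(\<lambda>n. m + 1 / real (Suc n)) \<longlonglongrightarrow> m + 0"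
    by (intro tendsto_intros LIMSEQ_Suc[OF lim_1_over_n])
  ultimately have "q x \<le> m + 0"
    by (rule LIMSEQ_le) (use X less_imp_le in blast)
  then have xmin: "q x \<le> q y" for y using mle[of y] by simp
  have "F h = inner h x" for h
  proof (rule ccontr)
    assume ne: "F h \<noteq> inner h x"
    define a where "a = inner h x - F h"
    have a: "a \<noteq> 0" using ne by (simp add: a_def)
    \<comment> \<open>Nearly the optimal step along \<open>h\<close>; adding 1 avoids a case distinction for \<open>h = 0\<close>.\<close>
    define t where "t = - a / ((norm h)\<^sup>2 + 1)"
    have p: "(norm h)\<^sup>2 + 1 > 0" using zero_le_power2[of "norm h"] by linarith
    have "q (x + t *\<^sub>R h) = q x + t\<^sup>2 * (norm h)\<^sup>2 + 2 * t * a"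
      unfolding q_def F.add F.scaleR power2_norm_eq_inner a_def
      by (simp add: inner_add_left inner_add_right inner_commute[of x h] power2_eq_square algebra_simps)
    then have "0 \<le> t\<^sup>2 * (norm h)\<^sup>2 + 2 * t * a" using xmin[of "x + t *\<^sub>R h"] by linarith
    also have "\<dots> \<le> t\<^sup>2 * ((norm h)\<^sup>2 + 1) + 2 * t * a" by (simp add: algebra_simps)
    also have "\<dots> = - (a\<^sup>2 / ((norm h)\<^sup>2 + 1))"
    proof -
      have "(- a / s)\<^sup>2 * s + 2 * (- a / s) * a = - (a\<^sup>2 / s)" if "s > 0" for s :: real
        using that by (simp add: power2_eq_square field_simps)
      from this[OF p] show ?thesis unfolding t_def .
    qed
    also have "\<dots> < 0" using a p by simp
    finally show False by simp
  qed
  then show ?thesis by blast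
qed

definition bounded_clinear :: "(dirichlet \<Rightarrow> dirichlet) \<Rightarrow> bool" where
  "bounded_clinear T \<longleftrightarrow> clinear_op T \<and> (\<exists>C. \<forall>f. norm (T f) \<le> C * norm f)"

text \<open>
  Complex linearity recovers the imaginary part of \<open>F\<close> from the real part, since
  \<open>Im (F f) = Re (F (- \<i> f))\<close>.
\<close>

lemma riesz_representation:
  fixes F :: "dirichlet \<Rightarrow> complex"
  assumes add: "\<And>f g. F (f + g) = F f + F g" and scale: "\<And>c f. F (dscale c f) = c * F f"
    and bound: "\<And>f. cmod (F f) \<le> C * norm f"
  shows "\<exists>k. \<forall>f. F f = dinner f k"
proof -
  have "bounded_linear (\<lambda>f. Re (F f))"
  proof (rule bounded_linear_intro)
    show "norm (Re (F f)) \<le> norm f * C" for f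
      using order_trans[OF abs_Re_le_cmod bound[of f]] by (simp add: mult.commute)
  qed (simp_all add: add scaleR_eq_dscale scale)
  then obtain k where "\<And>f. Re (F f) = inner f k" using riesz_representation_real by blast
  then have k: "Re (F f) = Re (dinner f k)" for f by (simp add: Re_dinner)
  have "Im (F f) = Im (dinner f k)" for f
    using k[of "dscale (- \<i>) f"] by (simp add: scale dinner_dscale_left)
  with k have "F f = dinner f k" for f by (simp add: complex_eq_iff)
  then show ?thesis by blast
qed

lemma dinner_eqI:
  assumes "\<And>f. dinner f g = dinner f h" shows "g = h"
proof -
  have "dinner (g - h) (g - h) = 0" using assms[of "g - h"] by (simp add: dinner_diff_right)
  then show ?thesis by (simp add: dinner_self)
qed

text \<open>
  Two adjoints agree by nondegeneracy, so the description in the definition is satisfied by exactly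
  one map once Riesz's theorem has provided it.
\<close>

lemma dinner_hadjoint:
  assumes T: "bounded_clinear T"
  shows "dinner (T f) g = dinner f (hadjoint T g)"
proof -
  obtain C where C: "\<And>f. norm (T f) \<le> C * norm f" using T by (auto simp: bounded_clinear_def)
  have ex: "\<exists>k. \<forall>f. dinner (T f) g = dinner f k" for g
  proof (rule riesz_representation)
    show "cmod (dinner (T f) g) \<le> (C * norm g) * norm f" for f
    proof -
      have "cmod (dinner (T f) g) \<le> norm (T f) * norm g" by (rule dinner_Cauchy_Schwarz)
      also have "\<dots> \<le> (C * norm f) * norm g" by (intro mult_right_mono C) simp
      finally show ?thesis by (simp add: mult_ac)
    qed
  qed (use T in \<open>simp_all add: bounded_clinear_def clinear_op_def dinner_add_left dinner_dscale_left\<close>)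
  then obtain S where S: "\<And>f g. dinner (T f) g = dinner f (S g)" by metis
  have "hadjoint T = S"
    unfolding hadjoint_def
  proof (rule the_equality)
    fix S' assume "\<forall>f g. dinner (T f) g = dinner f (S' g)"
    then have "S' g = S g" for g using S by (intro dinner_eqI) metis
    then show "S' = S" by blast
  qed (use S in blast)
  then show ?thesis using S by simp
qed

section \<open>Composition with univalent self-maps\<close>

text \<open>
  The properties of a linear fractional self-map that the upper bounds rest on; injectivity
  is what makes the change of variables an isometry onto \<open>\<phi> ` disk\<close>.
\<close>

definition univalent_self_map :: "(complex \<Rightarrow> complex) \<Rightarrow> bool" where
  "univalent_self_map \<phi> \<longleftrightarrow> \<phi> holomorphic_on disk \<and> inj_on \<phi> disk \<and> \<phi> ` disk \<subseteq> disk"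

lemma univalent_self_mapD:
  assumes "univalent_self_map \<phi>"
  shows "\<phi> holomorphic_on disk" "inj_on \<phi> disk" "z \<in> disk \<Longrightarrow> \<phi> z \<in> disk"
  using assms unfolding univalent_self_map_def by blast+

text \<open>
  The derivative of \<open>f \<circ> \<phi>\<close>, as given by the chain rule.
\<close>

definition chain_deriv :: "(complex \<Rightarrow> complex) \<Rightarrow> dirichlet \<Rightarrow> complex \<Rightarrow> complex" where
  "chain_deriv \<phi> f z = deriv (dfun f) (\<phi> z) * deriv \<phi> z"

text \<open>
  After the change of variables the integral of \<open>|(f \<circ> \<phi>)'|\<^sup>2\<close> is the integral of \<open>|f'|\<^sup>2\<close> over
  the image of the disk, which is a subset of the disk.
\<close>

lemma chain_deriv_L2:
  assumes phi: "univalent_self_map \<phi>"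
  shows "chain_deriv \<phi> f \<in> L2_disk" "norm_L2 (chain_deriv \<phi> f) \<le> norm_L2 (deriv (dfun f))"
proof -
  note p = univalent_self_mapD[OF phi]
  define g where "g z = indicator disk z *\<^sub>R deriv (dfun f) z" for z
  have g: "g \<in> borel_measurable borel"
    using deriv_dfun_L2[of f] unfolding L2_disk_def g_def by simp
  define G where "G z = (cmod (g z))\<^sup>2" for z
  have [measurable]: "G \<in> borel_measurable borel" unfolding G_def using g by measurable
  have Geq: "G = (\<lambda>z. indicator disk z *\<^sub>R (cmod (deriv (dfun f) z))\<^sup>2)" by (auto simp: G_def g_def indicator_def)
  have Gi: "integrable lborel G"
    using deriv_dfun_L2[of f] unfolding Geq by (simp only: L2_disk_def set_integrable_def mem_Collect_eq)
  have "\<phi> ` disk \<in> sets borel" using open_mapping_thm3[OF p(1) _ p(2)] by simp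
  then have cov: "(\<integral>\<^sup>+z. ennreal (G z) * indicator (\<phi> ` disk) z \<partial>lborel)
       = (\<integral>\<^sup>+z. ennreal (G (\<phi> z)) * ennreal ((cmod (deriv \<phi> z))\<^sup>2) * indicator disk z \<partial>lborel)"
    by (intro nn_integral_holomorphic_image p) simp_all
  have contf: "continuous_on disk (\<lambda>z. deriv (dfun f) (\<phi> z))"
    by (rule continuous_on_compose2[OF holomorphic_on_imp_continuous_on[OF deriv_dfun_holomorphic] holomorphic_on_imp_continuous_on[OF p(1)]])
      (use p(3) in auto)
  have m: "(\<lambda>z. indicator disk z *\<^sub>R chain_deriv \<phi> f z) \<in> borel_measurable borel"
    unfolding chain_deriv_def
    by (intro borel_measurable_continuous_on_indicator continuous_intros contf holomorphic_on_imp_continuous_on holomorphic_deriv p) auto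
  define H where "H z = (cmod (indicator disk z *\<^sub>R chain_deriv \<phi> f z))\<^sup>2" for z
  have [measurable]: "H \<in> borel_measurable borel" unfolding H_def by (intro borel_measurable_power measurable_compose[OF m] borel_measurable_norm)
  have Heq: "H = (\<lambda>z. indicator disk z *\<^sub>R (cmod (chain_deriv \<phi> f z))\<^sup>2)" by (auto simp: H_def indicator_def)
  have HG: "ennreal (G (\<phi> z)) * ennreal ((cmod (deriv \<phi> z))\<^sup>2) * indicator disk z = ennreal (H z)" for z
  proof (cases "z \<in> disk")
    case True
    then show ?thesis using p(3)[OF True]
      by (simp add: G_def g_def H_def chain_deriv_def norm_mult power_mult_distrib ennreal_mult)
  qed (simp add: H_def)
  have "(\<integral>\<^sup>+z. ennreal (H z) \<partial>lborel) = (\<integral>\<^sup>+z. ennreal (G z) * indicator (\<phi> ` disk) z \<partial>lborel)"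
    unfolding cov HG ..
  also have "\<dots> \<le> (\<integral>\<^sup>+z. ennreal (G z) \<partial>lborel)"
    by (intro nn_integral_mono) (auto simp: indicator_def)
  also have "\<dots> = ennreal (LINT z|lborel. G z)"
    by (rule nn_integral_eq_integral[OF Gi]) (simp add: G_def)
  finally have le: "(\<integral>\<^sup>+z. ennreal (H z) \<partial>lborel) \<le> ennreal (LINT z|lborel. G z)" .
  have Hi: "integrable lborel H"
    using le by (intro integrableI_nonneg) (auto simp: H_def le_less_trans)
  then show "chain_deriv \<phi> f \<in> L2_disk"
    unfolding Heq using m by (simp add: L2_disk_def set_integrable_def)
  have "ennreal (LINT z|lborel. H z) \<le> ennreal (LINT z|lborel. G z)"
    using le by (subst nn_integral_eq_integral[OF Hi, symmetric]) (simp add: H_def)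
  then have "(LINT z|lborel. H z) \<le> (LINT z|lborel. G z)"
    by (subst (asm) ennreal_le_iff) (simp_all add: G_def[abs_def])
  then show "norm_L2 (chain_deriv \<phi> f) \<le> norm_L2 (deriv (dfun f))"
    unfolding norm_L2_def set_lebesgue_integral_def Heq Geq by (intro real_sqrt_le_mono divide_right_mono) auto
qed

lemma comp_op_eq_restrict_disk: "comp_op \<phi> f = restrict_disk (\<lambda>z. dfun f (\<phi> z))"
  by (simp only: comp_op_def restrict_disk_def)

lemma L2_disk_cong:
  assumes "\<And>z. z \<in> disk \<Longrightarrow> u z = v z"
  shows "u \<in> L2_disk \<longleftrightarrow> v \<in> L2_disk" "norm_L2 u = norm_L2 v"
proof -
  have 1: "(\<lambda>z. indicator disk z *\<^sub>R u z) = (\<lambda>z. indicator disk z *\<^sub>R v z)"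
  proof
    show "indicator disk z *\<^sub>R u z = indicator disk z *\<^sub>R v z" for z
      using assms[of z] by (cases "z \<in> disk") simp_all
  qed
  have 2: "(\<lambda>z. indicator disk z *\<^sub>R (cmod (u z))\<^sup>2) = (\<lambda>z. indicator disk z *\<^sub>R (cmod (v z))\<^sup>2)"
  proof
    show "indicator disk z *\<^sub>R (cmod (u z))\<^sup>2 = indicator disk z *\<^sub>R (cmod (v z))\<^sup>2" for z
      using assms[of z] by (cases "z \<in> disk") simp_all
  qed
  show "u \<in> L2_disk \<longleftrightarrow> v \<in> L2_disk" unfolding L2_disk_def set_integrable_def mem_Collect_eq 1 2 ..
  show "norm_L2 u = norm_L2 v" unfolding norm_L2_def set_lebesgue_integral_def 2 ..
qed

lemma
  assumes phi: "univalent_self_map \<phi>"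
  shows dfun_comp_op: "dfun (comp_op \<phi> f) = (\<lambda>z. if z \<in> disk then dfun f (\<phi> z) else 0)"
    and deriv_dfun_comp_op: "z \<in> disk \<Longrightarrow> deriv (dfun (comp_op \<phi> f)) z = chain_deriv \<phi> f z"
proof -
  note p = univalent_self_mapD[OF phi]
  have h: "(\<lambda>z. dfun f (\<phi> z)) holomorphic_on disk"
    using holomorphic_on_compose_gen[OF p(1) dfun_holomorphic[of f]] p(3) unfolding o_def by blast
  have d: "deriv (\<lambda>z. dfun f (\<phi> z)) z = chain_deriv \<phi> f z" if "z \<in> disk" for z
  proof -
    have "deriv (dfun f \<circ> \<phi>) z = deriv (dfun f) (\<phi> z) * deriv \<phi> z"
      using p that by (intro deriv_chain dfun_field_differentiable) (auto simp: holomorphic_on_imp_differentiable_at)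
    then show ?thesis by (simp add: chain_deriv_def o_def)
  qed
  have L: "deriv (\<lambda>z. dfun f (\<phi> z)) \<in> L2_disk"
    using chain_deriv_L2(1)[OF phi, of f] L2_disk_cong(1)[OF d] by simp
  show 1: "dfun (comp_op \<phi> f) = (\<lambda>z. if z \<in> disk then dfun f (\<phi> z) else 0)"
    unfolding comp_op_eq_restrict_disk by (rule dfun_restrict_disk[OF h L])
  show "deriv (dfun (comp_op \<phi> f)) z = chain_deriv \<phi> f z" if "z \<in> disk"
    unfolding 1 using that by (simp only: deriv_if_in_disk d)
qed

text \<open>
  Composition may increase the norm only through the value at the origin; this is a condition of
  rank one and therefore invisible to the essential norm.
\<close>

lemma norm_comp_op_le:
  assumes phi: "univalent_self_map \<phi>"
  shows "(norm (comp_op \<phi> f))\<^sup>2 \<le> (cmod (dfun f (\<phi> 0)))\<^sup>2 + (norm f)\<^sup>2"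
proof -
  have "norm_L2 (deriv (dfun (comp_op \<phi> f))) = norm_L2 (chain_deriv \<phi> f)"
    by (rule L2_disk_cong(2)) (rule deriv_dfun_comp_op[OF phi])
  also have "\<dots> \<le> norm f"
    using chain_deriv_L2(2)[OF phi] norm_L2_deriv_le order_trans by blast
  finally have "(norm_L2 (deriv (dfun (comp_op \<phi> f))))\<^sup>2 \<le> (norm f)\<^sup>2" by (intro power_mono) auto
  moreover have "dfun (comp_op \<phi> f) 0 = dfun f (\<phi> 0)" by (simp add: dfun_comp_op[OF phi])
  ultimately show ?thesis unfolding norm_sq_eq_L2[of "comp_op \<phi> f"] by simp
qed

lemma bounded_clinear_comp_op:
  assumes phi: "univalent_self_map \<phi>"
  shows "bounded_clinear (comp_op \<phi>)"
  unfolding bounded_clinear_def clinear_op_def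
proof (intro conjI allI exI)
  note p = univalent_self_mapD[OF phi]
  show "comp_op \<phi> (f + g) = comp_op \<phi> f + comp_op \<phi> g" for f g
    by (rule dfun_eqI) (simp add: dfun_comp_op[OF phi])
  show "comp_op \<phi> (dscale c f) = dscale c (comp_op \<phi> f)" for c f
    by (rule dfun_eqI) (simp add: dfun_comp_op[OF phi])
  show "norm (comp_op \<phi> f) \<le> sqrt ((norm (rkernel (\<phi> 0)))\<^sup>2 + 1) * norm f" for f
  proof (rule power2_le_imp_le)
    have p0: "\<phi> 0 \<in> disk" by (rule p) simp
    have "cmod (dfun f (\<phi> 0)) \<le> norm f * norm (rkernel (\<phi> 0))"
      using dinner_Cauchy_Schwarz[of f "rkernel (\<phi> 0)"] by (simp add: dinner_rkernel[OF p0])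
    then have "(cmod (dfun f (\<phi> 0)))\<^sup>2 \<le> (norm f * norm (rkernel (\<phi> 0)))\<^sup>2" by (intro power_mono) auto
    then show "(norm (comp_op \<phi> f))\<^sup>2 \<le> (sqrt ((norm (rkernel (\<phi> 0)))\<^sup>2 + 1) * norm f)\<^sup>2"
      using norm_comp_op_le[OF phi, of f] by (simp add: power_mult_distrib algebra_simps)
  qed simp
qed

lemma dinner_hadjoint_comp:
  assumes S: "bounded_clinear S"
  shows "dinner ((hadjoint S \<circ> T) f) g = dinner (T f) (S g)"
  using dinner_hadjoint[OF S, of g "T f"] by (metis comp_apply dinner_commute)

lemma dinner_eqI_left:
  assumes "\<And>f. dinner g f = dinner h f" shows "g = h"
  using assms by (intro dinner_eqI) (metis dinner_commute)

lemma bounded_clinear_hadjoint_comp: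
  assumes S: "bounded_clinear S" and T: "bounded_clinear T"
  shows "bounded_clinear (hadjoint S \<circ> T)"
proof -
  note d = dinner_hadjoint_comp[OF S, of T]
  obtain A where A: "\<And>f. norm (S f) \<le> A * norm f" using S by (auto simp: bounded_clinear_def)
  obtain B where B: "\<And>f. norm (T f) \<le> B * norm f" using T by (auto simp: bounded_clinear_def)
  have T': "T (f + g) = T f + T g" "T (dscale c f) = dscale c (T f)" for c f g
    using T by (auto simp: bounded_clinear_def clinear_op_def)
  have "(hadjoint S \<circ> T) (f + g) = (hadjoint S \<circ> T) f + (hadjoint S \<circ> T) g" for f g
    by (rule dinner_eqI_left) (simp only: d dinner_add_left T')
  moreover have "(hadjoint S \<circ> T) (dscale c f) = dscale c ((hadjoint S \<circ> T) f)" for c f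
    by (rule dinner_eqI_left) (simp only: d dinner_dscale_left T')
  moreover have "norm ((hadjoint S \<circ> T) f) \<le> (\<bar>A\<bar> * \<bar>B\<bar>) * norm f" for f
  proof (rule dirichlet_norm_leI)
    fix g
    have "cmod (dinner ((hadjoint S \<circ> T) f) g) \<le> norm (T f) * norm (S g)"
      unfolding d by (rule dinner_Cauchy_Schwarz)
    also have "\<dots> \<le> (\<bar>B\<bar> * norm f) * (\<bar>A\<bar> * norm g)"
    proof (intro mult_mono)
      show "norm (T f) \<le> \<bar>B\<bar> * norm f" by (rule order_trans[OF B mult_right_mono]) auto
      show "norm (S g) \<le> \<bar>A\<bar> * norm g" by (rule order_trans[OF A mult_right_mono]) auto
    qed auto
    finally show "cmod (dinner ((hadjoint S \<circ> T) f) g) \<le> (\<bar>A\<bar> * \<bar>B\<bar>) * norm f * norm g"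
      by (simp add: mult_ac)
  qed simp
  ultimately show ?thesis unfolding bounded_clinear_def clinear_op_def by blast
qed

section \<open>Compact operators and the essential norm\<close>

lemma compact_opI:
  assumes "clinear_op K" "K ` cball 0 1 \<subseteq> C" "compact C"
  shows "compact_op K"
proof -
  have "closure (K ` cball 0 1) \<subseteq> C" using assms by (intro closure_minimal compact_imp_closed)
  then have "compact (closure (K ` cball 0 1))"
    using compact_Int_closed[OF assms(3) closed_closure] by (metis inf.absorb2)
  then show ?thesis using assms(1) by (simp add: compact_op_def)
qed

lemma dscale_add_left: "dscale (a + b) f = dscale a f + dscale b f"
  and dscale_add_right: "dscale c (f + g) = dscale c f + dscale c g"
  and dscale_dscale: "dscale a (dscale b f) = dscale (a * b) f"
  by (rule dfun_eqI, simp add: algebra_simps)+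

lemma compact_op_rank_one: "compact_op (\<lambda>f. dscale (dinner f u) v)"
proof (rule compact_opI)
  show "clinear_op (\<lambda>f. dscale (dinner f u) v)"
    by (simp add: clinear_op_def dinner_add_left dinner_dscale_left dscale_add_left dscale_dscale)
  show "(\<lambda>f. dscale (dinner f u) v) ` cball 0 1 \<subseteq> (\<lambda>c. dscale c v) ` cball 0 (norm u)"
  proof (rule image_subsetI)
    fix f :: dirichlet assume "f \<in> cball 0 1"
    then have "norm f * norm u \<le> norm u" using mult_right_mono[of "norm f" 1 "norm u"] by simp
    then have "dinner f u \<in> cball 0 (norm u)" using dinner_Cauchy_Schwarz[of f u] by simp
    then show "dscale (dinner f u) v \<in> (\<lambda>c. dscale c v) ` cball 0 (norm u)" by blast
  qed
  have "dscale c v - dscale d v = dscale (c - d) v" for c d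
    by (rule dfun_eqI) (simp add: algebra_simps)
  then have "(norm v)-lipschitz_on UNIV (\<lambda>c. dscale c v)"
    by (intro lipschitz_onI) (simp_all add: dist_norm norm_dscale)
  then have "continuous_on (cball 0 (norm u)) (\<lambda>c. dscale c v)"
    using lipschitz_on_continuous_on continuous_on_subset by blast
  then show "compact ((\<lambda>c. dscale c v) ` cball 0 (norm u))" by (rule compact_continuous_image) simp
qed

lemma compact_op_zero: "compact_op (\<lambda>f. 0)"
proof (rule compact_opI[of _ "{0}"])
  show "clinear_op (\<lambda>f. 0)"
    using dfun_eqI[of 0 "dscale _ 0"] unfolding clinear_op_def by simp
qed auto

lemma compact_op_add:
  assumes K: "compact_op K" and L: "compact_op L"
  shows "compact_op (\<lambda>f. K f + L f)"
proof (rule compact_opI)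
  show "clinear_op (\<lambda>f. K f + L f)"
    using K L by (simp add: compact_op_def clinear_op_def dscale_add_right algebra_simps)
  show "(\<lambda>f. K f + L f) ` cball 0 1 \<subseteq> {x + y |x y. x \<in> closure (K ` cball 0 1) \<and> y \<in> closure (L ` cball 0 1)}"
  proof (rule image_subsetI)
    fix f :: dirichlet assume "f \<in> cball 0 1"
    then have "K f \<in> closure (K ` cball 0 1)" "L f \<in> closure (L ` cball 0 1)"
      by (meson closure_subset imageI subsetD)+
    then show "K f + L f \<in> {x + y |x y. x \<in> closure (K ` cball 0 1) \<and> y \<in> closure (L ` cball 0 1)}"
      by blast
  qed
  show "compact {x + y |x y. x \<in> closure (K ` cball 0 1) \<and> y \<in> closure (L ` cball 0 1)}"
    using K L by (intro compact_sums) (auto simp: compact_op_def)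
qed

lemma compact_op_sum:
  assumes "finite I" "\<And>i. i \<in> I \<Longrightarrow> compact_op (K i)"
  shows "compact_op (\<lambda>f. \<Sum>i\<in>I. K i f)"
  using assms by (induction I rule: finite_induct) (simp_all add: compact_op_zero compact_op_add)

lemma bounded_linear_bounded_clinear:
  assumes "bounded_clinear T" shows "bounded_linear T"
proof -
  obtain C where C: "\<And>f. norm (T f) \<le> C * norm f" using assms by (auto simp: bounded_clinear_def)
  have lin: "T (f + g) = T f + T g" "T (dscale c f) = dscale c (T f)" for c f g
    using assms by (auto simp: bounded_clinear_def clinear_op_def)
  show ?thesis
    using C by (intro bounded_linear_intro[where K = C]) (simp_all add: lin scaleR_eq_dscale mult.commute)
qed

lemma bounded_linear_compact_op:
  assumes K: "compact_op K" shows "bounded_linear K"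
proof -
  have lin: "K (f + g) = K f + K g" "K (dscale c f) = dscale c (K f)" for c f g
    using K by (auto simp: compact_op_def clinear_op_def)
  have "bounded (closure (K ` cball 0 1))"
    using K unfolding compact_op_def by (blast intro: compact_imp_bounded)
  then obtain B where bd: "\<forall>y\<in>closure (K ` cball 0 1). norm y \<le> B" unfolding bounded_iff by blast
  have B: "norm (K f) \<le> B" if "norm f \<le> 1" for f
  proof -
    have "K f \<in> K ` cball 0 1" using that by simp
    then show ?thesis using bd closure_subset[of "K ` cball 0 1"] by blast
  qed
  have "norm (K f) \<le> norm f * B" for f
  proof (cases "f = 0")
    case True
    then show ?thesis using lin(1)[of 0 0] by simp
  next
    case False
    have "norm (K ((1 / norm f) *\<^sub>R f)) \<le> B" using False by (intro B) simp
    then show ?thesis using False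
      by (simp add: scaleR_eq_dscale lin norm_dscale norm_divide field_simps)
  qed
  then show ?thesis by (intro bounded_linear_intro) (simp_all add: lin scaleR_eq_dscale)
qed

text \<open>
  The infimum that defines the essential norm is over a set bounded below, since operator norms of
  bounded operators are nonnegative. This is why compact operators have to be bounded first.
\<close>

lemma ess_norm_le:
  assumes T: "bounded_clinear T" and K: "compact_op K" and C: "0 \<le> C"
    and b: "\<And>f. norm (T f - K f) \<le> C * norm f"
  shows "ess_norm T \<le> C"
proof -
  have "bdd_below {onorm (\<lambda>f. T f - K f) |K. compact_op K}"
  proof (rule bdd_belowI)
    fix x assume "x \<in> {onorm (\<lambda>f. T f - K f) |K. compact_op K}"
    then obtain L where L: "compact_op L" "x = onorm (\<lambda>f. T f - L f)" by blast
    then show "0 \<le> x"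
      using bounded_linear_sub[OF bounded_linear_bounded_clinear[OF T] bounded_linear_compact_op[OF L(1)]]
      by (simp add: onorm_pos_le)
  qed
  then have "ess_norm T \<le> onorm (\<lambda>f. T f - K f)"
    unfolding ess_norm_def using K by (intro cInf_lower) blast
  also have "\<dots> \<le> C" using b C by (intro onorm_bound)
  finally show ?thesis .
qed

lemma ess_norm_ge:
  assumes "\<And>K. compact_op K \<Longrightarrow> C \<le> onorm (\<lambda>f. T f - K f)"
  shows "C \<le> ess_norm T"
  unfolding ess_norm_def
proof (rule cInf_greatest)
  show "{onorm (\<lambda>f. T f - K f) |K. compact_op K} \<noteq> {}" using compact_op_zero by blast
qed (use assms in blast)

section \<open>The upper bounds\<close>

lemma
  assumes phi: "univalent_self_map \<phi>"
  shows chain_deriv_add: "z \<in> disk \<Longrightarrow> chain_deriv \<phi> (f + g) z = chain_deriv \<phi> f z + chain_deriv \<phi> g z"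
    and chain_deriv_dscale: "z \<in> disk \<Longrightarrow> chain_deriv \<phi> (dscale c f) z = c * chain_deriv \<phi> f z"
proof -
  assume z: "z \<in> disk"
  then have pz: "\<phi> z \<in> disk" by (rule univalent_self_mapD(3)[OF phi])
  note d = dfun_field_differentiable[OF pz]
  have "deriv (dfun (f + g)) (\<phi> z) = deriv (dfun f) (\<phi> z) + deriv (dfun g) (\<phi> z)"
    unfolding plus_dirichlet.rep_eq by (rule deriv_add[OF d d])
  then show "chain_deriv \<phi> (f + g) z = chain_deriv \<phi> f z + chain_deriv \<phi> g z"
    by (simp add: chain_deriv_def algebra_simps)
  have "deriv (dfun (dscale c f)) (\<phi> z) = c * deriv (dfun f) (\<phi> z)"
    unfolding dscale.rep_eq by (rule deriv_cmult[OF d])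
  then show "chain_deriv \<phi> (dscale c f) z = c * chain_deriv \<phi> f z"
    by (simp add: chain_deriv_def)
qed

definition L2_inner :: "(complex \<Rightarrow> complex) \<Rightarrow> (complex \<Rightarrow> complex) \<Rightarrow> complex" where
  "L2_inner u v = (LINT z:disk|lborel. u z * cnj (v z)) / of_real pi"

lemma L2_inner_bound: "u \<in> L2_disk \<Longrightarrow> v \<in> L2_disk \<Longrightarrow> cmod (L2_inner u v) \<le> norm_L2 u * norm_L2 v"
  unfolding L2_inner_def by (rule L2_disk_product)

lemma L2_inner_commute: "L2_inner v u = cnj (L2_inner u v)"
proof -
  have "cnj (LINT z:disk|lborel. u z * cnj (v z)) = (LINT z:disk|lborel. v z * cnj (u z))"
    unfolding set_lebesgue_integral_def
    by (subst Bochner_Integration.integral_cnj[symmetric]) (simp add: scaleR_conv_of_real mult_ac)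
  then show ?thesis by (simp add: L2_inner_def)
qed

lemma L2_inner_cong:
  assumes "\<And>z. z \<in> disk \<Longrightarrow> u z * cnj (v z) = u' z * cnj (v' z)"
  shows "L2_inner u v = L2_inner u' v'"
  unfolding L2_inner_def using assms
  by (intro arg_cong2[where f = "(/)"] set_lebesgue_integral_cong refl) auto

lemma L2_inner_add_left:
  assumes "u \<in> L2_disk" "u' \<in> L2_disk" "v \<in> L2_disk"
  shows "L2_inner (\<lambda>z. u z + u' z) v = L2_inner u v + L2_inner u' v"
  unfolding L2_inner_def distrib_right
  by (subst set_integral_add(2)) (auto intro: L2_disk_product assms simp: add_divide_distrib)

lemma L2_inner_cmult_left: "L2_inner (\<lambda>z. c * u z) v = c * L2_inner u v"
  unfolding L2_inner_def by (simp add: mult.assoc)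

lemma L2_disk_add:
  assumes u: "u \<in> L2_disk" and v: "v \<in> L2_disk"
  shows "(\<lambda>z. u z + v z) \<in> L2_disk"
proof -
  have m: "(\<lambda>z. indicator disk z *\<^sub>R (u z + v z)) \<in> borel_measurable borel"
    unfolding scaleR_add_right using u v by (intro borel_measurable_add) (simp_all add: L2_disk_def)
  have i: "set_integrable lborel disk (\<lambda>z. 2 * (cmod (u z))\<^sup>2 + 2 * (cmod (v z))\<^sup>2)"
    using u v by (intro set_integral_add set_integrable_mult_right) (auto simp: L2_disk_def)
  have b: "(cmod (x + y))\<^sup>2 \<le> 2 * (cmod x)\<^sup>2 + 2 * (cmod y)\<^sup>2" for x y
  proof -
    have "(cmod (x + y))\<^sup>2 \<le> (cmod x + cmod y)\<^sup>2" by (intro power_mono norm_triangle_ineq) auto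
    also have "\<dots> \<le> 2 * (cmod x)\<^sup>2 + 2 * (cmod y)\<^sup>2"
      using sum_squares_bound[of "cmod x" "cmod y"] by (simp add: power2_sum)
    finally show ?thesis .
  qed
  have "(\<lambda>z. (cmod (indicator disk z *\<^sub>R (u z + v z)))\<^sup>2) \<in> borel_measurable borel"
    by (intro borel_measurable_power measurable_compose[OF m] borel_measurable_norm)
  also have "(\<lambda>z. (cmod (indicator disk z *\<^sub>R (u z + v z)))\<^sup>2) = (\<lambda>z. indicator disk z *\<^sub>R (cmod (u z + v z))\<^sup>2)"
    by (auto simp: indicator_def)
  finally have "set_integrable lborel disk (\<lambda>z. (cmod (u z + v z))\<^sup>2)"
    unfolding set_integrable_def
    by (intro Bochner_Integration.integrable_bound[OF i[unfolded set_integrable_def]])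
      (auto simp: indicator_def b)
  then show ?thesis using m by (simp add: L2_disk_def)
qed

lemma L2_disk_zero: "(\<lambda>z. 0) \<in> L2_disk"
  by (rule L2_disk_boundedI[where B = 0]) auto

lemma L2_disk_sum:
  "(\<And>i. i \<in> I \<Longrightarrow> u i \<in> L2_disk) \<Longrightarrow> (\<lambda>z. \<Sum>i\<in>I. u i z) \<in> L2_disk"
  by (induction I rule: infinite_finite_induct) (auto simp: L2_disk_zero intro: L2_disk_add)

lemma L2_inner_sum_left:
  assumes "\<And>i. i \<in> I \<Longrightarrow> u i \<in> L2_disk" "v \<in> L2_disk"
  shows "L2_inner (\<lambda>z. \<Sum>i\<in>I. u i z) v = (\<Sum>i\<in>I. L2_inner (u i) v)"
  using assms
proof (induction I rule: infinite_finite_induct)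
  case (insert x F)
  then show ?case by (simp add: L2_inner_add_left L2_disk_sum)
qed (simp_all add: L2_inner_def set_lebesgue_integral_def)

lemma chain_deriv_functional:
  assumes phi: "univalent_self_map \<phi>" and G: "G \<in> L2_disk"
  shows "\<exists>u. \<forall>g. dinner g u = L2_inner (chain_deriv \<phi> g) G"
proof -
  note L = chain_deriv_L2(1)[OF phi]
  have "\<exists>u. \<forall>g. L2_inner (chain_deriv \<phi> g) G = dinner g u"
  proof (rule riesz_representation)
    show "L2_inner (chain_deriv \<phi> (f + g)) G = L2_inner (chain_deriv \<phi> f) G + L2_inner (chain_deriv \<phi> g) G" for f g
      unfolding L2_inner_add_left[OF L L G, symmetric]
      by (rule L2_inner_cong) (simp add: chain_deriv_add[OF phi])
    show "L2_inner (chain_deriv \<phi> (dscale c f)) G = c * L2_inner (chain_deriv \<phi> f) G" for c f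
      unfolding L2_inner_cmult_left[symmetric]
      by (rule L2_inner_cong) (simp add: chain_deriv_dscale[OF phi])
    show "cmod (L2_inner (chain_deriv \<phi> f) G) \<le> norm_L2 G * norm f" for f
    proof -
      have "cmod (L2_inner (chain_deriv \<phi> f) G) \<le> norm_L2 (chain_deriv \<phi> f) * norm_L2 G"
        by (rule L2_inner_bound[OF L G])
      also have "\<dots> \<le> norm f * norm_L2 G"
        using order_trans[OF chain_deriv_L2(2)[OF phi] norm_L2_deriv_le] by (intro mult_right_mono) auto
      finally show ?thesis by (simp add: mult.commute)
    qed
  qed
  then show ?thesis by metis
qed

text \<open>
  Restricting to \<open>|\<phi>| \<le> r\<close> or to its complement is how the disk is divided into a part where \<open>f \<circ> \<phi>\<close>
  is controlled and a part where \<open>g \<circ> \<psi>\<close> is.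
\<close>

lemma L2_disk_cut_sublevel:
  assumes u: "u \<in> L2_disk" and phi: "\<phi> holomorphic_on disk"
  shows "(\<lambda>z. if cmod (\<phi> z) \<le> r then u z else 0) \<in> L2_disk"
    and "(\<lambda>z. if cmod (\<phi> z) \<le> r then 0 else u z) \<in> L2_disk"
proof -
  define p where "p z = indicator disk z *\<^sub>R \<phi> z" for z
  define v where "v z = indicator disk z *\<^sub>R u z" for z
  have [measurable]: "p \<in> borel_measurable borel" unfolding p_def
    by (intro borel_measurable_continuous_on_indicator holomorphic_on_imp_continuous_on phi) auto
  have [measurable]: "v \<in> borel_measurable borel" using u unfolding L2_disk_def v_def by simp
  have "(\<lambda>z. if cmod (p z) \<le> r then v z else 0) \<in> borel_measurable borel" by measurable
  also have "(\<lambda>z. if cmod (p z) \<le> r then v z else 0) = (\<lambda>z. indicator disk z *\<^sub>R (if cmod (\<phi> z) \<le> r then u z else 0))"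
    by (auto simp: p_def v_def indicator_def)
  finally show "(\<lambda>z. if cmod (\<phi> z) \<le> r then u z else 0) \<in> L2_disk"
    by (intro L2_disk_dominated[OF u]) auto
  have "(\<lambda>z. if cmod (p z) \<le> r then 0 else v z) \<in> borel_measurable borel" by measurable
  also have "(\<lambda>z. if cmod (p z) \<le> r then 0 else v z) = (\<lambda>z. indicator disk z *\<^sub>R (if cmod (\<phi> z) \<le> r then 0 else u z))"
    by (auto simp: p_def v_def indicator_def)
  finally show "(\<lambda>z. if cmod (\<phi> z) \<le> r then 0 else u z) \<in> L2_disk"
    by (intro L2_disk_dominated[OF u]) auto
qed

text \<open>
  The derivative of \<open>\<phi>\<close> is the derivative of the composition of the identity with \<open>\<phi>\<close>.
\<close>

lemma deriv_L2_disk: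
  assumes phi: "univalent_self_map \<phi>"
  shows "deriv \<phi> \<in> L2_disk" "norm_L2 (deriv \<phi>) \<le> 1"
proof -
  have e: "chain_deriv \<phi> (zpow 0) z = deriv \<phi> z" if "z \<in> disk" for z
    using univalent_self_mapD(3)[OF phi that] by (simp add: chain_deriv_def deriv_dfun_zpow)
  show "deriv \<phi> \<in> L2_disk"
    using chain_deriv_L2(1)[OF phi, of "zpow 0"] L2_disk_cong(1)[OF e] by simp
  have "norm_L2 (deriv \<phi>) = norm_L2 (chain_deriv \<phi> (zpow 0))" by (rule L2_disk_cong(2)[OF e, symmetric])
  also have "\<dots> \<le> norm (zpow 0)" using chain_deriv_L2(2)[OF phi] norm_L2_deriv_le order_trans by blast
  also have "\<dots> \<le> 1" using norm_zpow_le[of 0] by simp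
  finally show "norm_L2 (deriv \<phi>) \<le> 1" .
qed

lemma power_deriv_L2_disk:
  assumes phi: "univalent_self_map \<phi>"
  shows "(\<lambda>z. \<phi> z ^ n * deriv \<phi> z) \<in> L2_disk"
proof (rule L2_disk_dominated[OF deriv_L2_disk(1)[OF phi]])
  note p = univalent_self_mapD[OF phi]
  show "(\<lambda>z. indicator disk z *\<^sub>R (\<phi> z ^ n * deriv \<phi> z)) \<in> borel_measurable borel"
    by (intro borel_measurable_continuous_on_indicator holomorphic_on_imp_continuous_on holomorphic_intros holomorphic_deriv p) auto
  show "cmod (\<phi> z ^ n * deriv \<phi> z) \<le> cmod (deriv \<phi> z)" if "z \<in> disk" for z
    using p(3)[OF that] by (simp add: norm_mult norm_power mult_left_le_one_le power_le_one)
qed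

text \<open>
  The derivative of \<open>f \<circ> \<phi>\<close> with the outer derivative \<open>f'\<close> replaced by its Taylor polynomial
  of degree less than \<open>N\<close>.
\<close>

definition taylor_chain_deriv :: "(complex \<Rightarrow> complex) \<Rightarrow> nat \<Rightarrow> dirichlet \<Rightarrow> complex \<Rightarrow> complex" where
  "taylor_chain_deriv \<phi> N f z = (\<Sum>n<N. dinner f (zpow n) * (\<phi> z ^ n * deriv \<phi> z))"

lemma chain_deriv_taylor_error:
  assumes r: "r < 1" and z: "cmod (\<phi> z) \<le> r"
  shows "cmod (chain_deriv \<phi> f z - taylor_chain_deriv \<phi> N f z) \<le> norm f * bergman_tail r N * cmod (deriv \<phi> z)"
proof -
  have "chain_deriv \<phi> f z - taylor_chain_deriv \<phi> N f z
      = (deriv (dfun f) (\<phi> z) - (\<Sum>n<N. dinner f (zpow n) * \<phi> z ^ n)) * deriv \<phi> z"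
    by (simp add: chain_deriv_def taylor_chain_deriv_def sum_distrib_right left_diff_distrib mult.assoc)
  then show ?thesis
    using deriv_dfun_taylor_error[OF r z, of f N] by (simp add: norm_mult mult_right_mono)
qed

lemma taylor_chain_deriv_L2: "univalent_self_map \<phi> \<Longrightarrow> taylor_chain_deriv \<phi> N f \<in> L2_disk"
  unfolding taylor_chain_deriv_def by (intro L2_disk_sum L2_disk_cmult power_deriv_L2_disk)

lemma dinner_comp_op:
  assumes "univalent_self_map \<phi>" "univalent_self_map \<psi>"
  shows "dinner (comp_op \<phi> f) (comp_op \<psi> g)
     = dfun f (\<phi> 0) * cnj (dfun g (\<psi> 0)) + L2_inner (chain_deriv \<phi> f) (chain_deriv \<psi> g)"
proof -
  have "(LINT z:disk|lborel. deriv (dfun (comp_op \<phi> f)) z * cnj (deriv (dfun (comp_op \<psi> g)) z))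
      = (LINT z:disk|lborel. chain_deriv \<phi> f z * cnj (chain_deriv \<psi> g z))"
    by (intro set_lebesgue_integral_cong) (simp_all add: deriv_dfun_comp_op assms)
  then show ?thesis
    by (simp add: dinner_formula dfun_comp_op assms L2_inner_def)
qed

text \<open>
  The subtracted operator \<open>f \<mapsto> f (\<phi> 0) k\<close>, with \<open>k\<close> the kernel at \<open>\<psi> 0\<close>, has rank one and
  represents the product of the values at the origin. What remains is the area integral.
\<close>

lemma ess_norm_le_1:
  assumes phi: "univalent_self_map \<phi>" and psi: "univalent_self_map \<psi>"
  shows "ess_norm (hadjoint (comp_op \<psi>) \<circ> comp_op \<phi>) \<le> 1"
proof (rule ess_norm_le)
  let ?T = "hadjoint (comp_op \<psi>) \<circ> comp_op \<phi>"
  let ?K = "\<lambda>f. dscale (dinner f (rkernel (\<phi> 0))) (rkernel (\<psi> 0))"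
  note b = bounded_clinear_comp_op[OF phi] bounded_clinear_comp_op[OF psi]
  have p0: "\<phi> 0 \<in> disk" "\<psi> 0 \<in> disk"
    using univalent_self_mapD(3)[OF phi] univalent_self_mapD(3)[OF psi] by simp_all
  show "bounded_clinear ?T" by (rule bounded_clinear_hadjoint_comp[OF b(2,1)])
  show "compact_op ?K" by (rule compact_op_rank_one)
  fix f
  show "norm (?T f - ?K f) \<le> 1 * norm f"
  proof (rule dirichlet_norm_leI)
    fix g
    have "dinner (?K f) g = dfun f (\<phi> 0) * cnj (dfun g (\<psi> 0))"
      by (simp add: dinner_dscale_left dinner_rkernel[OF p0(1)] dinner_commute[of "rkernel _" g] dinner_rkernel[OF p0(2)])
    then have dT: "dinner (?T f - ?K f) g = L2_inner (chain_deriv \<phi> f) (chain_deriv \<psi> g)"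
      unfolding dinner_diff_left dinner_hadjoint_comp[OF b(2)] dinner_comp_op[OF phi psi] by simp
    have "cmod (dinner (?T f - ?K f) g) \<le> norm_L2 (chain_deriv \<phi> f) * norm_L2 (chain_deriv \<psi> g)"
      unfolding dT by (intro L2_inner_bound chain_deriv_L2 phi psi)
    also have "\<dots> \<le> norm f * norm g"
      using order_trans[OF chain_deriv_L2(2)[OF phi] norm_L2_deriv_le]
        order_trans[OF chain_deriv_L2(2)[OF psi] norm_L2_deriv_le] by (intro mult_mono) auto
    finally show "cmod (dinner (?T f - ?K f) g) \<le> 1 * norm f * norm g" by simp
  qed simp
qed simp

text \<open>
  Split the area integral at \<open>E = {z. |\<phi> z| \<le> r}\<close>. On \<open>E\<close> replace \<open>f'\<close> by its Taylor
  polynomial: the result is a finite sum of coefficients of \<open>f\<close> times bounded functionals of \<open>g\<close>,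
  which Riesz's theorem represents by vectors \<open>u n\<close>. Off \<open>E\<close> one has \<open>|\<psi>| \<le> r\<close>, and the roles
  are exchanged, with vectors \<open>v n\<close>. Each replacement costs at most the Bergman tail, because
  the error is dominated by the tail times \<open>|\<phi>'|\<close> or \<open>|\<psi>'|\<close>, whose norms are at most 1.
\<close>

lemma ess_norm_le_bergman_tail:
  assumes phi: "univalent_self_map \<phi>" and psi: "univalent_self_map \<psi>"
    and r: "0 \<le> r" "r < 1" and cover: "\<And>z. z \<in> disk \<Longrightarrow> cmod (\<phi> z) \<le> r \<or> cmod (\<psi> z) \<le> r"
  shows "ess_norm (hadjoint (comp_op \<psi>) \<circ> comp_op \<phi>) \<le> 2 * bergman_tail r N"
proof -
  let ?T = "hadjoint (comp_op \<psi>) \<circ> comp_op \<phi>"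
  let ?E = "\<lambda>z. cmod (\<phi> z) \<le> r"
  define cut where "cut u z = (if ?E z then u z else 0)" for u :: "complex \<Rightarrow> complex" and z
  define cut' where "cut' u z = (if ?E z then 0 else u z)" for u :: "complex \<Rightarrow> complex" and z
  have cutL: "cut u \<in> L2_disk" "cut' u \<in> L2_disk" if "u \<in> L2_disk" for u
    using L2_disk_cut_sublevel[OF that univalent_self_mapD(1)[OF phi], of r]
    by (simp_all only: cut_def[abs_def] cut'_def[abs_def])
  note b = bounded_clinear_comp_op[OF phi] bounded_clinear_comp_op[OF psi]
  have p0: "\<phi> 0 \<in> disk" "\<psi> 0 \<in> disk"
    using univalent_self_mapD(3)[OF phi] univalent_self_mapD(3)[OF psi] by simp_all
  note A = chain_deriv_L2(1)[OF phi] and A' = chain_deriv_L2(1)[OF psi]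
  have tb: "0 \<le> bergman_tail r N"
    unfolding bergman_tail_def using r summable_Suc_power[of r]
    by (intro suminf_nonneg) (subst summable_iff_shift, auto)
  have "\<exists>u. \<forall>g. dinner g u = L2_inner (chain_deriv \<psi> g) (cut (\<lambda>z. \<phi> z ^ n * deriv \<phi> z))" for n
    by (intro chain_deriv_functional psi cutL power_deriv_L2_disk phi)
  then obtain u where u: "\<And>n g. dinner g (u n) = L2_inner (chain_deriv \<psi> g) (cut (\<lambda>z. \<phi> z ^ n * deriv \<phi> z))"
    by metis
  have "\<exists>v. \<forall>f. dinner f v = L2_inner (chain_deriv \<phi> f) (cut' (\<lambda>z. \<psi> z ^ n * deriv \<psi> z))" for n
    by (intro chain_deriv_functional psi cutL power_deriv_L2_disk phi)
  then obtain v where v: "\<And>n f. dinner f (v n) = L2_inner (chain_deriv \<phi> f) (cut' (\<lambda>z. \<psi> z ^ n * deriv \<psi> z))"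
    by metis
  define K where "K f = dscale (dinner f (rkernel (\<phi> 0))) (rkernel (\<psi> 0))
     + (\<Sum>n<N. dscale (dinner f (zpow n)) (u n) + dscale (dinner f (v n)) (zpow n))" for f
  have cK: "compact_op K"
    unfolding K_def by (intro compact_op_add compact_op_rank_one compact_op_sum) simp
  have main: "cmod (dinner (?T f - K f) g) \<le> 2 * bergman_tail r N * norm f * norm g" for f g
  proof -
    let ?Pf = "taylor_chain_deriv \<phi> N f" and ?Pg = "taylor_chain_deriv \<psi> N g"
    let ?Af = "chain_deriv \<phi> f" and ?Ag = "chain_deriv \<psi> g"
    define Rf where "Rf z = ?Af z - ?Pf z" for z
    define Rg where "Rg z = ?Ag z - ?Pg z" for z
    note P = taylor_chain_deriv_L2[OF phi, of N f] taylor_chain_deriv_L2[OF psi, of N g]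
    have RL: "Rf \<in> L2_disk" "Rg \<in> L2_disk"
      unfolding Rf_def Rg_def
      using L2_disk_add[OF A L2_disk_cmult[OF P(1), of "-1"], of f] L2_disk_add[OF A' L2_disk_cmult[OF P(2), of "-1"], of g] by simp_all
    have split: "L2_inner ?Af ?Ag = (L2_inner (cut ?Pf) ?Ag + L2_inner (cut Rf) ?Ag)
        + (cnj (L2_inner (cut' ?Pg) ?Af) + cnj (L2_inner (cut' Rg) ?Af))"
    proof -
      have "L2_inner ?Af ?Ag = L2_inner (\<lambda>z. cut ?Af z + cut' ?Af z) ?Ag"
        by (rule L2_inner_cong) (simp add: cut_def cut'_def)
      also have "\<dots> = L2_inner (cut ?Af) ?Ag + L2_inner (cut' ?Af) ?Ag"
        by (intro L2_inner_add_left cutL A A')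
      also have "L2_inner (cut ?Af) ?Ag = L2_inner (\<lambda>z. cut ?Pf z + cut Rf z) ?Ag"
        by (rule L2_inner_cong) (simp add: cut_def Rf_def)
      also have "\<dots> = L2_inner (cut ?Pf) ?Ag + L2_inner (cut Rf) ?Ag"
        by (intro L2_inner_add_left cutL P RL A')
      also have "L2_inner (cut' ?Af) ?Ag = L2_inner ?Af (\<lambda>z. cut' ?Pg z + cut' Rg z)"
        by (rule L2_inner_cong) (simp add: cut'_def Rg_def)
      also have "\<dots> = cnj (L2_inner (\<lambda>z. cut' ?Pg z + cut' Rg z) ?Af)" by (rule L2_inner_commute)
      also have "L2_inner (\<lambda>z. cut' ?Pg z + cut' Rg z) ?Af = L2_inner (cut' ?Pg) ?Af + L2_inner (cut' Rg) ?Af"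
        by (intro L2_inner_add_left cutL P RL A)
      finally show ?thesis by simp
    qed
    have t1: "L2_inner (cut ?Pf) ?Ag = (\<Sum>n<N. dinner f (zpow n) * dinner (u n) g)"
    proof -
      have "L2_inner (cut ?Pf) ?Ag = L2_inner (\<lambda>z. \<Sum>n<N. dinner f (zpow n) * cut (\<lambda>z. \<phi> z ^ n * deriv \<phi> z) z) ?Ag"
        by (rule L2_inner_cong) (simp add: cut_def taylor_chain_deriv_def)
      also have "\<dots> = (\<Sum>n<N. dinner f (zpow n) * L2_inner (cut (\<lambda>z. \<phi> z ^ n * deriv \<phi> z)) ?Ag)"
        unfolding L2_inner_cmult_left[symmetric]
        by (intro L2_inner_sum_left A' L2_disk_cmult cutL power_deriv_L2_disk phi)
      finally show ?thesis
        by (simp add: u dinner_commute[of "u _" g] L2_inner_commute[of _ ?Ag])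
    qed
    have t2: "L2_inner (cut' ?Pg) ?Af = (\<Sum>n<N. dinner g (zpow n) * dinner (v n) f)"
    proof -
      have "L2_inner (cut' ?Pg) ?Af = L2_inner (\<lambda>z. \<Sum>n<N. dinner g (zpow n) * cut' (\<lambda>z. \<psi> z ^ n * deriv \<psi> z) z) ?Af"
        by (rule L2_inner_cong) (simp add: cut'_def taylor_chain_deriv_def)
      also have "\<dots> = (\<Sum>n<N. dinner g (zpow n) * L2_inner (cut' (\<lambda>z. \<psi> z ^ n * deriv \<psi> z)) ?Af)"
        unfolding L2_inner_cmult_left[symmetric]
        by (intro L2_inner_sum_left A L2_disk_cmult cutL power_deriv_L2_disk psi)
      finally show ?thesis
        by (simp add: v dinner_commute[of "v _" f] L2_inner_commute[of _ ?Af])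
    qed
    have dK: "dinner (K f) g = dfun f (\<phi> 0) * cnj (dfun g (\<psi> 0)) + L2_inner (cut ?Pf) ?Ag + cnj (L2_inner (cut' ?Pg) ?Af)"
      unfolding t1 t2 K_def dinner_add_left dinner_sum_left dinner_dscale_left
      by (simp add: sum.distrib dinner_rkernel[OF p0(1)] dinner_commute[of "rkernel _" g] dinner_rkernel[OF p0(2)]
          dinner_commute[of f "v _"] dinner_commute[of g "zpow _"] mult.commute)
    have dR: "dinner (?T f - K f) g = L2_inner (cut Rf) ?Ag + cnj (L2_inner (cut' Rg) ?Af)"
      unfolding dinner_diff_left dinner_hadjoint_comp[OF b(2)] dinner_comp_op[OF phi psi] dK split by simp
    have "cmod (dinner (?T f - K f) g) \<le> cmod (L2_inner (cut Rf) ?Ag) + cmod (L2_inner (cut' Rg) ?Af)"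
      unfolding dR by (rule order_trans[OF norm_triangle_ineq]) simp
    also have "\<dots> \<le> (norm f * bergman_tail r N) * norm g + (norm g * bergman_tail r N) * norm f"
    proof (rule add_mono)
      have R: "norm_L2 (cut Rf) \<le> norm f * bergman_tail r N"
      proof -
        have "norm_L2 (cut Rf) \<le> norm_L2 (\<lambda>z. of_real (norm f * bergman_tail r N) * deriv \<phi> z)"
        proof (rule norm_L2_mono)
          show "cmod (cut Rf z) \<le> cmod (of_real (norm f * bergman_tail r N) * deriv \<phi> z)" for z
            using chain_deriv_taylor_error[OF r(2), of \<phi> z f N] tb by (auto simp: cut_def Rf_def norm_mult)
        qed (intro cutL RL L2_disk_cmult deriv_L2_disk phi)+
        also have "\<dots> \<le> (norm f * bergman_tail r N) * 1"
          unfolding norm_L2_cmult using tb deriv_L2_disk(2)[OF phi] by (intro mult_mono) (auto simp: norm_mult)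
        finally show ?thesis by simp
      qed
      have "cmod (L2_inner (cut Rf) ?Ag) \<le> norm_L2 (cut Rf) * norm_L2 ?Ag"
        by (intro L2_inner_bound cutL RL A')
      also have "\<dots> \<le> (norm f * bergman_tail r N) * norm g"
        using R tb order_trans[OF chain_deriv_L2(2)[OF psi] norm_L2_deriv_le] by (intro mult_mono) auto
      finally show "cmod (L2_inner (cut Rf) ?Ag) \<le> (norm f * bergman_tail r N) * norm g" .
      have R: "norm_L2 (cut' Rg) \<le> norm g * bergman_tail r N"
      proof -
        have "norm_L2 (cut' Rg) \<le> norm_L2 (\<lambda>z. of_real (norm g * bergman_tail r N) * deriv \<psi> z)"
        proof (rule norm_L2_mono)
          show "cmod (cut' Rg z) \<le> cmod (of_real (norm g * bergman_tail r N) * deriv \<psi> z)" if "z \<in> disk" for z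
            using chain_deriv_taylor_error[OF r(2), of \<psi> z g N] tb cover[OF that] by (auto simp: cut'_def Rg_def norm_mult)
        qed (intro cutL RL L2_disk_cmult deriv_L2_disk psi)+
        also have "\<dots> \<le> (norm g * bergman_tail r N) * 1"
          unfolding norm_L2_cmult using tb deriv_L2_disk(2)[OF psi] by (intro mult_mono) (auto simp: norm_mult)
        finally show ?thesis by simp
      qed
      have "cmod (L2_inner (cut' Rg) ?Af) \<le> norm_L2 (cut' Rg) * norm_L2 ?Af"
        by (intro L2_inner_bound cutL RL A)
      also have "\<dots> \<le> (norm g * bergman_tail r N) * norm f"
        using R tb order_trans[OF chain_deriv_L2(2)[OF phi] norm_L2_deriv_le] by (intro mult_mono) auto
      finally show "cmod (L2_inner (cut' Rg) ?Af) \<le> (norm g * bergman_tail r N) * norm f" .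
    qed
    finally show ?thesis by (simp add: algebra_simps)
  qed
  show ?thesis
  proof (rule ess_norm_le[OF bounded_clinear_hadjoint_comp[OF b(2,1)] cK])
    show "norm (?T f - K f) \<le> 2 * bergman_tail r N * norm f" for f
      by (rule dirichlet_norm_leI[OF main]) (simp add: tb)
  qed (simp add: tb)
qed

lemma ess_norm_nonneg:
  assumes "bounded_clinear T" shows "0 \<le> ess_norm T"
  using assms
  by (intro ess_norm_ge onorm_pos_le bounded_linear_sub bounded_linear_bounded_clinear bounded_linear_compact_op)

lemma ess_norm_eq_0:
  assumes phi: "univalent_self_map \<phi>" and psi: "univalent_self_map \<psi>"
    and r: "0 \<le> r" "r < 1" and cover: "\<And>z. z \<in> disk \<Longrightarrow> cmod (\<phi> z) \<le> r \<or> cmod (\<psi> z) \<le> r"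
  shows "ess_norm (hadjoint (comp_op \<psi>) \<circ> comp_op \<phi>) = 0"
proof (rule antisym)
  have "(\<lambda>N. 2 * bergman_tail r N) \<longlonglongrightarrow> 2 * 0"
    by (intro tendsto_intros bergman_tail_tendsto_0 r)
  then show "ess_norm (hadjoint (comp_op \<psi>) \<circ> comp_op \<phi>) \<le> 0"
    using ess_norm_le_bergman_tail[OF assms] by (intro LIMSEQ_le_const[where X = "\<lambda>N. 2 * bergman_tail r N"]) auto
  show "0 \<le> ess_norm (hadjoint (comp_op \<psi>) \<circ> comp_op \<phi>)"
    by (intro ess_norm_nonneg bounded_clinear_hadjoint_comp bounded_clinear_comp_op phi psi)
qed

section \<open>Normalised kernels near the circle\<close>

lemma norm_rkernel_pos: "w \<in> disk \<Longrightarrow> 0 < norm (rkernel w)"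
proof -
  assume w: "w \<in> disk"
  have "dfun (rkernel w) 0 = 1" using w by (simp add: dfun_rkernel)
  then have "rkernel w \<noteq> 0" by auto
  then show ?thesis by simp
qed

lemma norm_rkernel_at_top:
  assumes x: "\<And>n. x n \<in> disk" and lim: "(\<lambda>n. cmod (x n)) \<longlonglongrightarrow> 1"
  shows "filterlim (\<lambda>n. norm (rkernel (x n))) at_top sequentially"
proof -
  have l: "(cmod (x n))\<^sup>2 < 1" for n using x[of n] by (simp add: power_less_one_iff)
  have "(\<lambda>n. 1 - (cmod (x n))\<^sup>2) \<longlonglongrightarrow> 1 - 1\<^sup>2" by (intro tendsto_intros lim)
  then have "filterlim (\<lambda>n. 1 - (cmod (x n))\<^sup>2) (at_right 0) sequentially"
    by (intro tendsto_imp_filterlim_at_right) (auto simp: l)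
  then have "filterlim (\<lambda>n. ln (1 - (cmod (x n))\<^sup>2)) at_bot sequentially"
    by (rule filterlim_compose[OF ln_at_0])
  then have "filterlim (\<lambda>n. 1 + - ln (1 - (cmod (x n))\<^sup>2)) at_top sequentially"
    by (intro filterlim_tendsto_add_at_top[OF tendsto_const] filterlim_uminus_at_bot[THEN iffD1])
  then have "filterlim (\<lambda>n. (norm (rkernel (x n)))\<^sup>2) at_top sequentially"
    by (simp add: norm_rkernel_sq[OF x])
  then have "filterlim (\<lambda>n. sqrt ((norm (rkernel (x n)))\<^sup>2)) at_top sequentially"
    by (rule filterlim_compose[OF sqrt_at_top])
  then show ?thesis by simp
qed

lemma univalent_self_map_ident: "univalent_self_map (\<lambda>z. z)"
  by (simp add: univalent_self_map_def)

lemma norm_L2_bounded: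
  assumes "u \<in> L2_disk" "0 \<le> B" "\<And>z. z \<in> disk \<Longrightarrow> cmod (u z) \<le> B"
  shows "norm_L2 u \<le> B"
proof -
  note i = deriv_L2_disk[OF univalent_self_map_ident]
  have "norm_L2 u \<le> norm_L2 (\<lambda>z. of_real B * deriv (\<lambda>z. z) z)"
    by (rule norm_L2_mono[OF assms(1) L2_disk_cmult[OF i(1)]]) (use assms in \<open>simp add: norm_mult\<close>)
  also have "\<dots> \<le> B * 1" unfolding norm_L2_cmult using i(2) assms(2) by (intro mult_mono) auto
  finally show ?thesis by simp
qed

lemma L2_tail_small:
  assumes u: "u \<in> L2_disk" and e: "e > 0"
  shows "\<exists>r. 0 < r \<and> r < 1 \<and> norm_L2 (\<lambda>z. if cmod z \<le> r then 0 else u z) < e"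
proof -
  define R where "R k = 1 - 1 / real (k + 2)" for k
  have R: "0 < R k" "R k < 1" for k by (auto simp: R_def field_simps)
  have RL: "R \<longlonglongrightarrow> 1" unfolding R_def by real_asymp
  have i: "set_integrable lborel disk (\<lambda>z. (cmod (u z))\<^sup>2)" using u by (simp add: L2_disk_def)
  define J where "J A = (LINT z:A|lborel. (cmod (u z))\<^sup>2)" for A
  have J0: "(\<lambda>k. (J disk - J (ball 0 (R k))) / pi) \<longlonglongrightarrow> (J disk - J disk) / pi"
    unfolding J_def by (intro tendsto_intros integral_ball_tendsto_disk i R RL) simp
  have "\<forall>\<^sub>F k in sequentially. (J disk - J (ball 0 (R k))) / pi < e\<^sup>2"
    using e by (intro order_tendstoD(2)[OF J0]) simp
  then obtain k where k: "(J disk - J (ball 0 (R k))) / pi < e\<^sup>2"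
    by (auto simp: eventually_sequentially)
  define v where "v z = (if cmod z \<le> R k then 0 else u z)" for z
  have vL: "v \<in> L2_disk"
    unfolding v_def using L2_disk_cut_sublevel(2)[OF u holomorphic_on_ident] by simp
  have iv: "set_integrable lborel disk (\<lambda>z. (cmod (v z))\<^sup>2)" using vL by (simp add: L2_disk_def)
  have ib: "set_integrable lborel (ball 0 (R k)) (\<lambda>z. (cmod (u z))\<^sup>2)"
    by (rule set_integrable_subset[OF i]) (use R(2)[of k] in auto)
  have "J (ball 0 (R k)) + (LINT z:disk|lborel. (cmod (v z))\<^sup>2) \<le> J disk"
  proof -
    note ii = i[unfolded set_integrable_def] ib[unfolded set_integrable_def] iv[unfolded set_integrable_def]
    have "J (ball 0 (R k)) + (LINT z:disk|lborel. (cmod (v z))\<^sup>2)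
        = (LINT z|lborel. indicator (ball 0 (R k)) z *\<^sub>R (cmod (u z))\<^sup>2 + indicator disk z *\<^sub>R (cmod (v z))\<^sup>2)"
      unfolding J_def set_lebesgue_integral_def by (rule Bochner_Integration.integral_add[OF ii(2,3), symmetric])
    also have "\<dots> \<le> (LINT z|lborel. indicator disk z *\<^sub>R (cmod (u z))\<^sup>2)"
    proof (rule integral_mono[OF Bochner_Integration.integrable_add[OF ii(2,3)] ii(1)])
      show "indicator (ball 0 (R k)) z *\<^sub>R (cmod (u z))\<^sup>2 + indicator disk z *\<^sub>R (cmod (v z))\<^sup>2
          \<le> indicator disk z *\<^sub>R (cmod (u z))\<^sup>2" for z
        using R(2)[of k] by (auto simp: v_def indicator_def)
    qed
    finally show ?thesis by (simp only: J_def set_lebesgue_integral_def)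
  qed
  then have "(norm_L2 v)\<^sup>2 \<le> (J disk - J (ball 0 (R k))) / pi"
    unfolding norm_L2_sq by (intro divide_right_mono) auto
  then have "(norm_L2 v)\<^sup>2 < e\<^sup>2" using k by linarith
  then have "norm_L2 v < e" using e by (intro power2_less_imp_less[of _ e]) auto
  then show ?thesis using R[of k] unfolding v_def[abs_def] by blast
qed

text \<open>
  Split \<open>c' = \<close> inner part \<open>+\<close> outer part at a radius \<open>r\<close> for which the outer part is small in
  norm. The inner part pairs with the kernel to something bounded independently of the point,
  since the kernel derivatives are bounded by \<open>1 / (1 - r)\<close> there; this disappears after division
  by the kernel norm, which tends to infinity. The outer part contributes at most its norm times
  that of the kernel.
\<close>

lemma rkernel_weakly_null:
  assumes x: "\<And>n. x n \<in> disk" and lim: "(\<lambda>n. cmod (x n)) \<longlonglongrightarrow> 1"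
  shows "(\<lambda>n. cmod (dfun c (x n)) / norm (rkernel (x n))) \<longlonglongrightarrow> 0"
proof (rule order_tendstoI)
  fix e :: real assume e: "0 < e"
  define u where "u = deriv (dfun c)"
  have u: "u \<in> L2_disk" by (simp add: u_def)
  obtain r where r: "0 < r" "r < 1" and small: "norm_L2 (\<lambda>z. if cmod z \<le> r then 0 else u z) < e / 2"
    using L2_tail_small[OF u, of "e / 2"] e by auto
  define C where "C = cmod (dfun c 0) + norm_L2 u * (1 / (1 - r))"
  have bound: "cmod (dfun c w) \<le> C + norm_L2 (\<lambda>z. if cmod z \<le> r then 0 else u z) * norm (rkernel w)"
    if w: "w \<in> disk" for w
  proof -
    define k where "k = deriv (dfun (rkernel w))"
    define out where "out = (\<lambda>z. if cmod z \<le> r then 0 else u z)"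
    define kin where "kin = (\<lambda>z. if cmod z \<le> r then k z else 0)"
    have k: "k \<in> L2_disk" by (simp add: k_def)
    have L: "kin \<in> L2_disk" "out \<in> L2_disk"
      unfolding kin_def out_def
      using L2_disk_cut_sublevel(1)[OF k holomorphic_on_ident] L2_disk_cut_sublevel(2)[OF u holomorphic_on_ident] by simp_all
    have iL: "(\<lambda>z. if cmod z \<le> r then u z else 0) \<in> L2_disk"
      using L2_disk_cut_sublevel(1)[OF u holomorphic_on_ident] by simp
    have "dfun c w = dfun c 0 + L2_inner u k"
      using w unfolding dinner_rkernel[OF w, symmetric] dinner_formula[of c "rkernel w"] L2_inner_def u_def k_def
      by (simp add: dfun_rkernel)
    also have "L2_inner u k = L2_inner (\<lambda>z. (if cmod z \<le> r then u z else 0) + out z) k"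
      by (rule L2_inner_cong) (simp add: out_def)
    also have "\<dots> = L2_inner (\<lambda>z. if cmod z \<le> r then u z else 0) k + L2_inner out k"
      by (rule L2_inner_add_left[OF iL L(2) k])
    also have "L2_inner (\<lambda>z. if cmod z \<le> r then u z else 0) k = L2_inner u kin"
      by (rule L2_inner_cong) (simp add: kin_def)
    finally have eq: "dfun c w = dfun c 0 + (L2_inner u kin + L2_inner out k)" .
    have "norm_L2 kin \<le> 1 / (1 - r)"
    proof (rule norm_L2_bounded[OF L(1)])
      fix z assume z: "z \<in> disk"
      show "cmod (kin z) \<le> 1 / (1 - r)"
      proof (cases "cmod z \<le> r")
        case True
        have "cmod (cnj w * z) \<le> 1 * r" unfolding norm_mult using True w by (intro mult_mono) auto
        then have "1 - r \<le> cmod (1 - cnj w * z)" using norm_triangle_ineq2[of 1 "cnj w * z"] by simp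
        then have "cmod w / cmod (1 - cnj w * z) \<le> 1 / (1 - r)" using r w by (intro frac_le) auto
        then show ?thesis using True unfolding kin_def k_def deriv_dfun_rkernel[OF w z] by (simp add: norm_divide)
      qed (use r in \<open>simp add: kin_def\<close>)
    qed (use r in simp)
    then have 1: "cmod (L2_inner u kin) \<le> norm_L2 u * (1 / (1 - r))"
      by (rule order_trans[OF L2_inner_bound[OF u L(1)] mult_left_mono[OF _ norm_L2_nonneg]])
    have 2: "cmod (L2_inner out k) \<le> norm_L2 out * norm (rkernel w)"
    proof (rule order_trans[OF L2_inner_bound[OF L(2) k] mult_left_mono[OF _ norm_L2_nonneg]])
      show "norm_L2 k \<le> norm (rkernel w)" unfolding k_def by (rule norm_L2_deriv_le)
    qed
    have "cmod (dfun c w) \<le> cmod (dfun c 0) + (cmod (L2_inner u kin) + cmod (L2_inner out k))"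
      unfolding eq by (intro order_trans[OF norm_triangle_ineq] add_left_mono norm_triangle_ineq)
    then show ?thesis using 1 2 by (simp add: C_def out_def)
  qed
  have "(\<lambda>n. C / norm (rkernel (x n))) \<longlonglongrightarrow> 0"
    by (rule real_tendsto_divide_at_top[OF tendsto_const norm_rkernel_at_top[OF x lim]])
  then have "\<forall>\<^sub>F n in sequentially. C / norm (rkernel (x n)) < e / 2"
    using order_tendstoD(2) e by (metis half_gt_zero)
  then show "\<forall>\<^sub>F n in sequentially. cmod (dfun c (x n)) / norm (rkernel (x n)) < e"
  proof eventually_elim
    case (elim n)
    note p = norm_rkernel_pos[OF x[of n]]
    have "cmod (dfun c (x n)) / norm (rkernel (x n))
        \<le> (C + norm_L2 (\<lambda>z. if cmod z \<le> r then 0 else u z) * norm (rkernel (x n))) / norm (rkernel (x n))"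
      by (intro divide_right_mono bound x) simp
    also have "\<dots> = C / norm (rkernel (x n)) + norm_L2 (\<lambda>z. if cmod z \<le> r then 0 else u z)"
      using p by (simp add: add_divide_distrib)
    finally show ?case using elim small by linarith
  qed
next
  fix a :: real assume "a < 0"
  moreover have "0 \<le> cmod (dfun c (x n)) / norm (rkernel (x n))" for n by simp
  ultimately show "\<forall>\<^sub>F n in sequentially. a < cmod (dfun c (x n)) / norm (rkernel (x n))"
    by (intro always_eventually allI) (metis less_le_trans)
qed

definition nkernel :: "complex \<Rightarrow> dirichlet" where
  "nkernel w = dscale (of_real (1 / norm (rkernel w))) (rkernel w)"

lemma norm_nkernel: "w \<in> disk \<Longrightarrow> norm (nkernel w) = 1"
  using norm_rkernel_pos[of w] by (simp add: nkernel_def norm_dscale norm_divide)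

lemma dinner_nkernel: "w \<in> disk \<Longrightarrow> dinner f (nkernel w) = dfun f w / of_real (norm (rkernel w))"
  by (simp add: nkernel_def dinner_dscale_right dinner_rkernel)

lemma nkernel_weakly_null:
  assumes x: "\<And>n. x n \<in> disk" and lim: "(\<lambda>n. cmod (x n)) \<longlonglongrightarrow> 1"
  shows "(\<lambda>n. dinner c (nkernel (x n))) \<longlonglongrightarrow> 0"
proof (rule tendsto_norm_zero_cancel)
  show "(\<lambda>n. cmod (dinner c (nkernel (x n)))) \<longlonglongrightarrow> 0"
    using rkernel_weakly_null[OF assms] by (simp add: dinner_nkernel[OF x] norm_divide)
qed

text \<open>
  With \<open>a\<close> and \<open>b\<close> the norms of the kernels at \<open>\<phi> w\<close> and at \<open>w\<close>, the vectors
  \<open>u = C\<^sub>\<phi> k\<^bsub>\<phi> w\<^esub>\<close> and \<open>k\<^sub>w\<close> satisfy \<open>\<langle>u, k\<^sub>w\<rangle> = a / b\<close> and \<open>\<parallel>u\<parallel>\<^sup>2 \<le> 1 + s\<close>, where \<open>s\<close> is the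
  squared modulus of \<open>k\<^bsub>\<phi> w\<^esub>\<close> at \<open>\<phi> 0\<close> and tends to 0. Thus \<open>\<parallel>u - k\<^sub>w\<parallel>\<^sup>2 \<le> 2 + s - 2 a / b\<close>,
  and it suffices that the lower limit of \<open>a / b\<close> is at least 1, which the Lipschitz condition
  gives. The distances to \<open>l\<close> are \<open>1 / (n + 2)\<close> to keep them strictly between 0 and 1.
\<close>

lemma comp_op_nkernel_asymptotics:
  assumes phi: "univalent_self_map \<phi>" and l: "cmod l = 1" and pl: "cmod (\<phi> l) = 1"
    and L: "L > 0" and lip: "\<And>z w. cmod z \<le> 1 \<Longrightarrow> cmod w \<le> 1 \<Longrightarrow> cmod (\<phi> z - \<phi> w) \<le> L * cmod (z - w)"
    and w_def: "\<And>n. w n = of_real (1 - 1 / real (n + 2)) * l"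
  shows "(\<lambda>n. comp_op \<phi> (nkernel (\<phi> (w n))) - nkernel (w n)) \<longlonglongrightarrow> 0"
    and "(\<lambda>n. cmod (\<phi> (w n))) \<longlonglongrightarrow> 1"
proof -
  note p = univalent_self_mapD[OF phi]
  define d where "d n = 1 / real (n + 2)" for n
  have d: "0 < d n" "d n < 1" for n by (auto simp: d_def field_simps)
  have d0: "d \<longlonglongrightarrow> 0" unfolding d_def by real_asymp
  have nw: "cmod (w n) = 1 - d n" for n
    using d[of n] l unfolding w_def d_def[symmetric] by (simp only: norm_mult norm_of_real) simp
  have wd: "w n \<in> disk" for n using d[of n] by (simp add: nw)
  have pwd: "\<phi> (w n) \<in> disk" for n by (rule p(3)[OF wd])
  have lw: "cmod (l - w n) = d n" for n
  proof -
    have "l - w n = of_real (d n) * l" by (simp add: w_def d_def algebra_simps)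
    then show ?thesis using d[of n] l by (simp add: norm_mult)
  qed
  have low: "1 - cmod (\<phi> (w n)) \<le> L * d n" for n
  proof -
    have "1 - cmod (\<phi> (w n)) \<le> cmod (\<phi> l - \<phi> (w n))" using norm_triangle_ineq2[of "\<phi> l" "\<phi> (w n)"] pl by simp
    also have "\<dots> \<le> L * cmod (l - w n)" using l wd[of n] by (intro lip) auto
    finally show ?thesis by (simp add: lw)
  qed
  show lim: "(\<lambda>n. cmod (\<phi> (w n))) \<longlonglongrightarrow> 1"
  proof (rule tendsto_sandwich)
    show "(\<lambda>n. 1 - L * d n) \<longlonglongrightarrow> 1" using tendsto_diff[OF tendsto_const tendsto_mult[OF tendsto_const d0], of 1 L] by simp
    show "\<forall>\<^sub>F n in sequentially. 1 - L * d n \<le> cmod (\<phi> (w n))"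
      using low by (intro always_eventually allI) (smt (verit))
    show "\<forall>\<^sub>F n in sequentially. cmod (\<phi> (w n)) \<le> 1"
      using pwd by (intro always_eventually allI) (simp add: less_imp_le)
  qed simp
  define a where "a n = norm (rkernel (\<phi> (w n)))" for n
  define b where "b n = norm (rkernel (w n))" for n
  have ab: "0 < a n" "0 < b n" for n using norm_rkernel_pos wd pwd by (auto simp: a_def b_def)
  \<comment> \<open>From \<open>1 - |\<phi> w|\<^sup>2 \<le> 2 L d\<close> and \<open>1 - |w|\<^sup>2 \<ge> d\<close>; it may be negative for small \<open>n\<close>, where the bound
    below holds because \<^const>\<open>sqrt\<close> is monotone on all reals.\<close>
  define m where "m n = (1 - ln (2 * L * d n)) / (1 - ln (d n))" for n
  have m1: "m \<longlonglongrightarrow> 1"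
    unfolding m_def d_def using L by real_asymp
  have ratio: "sqrt (m n) \<le> a n / b n" for n
  proof -
    have "1 - (cmod (\<phi> (w n)))\<^sup>2 = (1 - cmod (\<phi> (w n))) * (1 + cmod (\<phi> (w n)))"
      by (simp add: power2_eq_square algebra_simps)
    also have "\<dots> \<le> (L * d n) * 2" using low[of n] pwd[of n] L d[of n] by (intro mult_mono) auto
    finally have "1 - (cmod (\<phi> (w n)))\<^sup>2 \<le> 2 * L * d n" by simp
    moreover have "0 < 1 - (cmod (\<phi> (w n)))\<^sup>2" using pwd[of n] by (simp add: power_less_one_iff)
    ultimately have "ln (1 - (cmod (\<phi> (w n)))\<^sup>2) \<le> ln (2 * L * d n)" by simp
    then have a2: "1 - ln (2 * L * d n) \<le> (a n)\<^sup>2" by (simp add: a_def norm_rkernel_sq[OF pwd])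
    have "d n * d n \<le> d n * 1" using d[of n] by (intro mult_left_mono) auto
    then have "d n \<le> 1 - (cmod (w n))\<^sup>2" by (simp add: nw power2_eq_square algebra_simps)
    then have "ln (d n) \<le> ln (1 - (cmod (w n))\<^sup>2)" using d[of n] by (subst ln_le_cancel_iff) auto
    then have b2: "(b n)\<^sup>2 \<le> 1 - ln (d n)" by (simp add: b_def norm_rkernel_sq[OF wd])
    have pos: "0 < 1 - ln (d n)" using b2 ab(2)[of n] by (smt (verit) zero_less_power)
    have "m n \<le> (a n)\<^sup>2 / (1 - ln (d n))" unfolding m_def using a2 pos by (intro divide_right_mono) auto
    also have "\<dots> \<le> (a n)\<^sup>2 / (b n)\<^sup>2" using b2 pos ab(2)[of n] by (intro divide_left_mono mult_pos_pos) auto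
    finally have "m n \<le> (a n / b n)\<^sup>2" by (simp add: power_divide)
    then have "sqrt (m n) \<le> sqrt ((a n / b n)\<^sup>2)" by (rule real_sqrt_le_mono)
    then show ?thesis using ab[of n] by simp
  qed
  define s where "s n = (cmod (dfun (nkernel (\<phi> (w n))) (\<phi> 0)))\<^sup>2" for n
  have s0: "s \<longlonglongrightarrow> 0"
  proof -
    have "cmod (dfun (nkernel (\<phi> (w n))) (\<phi> 0)) = cmod (dinner (rkernel (\<phi> 0)) (nkernel (\<phi> (w n))))" for n
    proof -
      have "dfun (nkernel (\<phi> (w n))) (\<phi> 0) = dinner (nkernel (\<phi> (w n))) (rkernel (\<phi> 0))"
        by (rule dinner_rkernel[symmetric]) (rule p(3), simp)
      also have "\<dots> = cnj (dinner (rkernel (\<phi> 0)) (nkernel (\<phi> (w n))))" by (rule dinner_commute)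
      finally show ?thesis by (simp only: complex_mod_cnj)
    qed
    then have "s = (\<lambda>n. (cmod (dinner (rkernel (\<phi> 0)) (nkernel (\<phi> (w n)))))\<^sup>2)" by (simp add: s_def fun_eq_iff)
    moreover have "(\<lambda>n. (cmod (dinner (rkernel (\<phi> 0)) (nkernel (\<phi> (w n)))))\<^sup>2) \<longlonglongrightarrow> (cmod 0)\<^sup>2"
      by (intro tendsto_intros nkernel_weakly_null pwd lim)
    ultimately show ?thesis by simp
  qed
  have close: "(norm (comp_op \<phi> (nkernel (\<phi> (w n))) - nkernel (w n)))\<^sup>2 \<le> s n + 2 - 2 * sqrt (m n)" for n
  proof -
    let ?u = "comp_op \<phi> (nkernel (\<phi> (w n)))"
    have "dfun (rkernel (\<phi> (w n))) (\<phi> (w n)) = of_real ((a n)\<^sup>2)"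
      unfolding a_def dinner_self[symmetric] dinner_rkernel[OF pwd] ..
    then have "dfun ?u (w n) = of_real (a n)"
      using wd[of n] ab(1)[of n] unfolding dfun_comp_op[OF phi]
      by (simp add: nkernel_def a_def[symmetric] power2_eq_square)
    then have "dinner ?u (nkernel (w n)) = of_real (a n / b n)"
      unfolding dinner_nkernel[OF wd] b_def[symmetric] by simp
    then have "inner ?u (nkernel (w n)) = a n / b n" by (simp add: Re_dinner[symmetric])
    moreover have "(norm ?u)\<^sup>2 \<le> s n + 1"
      using norm_comp_op_le[OF phi, of "nkernel (\<phi> (w n))"] norm_nkernel[OF pwd] by (simp add: s_def)
    moreover have "(norm (?u - nkernel (w n)))\<^sup>2 = (norm ?u)\<^sup>2 - 2 * inner ?u (nkernel (w n)) + (norm (nkernel (w n)))\<^sup>2"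
      using dot_norm_neg[of ?u "nkernel (w n)"] by simp
    ultimately show ?thesis using ratio[of n] norm_nkernel[OF wd, of n] by simp
  qed
  have up: "(\<lambda>n. s n + 2 - 2 * sqrt (m n)) \<longlonglongrightarrow> 0 + 2 - 2 * sqrt 1"
    by (intro tendsto_intros s0 m1)
  have "(\<lambda>n. (norm (comp_op \<phi> (nkernel (\<phi> (w n))) - nkernel (w n)))\<^sup>2) \<longlonglongrightarrow> 0"
    by (rule tendsto_sandwich[OF _ _ tendsto_const, where h = "\<lambda>n. s n + 2 - 2 * sqrt (m n)"])
      (use close up in auto)
  then have "(\<lambda>n. sqrt ((norm (comp_op \<phi> (nkernel (\<phi> (w n))) - nkernel (w n)))\<^sup>2)) \<longlonglongrightarrow> sqrt 0"
    by (rule tendsto_real_sqrt)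
  then have "(\<lambda>n. norm (comp_op \<phi> (nkernel (\<phi> (w n))) - nkernel (w n))) \<longlonglongrightarrow> 0" by simp
  then show "(\<lambda>n. comp_op \<phi> (nkernel (\<phi> (w n))) - nkernel (w n)) \<longlonglongrightarrow> 0"
    by (rule tendsto_norm_zero_cancel)
qed

text \<open>
  Let \<open>f\<close>, \<open>g\<close>, \<open>v\<close> be the normalised kernels at \<open>\<phi> w\<close>, \<open>\<psi> w\<close> and \<open>w\<close>. Then
  \<open>\<langle>T f, g\<rangle> = \<langle>C\<^sub>\<phi> f, C\<^sub>\<psi> g\<rangle>\<close> tends to \<open>\<parallel>v\<parallel>\<^sup>2 = 1\<close>, as both vectors approach \<open>v\<close>. For compact \<open>K\<close> a
  subsequence of \<open>K f\<close> converges to some \<open>c\<close>, and \<open>\<langle>c, g\<rangle>\<close> tends to 0 because \<open>g\<close>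
  is weakly null. So \<open>\<langle>(T - K) f, g\<rangle>\<close> tends to 1 along the subsequence.
\<close>

lemma ess_norm_ge_1:
  assumes phi: "univalent_self_map \<phi>" and psi: "univalent_self_map \<psi>"
    and l: "cmod l = 1" "cmod (\<phi> l) = 1" "cmod (\<psi> l) = 1"
    and L: "L > 0" "\<And>z w. cmod z \<le> 1 \<Longrightarrow> cmod w \<le> 1 \<Longrightarrow> cmod (\<phi> z - \<phi> w) \<le> L * cmod (z - w)"
    and M: "M > 0" "\<And>z w. cmod z \<le> 1 \<Longrightarrow> cmod w \<le> 1 \<Longrightarrow> cmod (\<psi> z - \<psi> w) \<le> M * cmod (z - w)"
  shows "1 \<le> ess_norm (hadjoint (comp_op \<psi>) \<circ> comp_op \<phi>)"
proof (rule ess_norm_ge)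
  let ?T = "hadjoint (comp_op \<psi>) \<circ> comp_op \<phi>"
  fix K assume K: "compact_op K"
  note b = bounded_clinear_comp_op[OF phi] bounded_clinear_comp_op[OF psi]
  define w where "w n = of_real (1 - 1 / real (n + 2)) * l" for n
  have wd: "w n \<in> disk" for n
  proof -
    have "cmod (w n) = \<bar>1 - 1 / real (n + 2)\<bar>" unfolding w_def norm_mult norm_of_real by (simp add: l)
    also have "\<dots> < 1" by (simp add: field_simps)
    finally show ?thesis by simp
  qed
  have pd: "\<phi> (w n) \<in> disk" "\<psi> (w n) \<in> disk" for n
    by (rule univalent_self_mapD(3)[OF phi wd], rule univalent_self_mapD(3)[OF psi wd])
  define f where "f n = nkernel (\<phi> (w n))" for n
  define g where "g n = nkernel (\<psi> (w n))" for n
  define u where "u n = comp_op \<phi> (f n)" for n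
  define u' where "u' n = comp_op \<psi> (g n)" for n
  define v where "v n = nkernel (w n)" for n
  have uv: "(\<lambda>n. u n - v n) \<longlonglongrightarrow> 0"
    unfolding u_def v_def f_def by (rule comp_op_nkernel_asymptotics(1)[OF phi l(1,2) L w_def])
  have u'v: "(\<lambda>n. u' n - v n) \<longlonglongrightarrow> 0"
    unfolding u'_def v_def g_def by (rule comp_op_nkernel_asymptotics(1)[OF psi l(1,3) M w_def])
  have plim: "(\<lambda>n. cmod (\<psi> (w n))) \<longlonglongrightarrow> 1"
    by (rule comp_op_nkernel_asymptotics(2)[OF psi l(1,3) M w_def])
  have nv: "norm (v n) = 1" and nf: "norm (f n) = 1" and ng: "norm (g n) = 1" for n
    by (simp_all only: v_def f_def g_def norm_nkernel[OF wd] norm_nkernel[OF pd(1)] norm_nkernel[OF pd(2)])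
  have inner1: "(\<lambda>n. inner (u n) (u' n)) \<longlonglongrightarrow> 1"
  proof -
    have eq: "inner (u n) (u' n) = 1 + (inner (u n - v n) (u' n - v n) + (inner (u n - v n) (v n) + inner (v n) (u' n - v n)))" for n
      using nv[of n] by (simp add: inner_diff_left inner_diff_right norm_eq_1 inner_commute)
    have bz: "(\<lambda>n. inner (x n) (y n)) \<longlonglongrightarrow> 0" if "x \<longlonglongrightarrow> 0" "\<And>n. norm (y n) = 1" for x y :: "nat \<Rightarrow> dirichlet"
    proof (rule Lim_null_comparison)
      show "\<forall>\<^sub>F n in sequentially. norm (inner (x n) (y n)) \<le> norm (x n)"
        using Cauchy_Schwarz_ineq2[of "x _" "y _"] that(2) by (auto intro!: always_eventually simp: that(2))
      show "(\<lambda>n. norm (x n)) \<longlonglongrightarrow> 0" using that(1) by (rule tendsto_norm_zero)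
    qed
    have "(\<lambda>n. inner (v n) (u' n - v n)) \<longlonglongrightarrow> 0"
      using bz[OF u'v nv] by (simp add: inner_commute)
    moreover have "(\<lambda>n. inner (u n - v n) (u' n - v n)) \<longlonglongrightarrow> inner 0 (0::dirichlet)"
      by (intro tendsto_inner uv u'v)
    ultimately have "(\<lambda>n. 1 + (inner (u n - v n) (u' n - v n) + (inner (u n - v n) (v n) + inner (v n) (u' n - v n)))) \<longlonglongrightarrow> 1 + (inner 0 (0::dirichlet) + (0 + 0))"
      by (intro tendsto_add tendsto_const bz[OF uv nv])
    then show ?thesis unfolding eq by simp
  qed
  have cpt: "compact (closure (K ` cball 0 1))" using K by (simp add: compact_op_def)
  have "\<forall>n. K (f n) \<in> closure (K ` cball 0 1)"
    using nf closure_subset[of "K ` cball 0 1"] by (auto simp: subset_iff)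
  then obtain c r where r: "strict_mono r" and c: "((\<lambda>n. K (f n)) \<circ> r) \<longlonglongrightarrow> c"
    using cpt[unfolded compact_def, THEN spec, of "\<lambda>n. K (f n)"] by blast
  define N where "N = onorm (\<lambda>h. ?T h - K h)"
  have bl: "bounded_linear (\<lambda>h. ?T h - K h)"
    by (intro bounded_linear_sub bounded_linear_bounded_clinear bounded_linear_compact_op K bounded_clinear_hadjoint_comp b)
  have low: "inner (u (r n)) (u' (r n)) - norm (K (f (r n)) - c) - inner c (g (r n)) \<le> N" for n
  proof -
    have "inner (?T (f (r n))) (g (r n)) = inner (u (r n)) (u' (r n))"
      unfolding Re_dinner[symmetric] dinner_hadjoint_comp[OF b(2)] u_def u'_def ..
    then have "inner (u (r n)) (u' (r n)) - inner (K (f (r n)) - c) (g (r n)) - inner c (g (r n))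
        = inner (?T (f (r n)) - K (f (r n))) (g (r n))" by (simp add: inner_diff_left)
    also have "\<dots> \<le> norm (?T (f (r n)) - K (f (r n))) * norm (g (r n))" by (rule norm_cauchy_schwarz)
    also have "\<dots> \<le> N" using onorm[OF bl, of "f (r n)"] by (simp add: ng nf N_def)
    finally have "inner (u (r n)) (u' (r n)) - inner (K (f (r n)) - c) (g (r n)) - inner c (g (r n)) \<le> N" .
    moreover have "inner (K (f (r n)) - c) (g (r n)) \<le> norm (K (f (r n)) - c)"
      using norm_cauchy_schwarz[of "K (f (r n)) - c" "g (r n)"] by (simp add: ng)
    ultimately show ?thesis by linarith
  qed
  have "(\<lambda>n. inner c (g n)) \<longlonglongrightarrow> Re 0"
    unfolding Re_dinner[symmetric] g_def by (intro tendsto_Re nkernel_weakly_null pd plim)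
  then have cg: "(\<lambda>n. inner c (g (r n))) \<longlonglongrightarrow> 0"
    using LIMSEQ_subseq_LIMSEQ[OF _ r, of "\<lambda>n. inner c (g n)"] by (simp add: o_def)
  have "(\<lambda>n. K (f (r n)) - c) \<longlonglongrightarrow> 0" using LIM_zero[OF c] by (simp add: o_def)
  then have kc: "(\<lambda>n. norm (K (f (r n)) - c)) \<longlonglongrightarrow> 0" by (rule tendsto_norm_zero)
  have uu: "(\<lambda>n. inner (u (r n)) (u' (r n))) \<longlonglongrightarrow> 1"
    using LIMSEQ_subseq_LIMSEQ[OF inner1 r] by (simp add: o_def)
  have "(\<lambda>n. inner (u (r n)) (u' (r n)) - norm (K (f (r n)) - c) - inner c (g (r n))) \<longlonglongrightarrow> 1 - 0 - 0"
    by (intro tendsto_diff uu kc cg)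
  then have "1 - 0 - 0 \<le> N" by (rule LIMSEQ_le_const2) (use low in blast)
  then show "1 \<le> onorm (\<lambda>h. ?T h - K h)" by (simp add: N_def)
qed

section \<open>Linear fractional self-maps\<close>

text \<open>
  Both statements follow from
  \<open>\<phi> z - \<phi> w = (ad - bc)(z - w) / ((cz + d)(cw + d))\<close> once the denominator is known to be bounded
  away from 0 on the closed disk. A pole on the circle is impossible: \<open>|\<phi>| < 1\<close> gives
  \<open>|az + b| \<le> |cz + d|\<close> up to the circle, so the numerator would vanish there too and
  \<open>ad - bc\<close> would be 0.
\<close>

lemma linear_fractional_self_map_regular:
  assumes "linear_fractional_self_map \<phi>"
  shows "univalent_self_map \<phi>"
    and "\<exists>L>0. \<forall>z w. cmod z \<le> 1 \<longrightarrow> cmod w \<le> 1 \<longrightarrow> cmod (\<phi> z - \<phi> w) \<le> L * cmod (z - w)"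
proof -
  obtain a b c d where det: "a * d - b * c \<noteq> 0" and pole: "\<And>z. z \<in> disk \<Longrightarrow> c * z + d \<noteq> 0"
    and eq: "\<And>z. z \<in> cball 0 1 \<Longrightarrow> \<phi> z = (a * z + b) / (c * z + d)" and self: "\<phi> ` disk \<subseteq> disk"
    using assms unfolding linear_fractional_self_map_def by blast
  have nz: "c * z + d \<noteq> 0" if z: "z \<in> cball 0 1" for z
  proof
    assume 0: "c * z + d = 0"
    have le: "cmod (a * y + b) \<le> cmod (c * y + d)" if "y \<in> disk" for y
    proof -
      have "cmod (\<phi> y) < 1" using self that by (auto simp: image_subset_iff)
      moreover have "a * y + b = \<phi> y * (c * y + d)" using eq[of y] pole[OF that] that by simp
      ultimately show ?thesis by (simp add: norm_mult mult_left_le_one_le)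
    qed
    have "cmod (a * z + b) - cmod (c * z + d) \<le> 0"
    proof (rule continuous_le_on_closure[where S = disk and f = "\<lambda>z. cmod (a * z + b) - cmod (c * z + d)" and x = z])
      show "continuous_on (closure disk) (\<lambda>z. cmod (a * z + b) - cmod (c * z + d))"
        by (intro continuous_intros)
    qed (use z le in auto)
    then have "a * z + b = 0" using 0 by simp
    then have "b = - (a * z)" "d = - (c * z)" using 0 by (simp_all add: add_eq_0_iff2)
    then show False using det by simp
  qed
  have diff: "\<phi> z - \<phi> w = (a * d - b * c) * (z - w) / ((c * z + d) * (c * w + d))"
    if "z \<in> cball 0 1" "w \<in> cball 0 1" for z w
    using nz[OF that(1)] nz[OF that(2)] unfolding eq[OF that(1)] eq[OF that(2)]
    by (simp add: divide_simps) (simp add: algebra_simps)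
  show "univalent_self_map \<phi>"
    unfolding univalent_self_map_def
  proof (intro conjI self)
    have "(\<lambda>z. (a * z + b) / (c * z + d)) holomorphic_on disk"
      using pole by (intro holomorphic_intros) auto
    then show "\<phi> holomorphic_on disk" by (rule holomorphic_transform) (simp add: eq)
    show "inj_on \<phi> disk"
    proof (rule inj_onI)
      fix z w assume zw: "z \<in> disk" "w \<in> disk" "\<phi> z = \<phi> w"
      then have cb: "z \<in> cball 0 1" "w \<in> cball 0 1" by auto
      then show "z = w" using diff[OF cb] zw(3) det nz[OF cb(1)] nz[OF cb(2)] by simp
    qed
  qed
  have "continuous_on (cball 0 1) (\<lambda>z. cmod (c * z + d))" by (intro continuous_intros)
  then obtain y where y: "y \<in> cball 0 1" "\<And>z. z \<in> cball 0 1 \<Longrightarrow> cmod (c * y + d) \<le> cmod (c * z + d)"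
    using continuous_attains_inf[of "cball (0::complex) 1" "\<lambda>z. cmod (c * z + d)"] by auto
  define m where "m = cmod (c * y + d)"
  have m: "m > 0" using nz[OF y(1)] by (simp add: m_def)
  show "\<exists>L>0. \<forall>z w. cmod z \<le> 1 \<longrightarrow> cmod w \<le> 1 \<longrightarrow> cmod (\<phi> z - \<phi> w) \<le> L * cmod (z - w)"
  proof (intro exI conjI allI impI)
    show "0 < cmod (a * d - b * c) / (m * m)" using det m by simp
    fix z w assume "cmod z \<le> 1" "cmod w \<le> 1"
    then have cb: "z \<in> cball 0 1" "w \<in> cball 0 1" by auto
    have "cmod (\<phi> z - \<phi> w) = cmod (a * d - b * c) * cmod (z - w) / (cmod (c * z + d) * cmod (c * w + d))"
      unfolding diff[OF cb] by (simp add: norm_mult norm_divide)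
    also have "\<dots> \<le> cmod (a * d - b * c) * cmod (z - w) / (m * m)"
      using m y(2)[OF cb(1)] y(2)[OF cb(2)] by (intro divide_left_mono mult_mono mult_pos_pos) (auto simp: m_def)
    finally show "cmod (\<phi> z - \<phi> w) \<le> cmod (a * d - b * c) / (m * m) * cmod (z - w)" by simp
  qed
qed

lemma self_map_closed_disk_norm_le_1:
  assumes phi: "univalent_self_map \<phi>" and cont: "continuous_on (cball 0 1) \<phi>" and z: "cmod z \<le> 1"
  shows "cmod (\<phi> z) \<le> 1"
proof (rule continuous_le_on_closure[where S = disk and f = "\<lambda>z. cmod (\<phi> z)" and x = z])
  show "continuous_on (closure disk) (\<lambda>z. cmod (\<phi> z))" using cont by (simp add: continuous_on_norm)
  show "z \<in> closure disk" using z by simp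
  show "cmod (\<phi> y) \<le> 1" if "y \<in> disk" for y
    using univalent_self_mapD(3)[OF phi that] by simp
qed

theorem theorem5p3:
  fixes \<phi> \<psi> :: "complex \<Rightarrow> complex"
  assumes "linear_fractional_self_map \<phi>" and "linear_fractional_self_map \<psi>"
  shows "ess_norm (hadjoint (comp_op \<psi>) \<circ> comp_op \<phi>) =
    (if \<phi> -` sphere 0 1 \<inter> \<psi> -` sphere 0 1 \<inter> sphere 0 1 = {} then 0 else 1)"
proof -
  note phi = linear_fractional_self_map_regular(1)[OF assms(1)]
    and psi = linear_fractional_self_map_regular(1)[OF assms(2)]
  obtain L where L: "L > 0" "\<And>z w. cmod z \<le> 1 \<Longrightarrow> cmod w \<le> 1 \<Longrightarrow> cmod (\<phi> z - \<phi> w) \<le> L * cmod (z - w)"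
    using linear_fractional_self_map_regular(2)[OF assms(1)] by blast
  obtain M where M: "M > 0" "\<And>z w. cmod z \<le> 1 \<Longrightarrow> cmod w \<le> 1 \<Longrightarrow> cmod (\<psi> z - \<psi> w) \<le> M * cmod (z - w)"
    using linear_fractional_self_map_regular(2)[OF assms(2)] by blast
  have cont: "continuous_on (cball 0 1) \<phi>" "continuous_on (cball 0 1) \<psi>"
    using L M
    by (auto intro!: lipschitz_on_continuous_on[where L = L and f = \<phi>]
        lipschitz_on_continuous_on[where L = M and f = \<psi>] lipschitz_onI simp: dist_norm)
  show ?thesis
  proof (cases "\<phi> -` sphere 0 1 \<inter> \<psi> -` sphere 0 1 \<inter> sphere 0 1 = {}")
    case True
    define h where "h z = min (cmod (\<phi> z)) (cmod (\<psi> z))" for z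
    have "continuous_on (cball 0 1) h" unfolding h_def by (intro continuous_intros cont)
    then obtain y where y: "y \<in> cball 0 1" "\<And>z. z \<in> cball 0 1 \<Longrightarrow> h z \<le> h y"
      using continuous_attains_sup[of "cball (0::complex) 1" h] by auto
    have "h y < 1"
    proof (cases "y \<in> disk")
      case True
      then show ?thesis using univalent_self_mapD(3)[OF phi True] by (simp add: h_def)
    next
      case False
      then have "y \<in> sphere 0 1" using y(1) by simp
      then have "cmod (\<phi> y) \<noteq> 1 \<or> cmod (\<psi> y) \<noteq> 1" using True by auto
      moreover have "cmod (\<phi> y) \<le> 1" "cmod (\<psi> y) \<le> 1"
        using y(1) self_map_closed_disk_norm_le_1[OF phi cont(1), of y] self_map_closed_disk_norm_le_1[OF psi cont(2), of y] by auto
      ultimately show ?thesis by (auto simp: h_def)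
    qed
    moreover have "0 \<le> h y" by (simp add: h_def)
    moreover have "cmod (\<phi> z) \<le> h y \<or> cmod (\<psi> z) \<le> h y" if "z \<in> disk" for z
      using y(2)[of z] that by (auto simp: h_def)
    ultimately have "ess_norm (hadjoint (comp_op \<psi>) \<circ> comp_op \<phi>) = 0"
      by (intro ess_norm_eq_0[OF phi psi, of "h y"])
    then show ?thesis using True by simp
  next
    case False
    then obtain l where l: "cmod l = 1" "cmod (\<phi> l) = 1" "cmod (\<psi> l) = 1" by auto
    have "ess_norm (hadjoint (comp_op \<psi>) \<circ> comp_op \<phi>) = 1"
      by (intro antisym ess_norm_le_1[OF phi psi] ess_norm_ge_1[OF phi psi l L M])
    then show ?thesis using False by simp
  qed
qed

end
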